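(* Let $\Omega\subset\mathbb{C}$ be a bounded multi-connected domain whose boundary consists of $m+1$ disjoint simple analytic closed curves, and let $N\ge1$. Let $\theta:\Omega\to M_N(\mathbb{C})$ be a holomorphic function such that $\|\theta(z)\|\le1$ for every $z\in\Omega$. Then there is a sequence of $M_N(\mathbb{C})$-valued inner functions on $\Omega$ which converges to $\theta$ uniformly on every compact subset of $\Omega$.
   Context: $M_N(\mathbb{C})$ is the algebra of $N\times N$ complex matrices with the operator norm. An $M_N(\mathbb{C})$-valued inner function on $\Omega$ is a bounded holomorphic function $\Omega\to M_N(\mathbb{C})$ whose boundary values (non-tangential limits, which exist almost everywhere on $\partial\Omega$) are unitary matrices almost everywhere on $\partial\Omega$. "Almost everywhere" is with respect to arc length on $\partial\Omega$, equivalently with respect to harmonic measure $\omega_{z_0}$ for any $z_0\in\Omega$. *)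

theory Defs
  imports "HOL-Complex_Analysis.Complex_Analysis"
begin

text \<open>
  $N \times N$ complex matrices are rendered as \<open>complex^'n^'n\<close> with $N$ the cardinality of \<open>'n\<close>.
  The norm of this type is the Hilbert--Schmidt norm, hence the separate \<open>opnorm\<close>;
  the norm of \<open>complex^'n\<close> is the usual Hermitian norm.
\<close>

definition opnorm :: "complex^'n^'m \<Rightarrow> real" where
  "opnorm A = onorm (\<lambda>v. A *v v)"

definition adjoint_matrix :: "complex^'n^'m \<Rightarrow> complex^'m^'n" where
  "adjoint_matrix A = (\<chi> i j. cnj (A $ j $ i))"

definition unitary_matrix :: "complex^'n^'n \<Rightarrow> bool" where
  "unitary_matrix A \<longleftrightarrow>
     adjoint_matrix A ** A = mat 1 \<and> A ** adjoint_matrix A = mat 1"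

definition matrix_holomorphic_on :: "(complex \<Rightarrow> complex^'n^'m) \<Rightarrow> complex set \<Rightarrow> bool"
    (infix "matrix'_holomorphic'_on" 50) where
  "F matrix_holomorphic_on S \<longleftrightarrow> (\<forall>i j. (\<lambda>z. F z $ i $ j) holomorphic_on S)"

text \<open>
  An analytic closed curve is the trace on the unit circle of a holomorphic map defined near the
  circle; the condition on the derivative says that the parametrization is regular (no cusps).
\<close>

definition simple_analytic_closed_curve :: "(real \<Rightarrow> complex) \<Rightarrow> bool" where
  "simple_analytic_closed_curve \<gamma> \<longleftrightarrow>
     simple_path \<gamma> \<and> pathfinish \<gamma> = pathstart \<gamma> \<and>
     (\<exists>U \<phi>. open U \<and> sphere 0 1 \<subseteq> U \<and> \<phi> holomorphic_on U \<and>
        (\<forall>w\<in>sphere 0 1. deriv \<phi> w \<noteq> 0) \<and>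
        (\<forall>t\<in>{0..1}. \<gamma> t = \<phi> (cis (2 * pi * t))))"

definition analytic_multi_connected_domain ::
    "complex set \<Rightarrow> nat \<Rightarrow> (nat \<Rightarrow> real \<Rightarrow> complex) \<Rightarrow> bool" where
  "analytic_multi_connected_domain \<Omega> m \<gamma> \<longleftrightarrow>
     open \<Omega> \<and> connected \<Omega> \<and> \<Omega> \<noteq> {} \<and> bounded \<Omega> \<and>
     (\<forall>k\<le>m. simple_analytic_closed_curve (\<gamma> k)) \<and>
     disjoint_family_on (\<lambda>k. path_image (\<gamma> k)) {..m} \<and>
     frontier \<Omega> = (\<Union>k\<le>m. path_image (\<gamma> k))"

text \<open>
  The measure \<open>\<bar>d\<gamma>\<bar>\<close> on the plane, carried by the image of the curve; for a regular simple closed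
  curve it does not depend on the parametrization.
\<close>

definition arc_length_measure :: "(real \<Rightarrow> complex) \<Rightarrow> complex measure" where
  "arc_length_measure \<gamma> =
     distr (density (lebesgue_on {0..1})
              (\<lambda>t. ennreal (norm (vector_derivative \<gamma> (at t within {0..1})))))
           borel \<gamma>"

definition approach_region :: "complex set \<Rightarrow> real \<Rightarrow> complex \<Rightarrow> complex set" where
  "approach_region \<Omega> \<alpha> p = {z \<in> \<Omega>. dist z p < (1 + \<alpha>) * infdist z (frontier \<Omega>)}"

definition has_nontangential_limit ::
    "complex set \<Rightarrow> (complex \<Rightarrow> 'a::topological_space) \<Rightarrow> complex \<Rightarrow> 'a \<Rightarrow> bool" where
  "has_nontangential_limit \<Omega> F p L \<longleftrightarrow>
     (\<forall>\<alpha>>0. (F \<longlongrightarrow> L) (at p within approach_region \<Omega> \<alpha> p))"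

text \<open>The parameters \<open>m\<close> and \<open>\<gamma>\<close> enter only through arc length on the boundary.\<close>

definition matrix_inner_function ::
    "complex set \<Rightarrow> nat \<Rightarrow> (nat \<Rightarrow> real \<Rightarrow> complex) \<Rightarrow> (complex \<Rightarrow> complex^'n^'n) \<Rightarrow> bool" where
  "matrix_inner_function \<Omega> m \<gamma> F \<longleftrightarrow>
     F matrix_holomorphic_on \<Omega> \<and>
     (\<exists>B. \<forall>z\<in>\<Omega>. opnorm (F z) \<le> B) \<and>
     (\<forall>k\<le>m. AE p in arc_length_measure (\<gamma> k).
        \<exists>L. has_nontangential_limit \<Omega> F p L \<and> unitary_matrix L)"

end

theory Submission
  imports Defs
begin

text \<open>
  By a Cayley transform it suffices to approximate a holomorphic \<open>F\<close> with \<open>Re F \<ge> c > 0\<close> by holomorphic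
  functions whose real part is nonnegative in \<open>\<Omega>\<close> and vanishes almost everywhere on the boundary.
  Near a boundary curve use a conformal coordinate \<open>w\<close> in which the curve is the unit circle. If \<open>E\<close>
  continues across the circle and \<open>E\<^sup>~\<close> is its reflected adjoint, then with \<open>v = w\<^sup>N\<close> the function
  \<open>T = (E - v E\<^sup>~) / (1 + v)\<close> is skew-Hermitian on the circle off the zeros of \<open>1 + v\<close>, has nonnegative
  real part just inside it, and converges to \<open>E\<close> further inside as \<open>N\<close> grows. Hence \<open>T - E\<close>, given near
  the boundary only, can be glued by Cauchy integrals to a function on all of \<open>\<Omega>\<close>, at the price of a
  tiny error that continues across the boundary. This error plus a tiny positive constant is the
  new \<open>E\<close>, and the step is repeated with errors of size \<open>16\<^sup>-\<^sup>n\<close>. The corrections converge locally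
  uniformly, and in approach regions at every boundary point that is eventually not within
  \<open>2\<^sup>-\<^sup>n\<close> of \<open>1 + v = 0\<close>; by Borel--Cantelli these are almost all boundary points.
\<close>

unbundle no fps_syntax

section \<open>Quadratic forms and the Cayley transform\<close>

text \<open>Contractions with unitary boundary values cannot be added, accretive functions can;
  after the Cayley transform the correction is an additive gluing problem. Cauchy integrals solve it
  on a domain with holes, where building a holomorphic function from the boundary values of its real
  part would meet the periods of harmonic conjugates. The price is a residual that spoils skewness
  on the boundary; since it continues across the boundary, it is a valid input for the same step,
  and this is what forces an iteration. The exponent N is chosen last and gets no upper bound, so
  the boundary estimates must be uniform in it: the set of circle points with |1 + w^N| < e has
  measure O(e) for every N, and in a Stolz angle at w0 the inequality |1 + w^N| < 4^-n forces N (1 -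
  |w|) to be small and hence |1 + w0^N| < 2^-n for large n. The rates are matched to this: residuals
  of order 16^-n divided by 4^-n leave the summable 4^-n, and the gap between 4^-n and 2^-n is a
  factor 2^-n that absorbs the aperture of the angle.\<close>

definition hform :: "complex^'n^'n \<Rightarrow> complex^'n \<Rightarrow> complex" where
  "hform A x = (\<Sum>i\<in>UNIV. \<Sum>j\<in>UNIV. A $ i $ j * x $ j * cnj (x $ i))"

definition accretive :: "real \<Rightarrow> complex^'n^'n \<Rightarrow> bool" where
  "accretive c A \<longleftrightarrow> (\<forall>x. c * (norm x)\<^sup>2 \<le> Re (hform A x))"

text \<open>By polarisation this says that \<open>A\<close> plus its adjoint is zero. The version
  with forms passes to sums and limits at once.\<close>

definition skew_hermitian :: "complex^'n^'n \<Rightarrow> bool" where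
  "skew_hermitian A \<longleftrightarrow> (\<forall>x. Re (hform A x) = 0)"

text \<open>This is (A - 1)(A + 1)^-1, written with a single inverse so that differences of Cayley
  transforms are differences of resolvents.\<close>

definition cayley :: "complex^'n^'n \<Rightarrow> complex^'n^'n" where
  "cayley A = mat 1 - 2 *\<^sub>R matrix_inv (A + mat 1)"

section \<open>Forms, the Hilbert-Schmidt norm and the operator norm\<close>

lemma hform_add: "hform (A + B) x = hform A x + hform B x"
  by (simp add: hform_def algebra_simps sum.distrib)

lemma hform_diff: "hform (A - B) x = hform A x - hform B x"
  by (simp add: hform_def algebra_simps sum_subtractf)

lemma hform_scaleR: "hform (r *\<^sub>R A) x = r *\<^sub>R hform A x"
  by (simp add: hform_def scaleR_sum_right)

lemma hform_adjoint: "hform (adjoint_matrix A) x = cnj (hform A x)"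
  unfolding hform_def adjoint_matrix_def cnj_sum
  by (subst sum.swap) (simp add: mult_ac)

lemma inner_eq_Re_sum:
  fixes x y :: "complex^'n"
  shows "x \<bullet> y = Re (\<Sum>i\<in>UNIV. x $ i * cnj (y $ i))"
  by (simp add: inner_vec_def inner_complex_def Re_sum)

lemma Re_hform: "Re (hform A x) = (A *v x) \<bullet> x"
  by (simp add: hform_def inner_eq_Re_sum matrix_vector_mult_def sum_distrib_right)

lemma hform_mat1: "hform (mat 1) x = of_real ((norm x)\<^sup>2)"
proof -
  have "hform (mat 1) x = (\<Sum>i\<in>UNIV. x $ i * cnj (x $ i))"
    by (simp add: hform_def mat_def if_distrib if_distribR cong: if_cong)
  also have "\<dots> = of_real (\<Sum>i\<in>UNIV. (norm (x $ i))\<^sup>2)"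
    by (simp only: complex_norm_square of_real_sum)
  also have "(\<Sum>i\<in>UNIV. (norm (x $ i))\<^sup>2) = (norm x)\<^sup>2"
    by (simp add: norm_vec_def L2_set_def sum_nonneg)
  finally show ?thesis .
qed

lemma norm_matrix_vector_mult_le:
  fixes A :: "complex^'n^'m"
  shows "norm (A *v x) \<le> norm A * norm x"
proof -
  have "norm ((A *v x) $ i) \<le> norm (A $ i) * norm x" for i
  proof -
    have "norm ((A *v x) $ i) \<le> (\<Sum>j\<in>UNIV. norm (A $ i $ j) * norm (x $ j))"
      unfolding matrix_vector_mult_def by (simp add: sum_norm_le norm_mult)
    also have "\<dots> \<le> norm (A $ i) * norm x"
      using L2_set_mult_ineq[of "\<lambda>j. norm (A $ i $ j)" "\<lambda>j. norm (x $ j)" UNIV]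
      by (simp add: norm_vec_def)
    finally show ?thesis .
  qed
  then have "norm (A *v x) \<le> L2_set (\<lambda>i. norm (A $ i) * norm x) UNIV"
    unfolding norm_vec_def[of "A *v x"] by (intro L2_set_mono) auto
  also have "\<dots> = norm A * norm x"
    by (simp add: norm_vec_def[of A] L2_set_left_distrib)
  finally show ?thesis .
qed

lemma norm_hform_le: "norm (hform A x) \<le> norm A * (norm x)\<^sup>2"
proof -
  have "hform A x = (\<Sum>i\<in>UNIV. (A *v x) $ i * cnj (x $ i))"
    by (simp add: hform_def matrix_vector_mult_def sum_distrib_right)
  also have "norm \<dots> \<le> (\<Sum>i\<in>UNIV. norm ((A *v x) $ i) * norm (x $ i))"
    by (rule sum_norm_le) (simp add: norm_mult)
  also have "\<dots> \<le> norm (A *v x) * norm x"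
    using L2_set_mult_ineq[of "\<lambda>j. norm ((A *v x) $ j)" "\<lambda>j. norm (x $ j)" UNIV]
    by (simp add: norm_vec_def)
  also have "\<dots> \<le> norm A * norm x * norm x"
    by (intro mult_right_mono norm_matrix_vector_mult_le) auto
  finally show ?thesis by (simp add: power2_eq_square mult.assoc)
qed

lemma opnorm_le:
  fixes A :: "complex^'n^'m"
  assumes "\<And>x. norm (A *v x) \<le> b * norm x"
  shows "opnorm A \<le> b"
  unfolding opnorm_def by (rule onorm_le) (rule assms)

lemma matrix_vector_mult_scaleR_right:
  "(A :: complex^'n^'m) *v (r *\<^sub>R x) = r *\<^sub>R (A *v x)"
  by (simp add: matrix_vector_mult_def vec_eq_iff scaleR_sum_right)

lemma matrix_vector_mult_scaleR_left:
  "(r *\<^sub>R A) *v x = r *\<^sub>R ((A :: complex^'n^'m) *v x)"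
  by (simp add: matrix_vector_mult_def vec_eq_iff scaleR_sum_right)

lemma bounded_linear_matrix_vector_mult:
  "bounded_linear (\<lambda>x. (A :: complex^'n^'m) *v x)"
proof (rule bounded_linear_intro[where K = "norm A"])
  show "norm (A *v x) \<le> norm x * norm A" for x
    using norm_matrix_vector_mult_le[of A x] by (simp add: mult.commute)
qed (simp_all add: matrix_vector_right_distrib matrix_vector_mult_scaleR_right)

lemma matrix_vector_mult_axis:
  "((A :: complex^'n^'m) *v axis j 1) $ i = A $ i $ j"
  by (simp add: matrix_vector_mult_def axis_def if_distrib cong: if_cong)

lemma norm_mult_le_opnorm: "norm ((A :: complex^'n^'m) *v x) \<le> opnorm A * norm x"
  unfolding opnorm_def by (rule onorm[OF bounded_linear_matrix_vector_mult])

lemma opnorm_nonneg: "0 \<le> opnorm (A :: complex^'n^'m)"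
  unfolding opnorm_def by (rule onorm_pos_le[OF bounded_linear_matrix_vector_mult])

lemma opnorm_triangle: "opnorm (A + B :: complex^'n^'m) \<le> opnorm A + opnorm B"
  unfolding opnorm_def matrix_vector_mult_add_rdistrib
  by (intro onorm_triangle bounded_linear_matrix_vector_mult)

lemma opnorm_scaleR: "opnorm (r *\<^sub>R A :: complex^'n^'m) = \<bar>r\<bar> * opnorm A"
proof -
  have "(\<lambda>x. (r *\<^sub>R A) *v x) = (\<lambda>x. r *\<^sub>R (A *v x))"
    by (simp add: fun_eq_iff matrix_vector_mult_def vec_eq_iff scaleR_sum_right)
  then show ?thesis
    unfolding opnorm_def by (simp add: onorm_scaleR bounded_linear_matrix_vector_mult)
qed

lemma norm_matrix_le_entries:
  fixes A :: "complex^'n^'m"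
  assumes "\<And>i j. norm (A $ i $ j) \<le> e"
  shows "norm A \<le> real CARD('m) * (real CARD('n) * e)"
proof -
  have row: "norm (A $ i) \<le> real CARD('n) * e" for i
  proof -
    have "norm (A $ i) \<le> (\<Sum>j\<in>UNIV. norm (A $ i $ j))"
      unfolding norm_vec_def by (rule L2_set_le_sum) auto
    also have "\<dots> \<le> (\<Sum>j\<in>(UNIV::'n set). e)" by (intro sum_mono assms)
    finally show ?thesis by simp
  qed
  have "norm A \<le> (\<Sum>i\<in>UNIV. norm (A $ i))"
    unfolding norm_vec_def[of A] by (rule L2_set_le_sum) auto
  also have "\<dots> \<le> (\<Sum>i\<in>(UNIV::'m set). real CARD('n) * e)" by (intro sum_mono row)
  finally show ?thesis by simp
qed

lemma norm_entry_le: "norm ((A :: complex^'n^'m) $ i $ j) \<le> norm A"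
  by (meson Finite_Cartesian_Product.norm_nth_le order_trans)

section \<open>Accretive matrices and their Cayley transforms\<close>

lemma accretive_add: "accretive a A \<Longrightarrow> accretive b B \<Longrightarrow> accretive (a + b) (A + B)"
  unfolding accretive_def hform_add by (simp add: algebra_simps add_mono)

lemma accretive_mono: "accretive a A \<Longrightarrow> b \<le> a \<Longrightarrow> accretive b A"
  unfolding accretive_def by (meson mult_right_mono order_trans zero_le_power2)

lemma accretive_norm: "accretive (- norm A) A"
  unfolding accretive_def
proof
  fix x show "- norm A * (norm x)\<^sup>2 \<le> Re (hform A x)"
    using norm_hform_le[of A x] abs_Re_le_cmod[of "hform A x"] by linarith
qed

lemma accretive_scaled_mat1: "accretive r (r *\<^sub>R mat 1)"
  by (simp add: accretive_def hform_scaleR hform_mat1)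

text \<open>The form of \<open>A + mat 1\<close> has real part at least |x|^2, and Cauchy-Schwarz
  does the rest. This one bound yields both invertibility of \<open>A + mat 1\<close> and
  contractivity of its inverse.\<close>

lemma accretive_mult_vector_ge:
  assumes "accretive 0 A"
  shows "norm x \<le> norm ((A + mat 1) *v x)"
proof (cases "x = 0")
  case False
  have "(norm x)\<^sup>2 \<le> Re (hform (A + mat 1) x)"
    using assms by (simp add: accretive_def hform_add hform_mat1)
  also have "\<dots> \<le> norm ((A + mat 1) *v x) * norm x"
    unfolding Re_hform by (rule norm_cauchy_schwarz)
  finally show ?thesis using False by (simp add: power2_eq_square)
qed simp

lemma invertible_if_norm_ge:
  fixes A :: "complex^'n^'n"
  assumes "c > 0" "\<And>x. c * norm x \<le> norm (A *v x)"
  shows "invertible A"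
proof -
  have "\<And>x. A *v x = 0 \<Longrightarrow> x = 0"
    using assms by (metis mult_le_0_iff norm_eq_zero norm_le_zero_iff not_less)
  then show ?thesis
    using invertible_left_inverse matrix_left_invertible_ker by blast
qed

lemma matrix_inv_unique:
  fixes A :: "complex^'n^'n"
  assumes "A ** B = mat 1"
  shows "matrix_inv A = B"
proof -
  have BA: "B ** A = mat 1" using assms matrix_left_right_inverse by blast
  then have "\<exists>A'. A ** A' = mat 1 \<and> A' ** A = mat 1" using assms by blast
  then have "A ** matrix_inv A = mat 1 \<and> matrix_inv A ** A = mat 1"
    unfolding matrix_inv_def by (rule someI_ex)
  then show ?thesis by (metis BA matrix_mul_assoc matrix_mul_lid matrix_mul_rid)
qed

lemma matrix_inv:
  fixes A :: "complex^'n^'n"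
  assumes "invertible A"
  shows "A ** matrix_inv A = mat 1" "matrix_inv A ** A = mat 1"
  using assms matrix_inv_unique[of A] matrix_left_right_inverse unfolding invertible_def by metis+

lemma accretive_invertible: "accretive 0 A \<Longrightarrow> invertible (A + mat 1)"
  by (rule invertible_if_norm_ge[of 1]) (simp_all add: accretive_mult_vector_ge)

lemma norm_matrix_inv_accretive:
  assumes "accretive 0 A"
  shows "norm (matrix_inv (A + mat 1) *v x) \<le> norm x"
  using accretive_mult_vector_ge[OF assms, of "matrix_inv (A + mat 1) *v x"]
  by (simp add: matrix_vector_mul_assoc matrix_inv[OF accretive_invertible[OF assms]])

lemma cayley_mult_vector:
  assumes "accretive 0 A"
  shows "cayley A *v ((A + mat 1) *v y) = (A - mat 1) *v y"
proof -
  have "matrix_inv (A + mat 1) *v ((A + mat 1) *v y) = y"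
    by (simp add: matrix_vector_mul_assoc matrix_inv[OF accretive_invertible[OF assms]])
  then have "cayley A *v ((A + mat 1) *v y) = (A + mat 1) *v y - 2 *\<^sub>R y"
    unfolding cayley_def
    by (simp only: matrix_vector_mult_diff_rdistrib matrix_vector_mult_scaleR_left matrix_vector_mul_lid)
  then show ?thesis
    by (simp add: matrix_vector_mult_diff_rdistrib matrix_vector_mult_add_rdistrib vec_eq_iff scaleR_conv_of_real)
qed

text \<open>Polarisation of |Ay + y|^2 - |Ay - y|^2. The sign of the form decides everything:
  nonnegative real part gives a contraction, zero real part an isometry.\<close>

lemma norm_cayley_identity:
  assumes "accretive 0 A"
  shows "(norm ((A + mat 1) *v y))\<^sup>2 - (norm (cayley A *v ((A + mat 1) *v y)))\<^sup>2 = 4 * Re (hform A y)"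
proof -
  have "(norm (A *v y + y))\<^sup>2 - (norm (A *v y - y))\<^sup>2 = 4 * ((A *v y) \<bullet> y)"
    unfolding power2_norm_eq_inner by (simp add: inner_simps inner_commute)
  then show ?thesis
    unfolding cayley_mult_vector[OF assms] Re_hform
    by (simp add: matrix_vector_mult_diff_rdistrib matrix_vector_mult_add_rdistrib)
qed

lemma opnorm_cayley_le:
  assumes "accretive 0 A"
  shows "opnorm (cayley A) \<le> 1"
proof (rule opnorm_le)
  fix x
  define y where "y = matrix_inv (A + mat 1) *v x"
  have x: "x = (A + mat 1) *v y"
    by (simp add: y_def matrix_vector_mul_assoc matrix_inv[OF accretive_invertible[OF assms]])
  have "0 \<le> Re (hform A y)" using assms by (simp add: accretive_def)
  then have "(norm (cayley A *v x))\<^sup>2 \<le> (norm x)\<^sup>2"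
    unfolding x using norm_cayley_identity[OF assms, of y] by linarith
  then show "norm (cayley A *v x) \<le> 1 * norm x" by (metis mult_1 norm_ge_zero power2_le_imp_le)
qed

lemma inner_adjoint_matrix:
  fixes A :: "complex^'n^'m"
  shows "(A *v x) \<bullet> y = x \<bullet> (adjoint_matrix A *v y)"
  unfolding inner_eq_Re_sum matrix_vector_mult_def adjoint_matrix_def vec_lambda_beta
    cnj_sum sum_distrib_left sum_distrib_right
  by (subst sum.swap) (simp add: mult_ac)

text \<open>The inner product used here is the real part of the Hermitian one. It is still
  nondegenerate and has the same adjoint, so real polarisation suffices.\<close>

lemma unitary_if_isometry:
  assumes "\<And>x. norm ((A :: complex^'n^'n) *v x) = norm x"
  shows "unitary_matrix A"
proof -
  have "(A *v x) \<bullet> (A *v y) = x \<bullet> y" for x y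
    using assms[of "x + y"] assms[of x] assms[of y]
    by (simp add: dot_norm matrix_vector_right_distrib)
  then have "x \<bullet> (adjoint_matrix A *v (A *v y) - y) = 0" for x y
    by (simp add: inner_diff_right flip: inner_adjoint_matrix)
  then have "adjoint_matrix A *v (A *v y) = y" for y
    by (metis eq_iff_diff_eq_0 inner_eq_zero_iff)
  then have "adjoint_matrix A ** A = mat 1"
    by (simp add: matrix_eq flip: matrix_vector_mul_assoc)
  then show ?thesis
    unfolding unitary_matrix_def using matrix_left_right_inverse by auto
qed

lemma skew_hermitian_accretive: "skew_hermitian A \<Longrightarrow> accretive 0 A"
  by (simp add: skew_hermitian_def accretive_def)

lemma unitary_cayley:
  assumes "skew_hermitian A"
  shows "unitary_matrix (cayley A)"
proof (rule unitary_if_isometry)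
  fix x
  note acc = skew_hermitian_accretive[OF assms]
  define y where "y = matrix_inv (A + mat 1) *v x"
  have x: "x = (A + mat 1) *v y"
    by (simp add: y_def matrix_vector_mul_assoc matrix_inv[OF accretive_invertible[OF acc]])
  have "(norm (cayley A *v x))\<^sup>2 = (norm x)\<^sup>2"
    using norm_cayley_identity[OF acc, of y] x assms by (simp add: skew_hermitian_def)
  then show "norm (cayley A *v x) = norm x" by simp
qed

text \<open>Resolvent identity: the difference of the two inverses is (A + 1)^-1 (A - B) (B + 1)^-1,
  whose outer factors are contractions; the 2 is the coefficient in \<open>cayley\<close>. The
  constant is uniform over accretive matrices, so approximation may be done entirely before the
  Cayley transform.\<close>

lemma opnorm_cayley_diff_le:
  assumes "accretive 0 A" "accretive 0 B"
  shows "opnorm (cayley A - cayley B) \<le> 2 * norm (A - B)"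
proof (rule opnorm_le)
  fix x
  let ?a = "matrix_inv (A + mat 1)" and ?b = "matrix_inv (B + mat 1)"
  note iA = matrix_inv[OF accretive_invertible[OF assms(1)]]
  note iB = matrix_inv[OF accretive_invertible[OF assms(2)]]
  have ab: "(A + mat 1) *v (?b *v x) = x + (A - B) *v (?b *v x)"
  proof -
    have "(A + mat 1) *v (?b *v x) = (B + mat 1) *v (?b *v x) + (A - B) *v (?b *v x)"
      by (simp add: algebra_simps flip: matrix_vector_mult_add_rdistrib)
    then show ?thesis by (simp add: matrix_vector_mul_assoc iB)
  qed
  have "?a *v ((A + mat 1) *v w) = w" for w
    by (simp add: matrix_vector_mul_assoc iA)
  from this[of "?b *v x"] have "?a *v ((A + mat 1) *v (?b *v x)) = ?b *v x" .
  then have "?b *v x - ?a *v x = ?a *v ((A - B) *v (?b *v x))"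
    unfolding ab by (metis add_diff_cancel_left' matrix_vector_right_distrib)
  moreover have "(cayley A - cayley B) *v x = 2 *\<^sub>R (?b *v x - ?a *v x)"
    unfolding cayley_def
    by (simp add: matrix_vector_mult_def vec_eq_iff scaleR_sum_right sum_subtractf algebra_simps)
  ultimately have "norm ((cayley A - cayley B) *v x) = 2 * norm (?a *v ((A - B) *v (?b *v x)))"
    by simp
  also have "\<dots> \<le> 2 * (norm (A - B) * norm x)"
    using norm_matrix_inv_accretive[OF assms(1), of "(A - B) *v (?b *v x)"]
      norm_matrix_vector_mult_le[of "A - B" "?b *v x"]
      mult_left_mono[OF norm_matrix_inv_accretive[OF assms(2), of x], of "norm (A - B)"]
    by simp
  finally show "norm ((cayley A - cayley B) *v x) \<le> 2 * norm (A - B) * norm x" by simp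
qed

section \<open>Holomorphy and limits of inverses and Cayley transforms\<close>

lemma matrix_inv_entry:
  fixes A :: "complex^'n^'n"
  assumes "invertible A"
  shows "matrix_inv A $ i $ j = det (\<chi> k l. if l = i then axis j 1 $ k else A $ k $ l) / det A"
proof -
  have "A *v (matrix_inv A *v axis j 1) = axis j 1"
    by (simp add: matrix_vector_mul_assoc matrix_inv[OF assms])
  then have "matrix_inv A *v axis j 1 =
      (\<chi> i. det (\<chi> k l. if l = i then axis j 1 $ k else A $ k $ l) / det A)"
    using cramer[of A "matrix_inv A *v axis j 1" "axis j 1"] assms by (simp add: invertible_det_nz)
  moreover have "(matrix_inv A *v axis j 1) $ i = matrix_inv A $ i $ j"
    by (simp add: matrix_vector_mult_axis)
  ultimately show ?thesis by simp
qed

lemma holomorphic_on_det: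
  assumes "\<And>i j. (\<lambda>z. (A z :: complex^'n^'n) $ i $ j) holomorphic_on S"
  shows "(\<lambda>z. det (A z)) holomorphic_on S"
  unfolding det_def by (intro holomorphic_intros assms)

text \<open>By Cramer's rule the entries of the inverse are quotients of determinants, that is, of
  polynomials in holomorphic entries.\<close>

lemma matrix_holomorphic_on_inv:
  fixes A :: "complex \<Rightarrow> complex^'n^'n"
  assumes "A matrix_holomorphic_on S" "\<And>z. z \<in> S \<Longrightarrow> invertible (A z)"
  shows "(\<lambda>z. matrix_inv (A z)) matrix_holomorphic_on S"
  unfolding matrix_holomorphic_on_def
proof (intro allI)
  fix i j
  have "(\<lambda>z. det (\<chi> k l. if l = i then axis j 1 $ k else A z $ k $ l) / det (A z)) holomorphic_on S"
  proof (intro holomorphic_intros holomorphic_on_det)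
    show "(\<lambda>z. (\<chi> k l. if l = i then axis j 1 $ k else A z $ k $ l) $ ia $ ja) holomorphic_on S" for ia ja
      using assms(1) by (cases "ja = i") (auto simp: matrix_holomorphic_on_def)
  qed (use assms in \<open>auto simp: matrix_holomorphic_on_def invertible_det_nz\<close>)
  then show "(\<lambda>z. matrix_inv (A z) $ i $ j) holomorphic_on S"
    by (rule holomorphic_transform) (simp add: matrix_inv_entry assms)
qed

lemma matrix_holomorphic_cayley:
  assumes "A matrix_holomorphic_on S" "\<And>z. z \<in> S \<Longrightarrow> accretive 0 (A z)"
  shows "(\<lambda>z. cayley (A z)) matrix_holomorphic_on S"
proof -
  have 1: "(\<lambda>z. A z + mat 1) matrix_holomorphic_on S"
    using assms(1) unfolding matrix_holomorphic_on_def by (auto intro!: holomorphic_intros)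
  have "(\<lambda>z. matrix_inv (A z + mat 1)) matrix_holomorphic_on S"
    using assms(2) by (intro matrix_holomorphic_on_inv 1 accretive_invertible)
  then show ?thesis
    unfolding matrix_holomorphic_on_def cayley_def by (auto intro!: holomorphic_intros simp: scaleR_conv_of_real)
qed

lemma tendsto_cayley:
  fixes L :: "complex^'n^'n"
  assumes "(f \<longlongrightarrow> L) F" "accretive 0 L" "\<forall>\<^sub>F z in F. accretive 0 (f z)"
  shows "((\<lambda>z. cayley (f z)) \<longlongrightarrow> cayley L) F"
proof -
  have ent: "norm (M $ i $ j) \<le> opnorm M" for M :: "complex^'n^'n" and i j
  proof -
    have "norm (M $ i $ j) = norm ((M *v axis j 1) $ i)"
      by (simp add: matrix_vector_mult_axis)
    also have "\<dots> \<le> norm (M *v axis j 1)" by (rule Finite_Cartesian_Product.norm_nth_le)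
    also have "\<dots> \<le> opnorm M" using norm_mult_le_opnorm[of M "axis j 1"] by (simp add: norm_axis_1)
    finally show ?thesis .
  qed
  have "((\<lambda>z. cayley (f z) $ i $ j) \<longlongrightarrow> cayley L $ i $ j) F" for i j
  proof (rule tendsto_norm_zero_cancel[THEN LIM_zero_cancel])
    show "((\<lambda>z. norm (cayley (f z) $ i $ j - cayley L $ i $ j)) \<longlongrightarrow> 0) F"
    proof (rule tendsto_sandwich[OF _ _ tendsto_const])
      show "\<forall>\<^sub>F z in F. norm (cayley (f z) $ i $ j - cayley L $ i $ j) \<le> 2 * norm (f z - L)"
        using assms(3)
      proof eventually_elim
        case (elim z)
        show ?case using ent[of "cayley (f z) - cayley L" i j] opnorm_cayley_diff_le[OF elim assms(2)] by simp
      qed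
      show "((\<lambda>z. 2 * norm (f z - L)) \<longlongrightarrow> 0) F"
        using assms(1) by (intro tendsto_mult_right_zero tendsto_norm_zero LIM_zero)
    qed simp
  qed
  then show ?thesis by (intro vec_tendstoI)
qed

lemma tendsto_hform: "(f \<longlongrightarrow> L) F \<Longrightarrow> ((\<lambda>z. hform (f z) x) \<longlongrightarrow> hform L x) F"
  unfolding hform_def by (intro tendsto_intros)

section \<open>Gluing along one boundary curve\<close>

definition annulus :: "real \<Rightarrow> real \<Rightarrow> complex set" where
  "annulus a b = {w. a < norm w \<and> norm w < b}"

lemma mem_annulus [simp]: "w \<in> annulus a b \<longleftrightarrow> a < norm w \<and> norm w < b"
  by (simp add: annulus_def)

lemma open_annulus [simp, intro]: "open (annulus a b)"
proof -
  have "annulus a b = norm -` {a<..<b}" by auto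
  then show ?thesis by (simp add: open_vimage continuous_on_norm_id)
qed

lemma connected_annulus_complex: "connected (annulus a b)"
  unfolding annulus_def using connected_annulus(1)[where a = "0::complex" and ?r1.0 = a and ?r2.0 = b] by simp

lemma compact_norm_between: "compact {w::complex. a \<le> norm w \<and> norm w \<le> b}"
proof -
  have "{w::complex. a \<le> norm w \<and> norm w \<le> b} = cball 0 b \<inter> norm -` {a..}" by auto
  moreover have "closed (norm -` {a..} :: complex set)"
    by (intro closed_vimage) (auto intro: continuous_intros)
  ultimately show ?thesis by (simp add: compact_Int_closed)
qed

lemma holomorphic_cauchy_transform:
  assumes r: "r > 0" and G: "continuous_on (sphere 0 r) G" and psi: "continuous_on (sphere 0 r) \<psi>"
    and S: "open S" "S \<inter> \<psi> ` sphere 0 r = {}"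
  shows "(\<lambda>z. contour_integral (circlepath 0 r) (\<lambda>\<omega>. G \<omega> / (\<psi> \<omega> - z))) holomorphic_on S"
proof -
  define c where "c t = circlepath 0 r t" for t
  define d where "d t = 2 * pi * \<i> * r * exp (2 * of_real pi * \<i> * t)" for t :: real
  have cc: "continuous_on A c" for A unfolding c_def circlepath by (intro continuous_intros)
  have cd: "continuous_on A d" for A unfolding d_def by (intro continuous_intros)
  have c_sph: "c t \<in> sphere 0 r" for t
    using r unfolding c_def circlepath by (simp add: norm_mult)
  have cG: "continuous_on A (\<lambda>t. G (c t))" for A
    by (rule continuous_on_compose2[OF G cc]) (use c_sph in auto)
  have cpsi: "continuous_on A (\<lambda>t. \<psi> (c t))" for A
    by (rule continuous_on_compose2[OF psi cc]) (use c_sph in auto)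
  have eq: "contour_integral (circlepath 0 r) f = integral (cbox 0 1) (\<lambda>t. f (c t) * d t)" for f
    unfolding contour_integral_integral c_def d_def by (simp add: vector_derivative_circlepath mult_ac)
  \<comment> \<open>The Leibniz rule for parameter integrals wants a convex parameter set, so
    holomorphy is obtained on convex pieces of \<open>S\<close> and afterwards read off on small
    balls.\<close>
  have "(\<lambda>z. integral (cbox 0 1) (\<lambda>t. G (c t) / (\<psi> (c t) - z) * d t)) holomorphic_on U"
    if U: "convex U" "U \<subseteq> S" for U
  proof (rule leibniz_rule_holomorphic[where fx = "\<lambda>z t. G (c t) / (\<psi> (c t) - z)\<^sup>2 * d t"])
    have nz: "\<psi> (c t) - z \<noteq> 0" if "z \<in> U" for z t
      using that U(2) S(2) c_sph by fastforce
    show "((\<lambda>z. G (c t) / (\<psi> (c t) - z) * d t) has_field_derivative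
        G (c t) / (\<psi> (c t) - z)\<^sup>2 * d t) (at z within U)" if "z \<in> U" for z t
      using nz[OF that, of t] by (auto intro!: derivative_eq_intros simp: power2_eq_square)
    show "(\<lambda>t. G (c t) / (\<psi> (c t) - z) * d t) integrable_on cbox 0 1" if "z \<in> U" for z
      using nz[OF that] by (intro integrable_continuous continuous_intros cG cpsi cd) auto
    have cpr: "continuous_on A (\<lambda>p :: complex \<times> real. f (snd p))"
      if "\<And>B. continuous_on B f" for f :: "real \<Rightarrow> complex" and A
      by (rule continuous_on_compose2[OF that]) (auto intro: continuous_intros)
    show "continuous_on (U \<times> cbox 0 1) (\<lambda>(z, t). G (c t) / (\<psi> (c t) - z)\<^sup>2 * d t)"
      unfolding case_prod_beta
      by (intro continuous_intros cpr[OF cG] cpr[OF cpsi] cpr[OF cd]) (use nz in auto)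
  qed (use U in auto)
  then have *: "(\<lambda>z. contour_integral (circlepath 0 r) (\<lambda>\<omega>. G \<omega> / (\<psi> \<omega> - z))) holomorphic_on U"
    if "convex U" "U \<subseteq> S" for U
    using that by (simp add: eq)
  show ?thesis
  proof (rule holomorphic_onI)
    fix z assume "z \<in> S"
    then obtain e where e: "e > 0" "ball z e \<subseteq> S" using S(1) open_contains_ball by blast
    have "(\<lambda>z. contour_integral (circlepath 0 r) (\<lambda>\<omega>. G \<omega> / (\<psi> \<omega> - z))) field_differentiable at z"
      by (rule holomorphic_on_imp_differentiable_at[OF *[OF convex_ball e(2)]]) (use e in auto)
    then show "(\<lambda>z. contour_integral (circlepath 0 r) (\<lambda>\<omega>. G \<omega> / (\<psi> \<omega> - z))) field_differentiable at z within S"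
      by (rule field_differentiable_at_within)
  qed
qed

text \<open>The two circles are joined by the radial homotopy, which stays in the closed annulus
  between them.\<close>

lemma contour_integral_circlepath_eq:
  assumes "f holomorphic_on S" "open S" "0 < r" "r \<le> s"
    and "\<And>w. r \<le> norm w \<Longrightarrow> norm w \<le> s \<Longrightarrow> w \<in> S"
  shows "contour_integral (circlepath 0 r) f = contour_integral (circlepath 0 s) f"
proof (rule Cauchy_theorem_homotopic_loops[of S])
  show "homotopic_loops S (circlepath 0 r) (circlepath 0 s)"
  proof (rule homotopic_loops_linear)
    fix t :: real and x
    assume "t \<in> {0..1}"
    show "closed_segment (circlepath 0 r t) (circlepath 0 s t) \<subseteq> S"
    proof
      fix w assume "w \<in> closed_segment (circlepath 0 r t) (circlepath 0 s t)"
      then obtain u where u: "0 \<le> u" "u \<le> 1"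
        "w = (1 - u) *\<^sub>R circlepath 0 r t + u *\<^sub>R circlepath 0 s t"
        by (auto simp: closed_segment_def)
      have "w = of_real ((1 - u) * r + u * s) * exp (2 * of_real pi * \<i> * of_real t)"
        unfolding u circlepath by (simp add: scaleR_conv_of_real algebra_simps)
      then have "norm w = \<bar>(1 - u) * r + u * s\<bar>"
        by (simp only: norm_mult norm_of_real) (simp add: norm_exp_eq_Re)
      moreover have ge: "r \<le> (1 - u) * r + u * s"
        using mult_left_mono[OF assms(4) u(1)] by (simp add: algebra_simps)
      moreover have "(1 - u) * r + u * s \<le> s"
        using mult_left_mono[OF assms(4), of "1 - u"] u(2) by (simp add: algebra_simps)
      ultimately show "w \<in> S"
        using assms(3) by (intro assms(5)) simp_all
    qed
  qed simp_all
qed (use assms in auto)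

text \<open>A conformal coordinate near one boundary curve, which is the image of the unit circle.
  The domain does not enter yet; later it will be on the side of radii below 1.\<close>

locale collar =
  fixes \<psi> :: "complex \<Rightarrow> complex" and a b :: real
  assumes a: "0 < a" "a < 1" and b: "1 < b"
    and hol: "\<psi> holomorphic_on annulus a b"
    and inj: "inj_on \<psi> (annulus a b)"
begin

text \<open>Substituting \<open>\<psi> \<omega>\<close> for the integration variable shows that this
  is the Cauchy integral of \<open>H\<close> composed with the inverse of \<open>\<psi>\<close> over
  the image of the circle of radius \<open>r\<close>. Working in the parameter plane avoids
  integrating over the image curve.\<close>

definition cauchy :: "real \<Rightarrow> (complex \<Rightarrow> complex) \<Rightarrow> complex \<Rightarrow> complex" where
  "cauchy r H z = contour_integral (circlepath 0 r) (\<lambda>\<omega>. H \<omega> * deriv \<psi> \<omega> / (\<psi> \<omega> - z)) / (2 * pi * \<i>)"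

lemma cont: "continuous_on (annulus a b) \<psi>" and cont_deriv: "continuous_on (annulus a b) (deriv \<psi>)"
  using hol holomorphic_on_imp_continuous_on holomorphic_deriv open_annulus by blast+

lemma open_image: "a \<le> r \<Longrightarrow> s \<le> b \<Longrightarrow> open (\<psi> ` annulus r s)"
  by (rule open_mapping_thm3) (auto intro: holomorphic_on_subset[OF hol] inj_on_subset[OF inj])

lemma image_disjoint: "A \<subseteq> annulus a b \<Longrightarrow> B \<subseteq> annulus a b \<Longrightarrow> A \<inter> B = {} \<Longrightarrow> \<psi> ` A \<inter> \<psi> ` B = {}"
  using inj_on_image_Int[OF inj, of A B] by simp

lemma sphere_subset: "a < r \<Longrightarrow> r < b \<Longrightarrow> sphere 0 r \<subseteq> annulus a b"
  by auto

lemma holomorphic_cauchy: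
  assumes "a < r" "r < b" "continuous_on (sphere 0 r) H" "open S" "S \<inter> \<psi> ` sphere 0 r = {}"
  shows "cauchy r H holomorphic_on S"
proof -
  have "(\<lambda>z. contour_integral (circlepath 0 r) (\<lambda>\<omega>. H \<omega> * deriv \<psi> \<omega> / (\<psi> \<omega> - z))) holomorphic_on S"
    using assms a sphere_subset[of r]
    by (intro holomorphic_cauchy_transform continuous_intros)
       (auto intro: continuous_on_subset[OF cont] continuous_on_subset[OF cont_deriv])
  then show ?thesis unfolding cauchy_def by (intro holomorphic_intros) auto
qed

text \<open>By compactness the image of the circle has a positive distance from the complement of
  \<open>V\<close>, which bounds the kernel. The constant is fixed before \<open>H\<close> and
  \<open>e\<close>; this uniformity is what later permits choosing the exponent of the twist after
  the constant.\<close>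

lemma cauchy_bound:
  assumes r: "a < r" "r < b" and V: "open V" "\<psi> ` sphere 0 r \<subseteq> V"
  shows "\<exists>C>0. \<forall>H e z. continuous_on (sphere 0 r) H \<longrightarrow> (\<forall>w\<in>sphere 0 r. norm (H w) \<le> e) \<longrightarrow> z \<notin> V
           \<longrightarrow> norm (cauchy r H z) \<le> C * e"
proof -
  have r0: "r > 0" using a r by simp
  have "compact (\<psi> ` sphere 0 r)"
    by (intro compact_continuous_image continuous_on_subset[OF cont] sphere_subset r) auto
  then obtain d where d: "d > 0" "\<And>x y. x \<in> \<psi> ` sphere 0 r \<Longrightarrow> y \<in> - V \<Longrightarrow> d \<le> dist x y"
    using separate_compact_closed[of "\<psi> ` sphere 0 r" "- V"] V by (metis closed_Compl disjoint_eq_subset_Compl double_complement)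
  have "bounded (deriv \<psi> ` sphere 0 r)"
    by (intro compact_imp_bounded compact_continuous_image continuous_on_subset[OF cont_deriv] sphere_subset r) auto
  then obtain M where M: "M > 0" "\<And>w. w \<in> sphere 0 r \<Longrightarrow> norm (deriv \<psi> w) \<le> M"
    unfolding bounded_pos by auto
  have "norm (cauchy r H z) \<le> M / d * r * e"
    if H: "continuous_on (sphere 0 r) H" "\<And>w. w \<in> sphere 0 r \<Longrightarrow> norm (H w) \<le> e" and z: "z \<notin> V" for H e z
  proof -
    have "norm (H (of_real r)) \<le> e" using H(2) r0 by simp
    then have e0: "0 \<le> e" using norm_ge_zero order_trans by blast
    let ?f = "\<lambda>\<omega>. H \<omega> * deriv \<psi> \<omega> / (\<psi> \<omega> - z)"
    have nz: "\<psi> w - z \<noteq> 0" if "w \<in> sphere 0 r" for w using imageI[OF that, of \<psi>] z V by auto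
    have "continuous_on (sphere 0 r) ?f"
      using sphere_subset[OF r]
      by (intro continuous_intros H) 
         (auto intro: continuous_on_subset[OF cont] continuous_on_subset[OF cont_deriv] simp: nz[simplified])
    then have "?f contour_integrable_on circlepath 0 r"
      using r0 by (intro contour_integrable_continuous_circlepath) simp
    then have "(?f has_contour_integral contour_integral (circlepath 0 r) ?f) (circlepath 0 r)"
      by (rule has_contour_integral_integral)
    then have "norm (contour_integral (circlepath 0 r) ?f) \<le> (e * M / d) * (2 * pi * r)"
    proof (rule has_contour_integral_bound_circlepath)
      show "0 \<le> e * M / d" using e0 M d by simp
      fix x :: complex assume "norm (x - 0) = r"
      then have x: "x \<in> sphere 0 r" by simp
      have "d \<le> norm (\<psi> x - z)" using d(2)[of "\<psi> x" z] x z by (auto simp: dist_norm)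
      then show "norm (?f x) \<le> e * M / d"
        unfolding norm_divide norm_mult using H(2)[OF x] M(2)[OF x] d(1) e0 M(1)
        by (intro frac_le mult_mono) auto
    qed (rule r0)
    then show ?thesis
      unfolding cauchy_def norm_divide by (simp add: norm_mult field_simps)
  qed
  then show ?thesis using M d r0 by (intro exI[of _ "M / d * r"]) auto
qed

text \<open>Dividing out the factor \<open>\<psi> \<omega> - \<psi> w\<close> reduces this to the Cauchy kernel in the parameter plane.\<close>

lemma cauchy_jump:
  assumes H: "H holomorphic_on annulus c 1" and c: "a \<le> c" "c < r" "s < 1"
    and w: "r < norm w" "norm w < s"
  shows "cauchy s H (\<psi> w) = H w + cauchy r H (\<psi> w)"
proof -
  let ?A = "annulus c 1"
  have wA: "w \<in> ?A" using w c by auto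
  have sub: "?A \<subseteq> annulus a b" using b c by auto
  note hol' = holomorphic_on_subset[OF hol sub]
  define D where "D = (\<lambda>\<omega>. if \<omega> = w then deriv \<psi> w else (\<psi> \<omega> - \<psi> w) / (\<omega> - w))"
  have D: "D holomorphic_on ?A" unfolding D_def by (rule pole_lemma_open[OF hol']) auto
  have Dnz: "D \<omega> \<noteq> 0" if "\<omega> \<in> ?A" for \<omega>
  proof (cases "\<omega> = w")
    case True
    have "deriv \<psi> w \<noteq> 0"
      by (rule holomorphic_injective_imp_regular[OF hol _ inj]) (use wA sub in auto)
    then show ?thesis using True by (simp add: D_def)
  next
    case False
    then have "\<psi> \<omega> \<noteq> \<psi> w" using inj_onD[OF inj, of \<omega> w] that wA sub by blast
    then show ?thesis using False by (simp add: D_def)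
  qed
  define K where "K = (\<lambda>\<omega>. H \<omega> * deriv \<psi> \<omega> / D \<omega>)"
  have K: "K holomorphic_on ?A" unfolding K_def
    by (intro holomorphic_intros H D Dnz holomorphic_deriv[OF hol']) auto
  have Kw: "K w = H w" using Dnz[OF wA] by (simp add: K_def D_def)
  \<comment> \<open>\<open>K\<close> over (\<omega> - w) splits into the holomorphic
    \<open>\<Phi>\<close> and \<open>H w\<close> times the elementary kernel. The integral of
    \<open>\<Phi>\<close> is the same over both circles; only the winding number of the elementary
    part changes, from 0 to 1, as the circle crosses \<open>w\<close>.\<close>
  define \<Phi> where "\<Phi> = (\<lambda>\<omega>. if \<omega> = w then deriv K w else (K \<omega> - K w) / (\<omega> - w))"
  have Phi: "\<Phi> holomorphic_on ?A" unfolding \<Phi>_def by (rule pole_lemma_open[OF K]) auto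
  have r0: "r > 0" and rs: "r < s" and s1: "s < 1" using a c w by auto
  have split: "contour_integral (circlepath 0 t) (\<lambda>\<omega>. H \<omega> * deriv \<psi> \<omega> / (\<psi> \<omega> - \<psi> w)) =
      contour_integral (circlepath 0 t) \<Phi> + H w * (2 * pi * \<i> * winding_number (circlepath 0 t) w)"
    if t: "c < t" "t < 1" "t \<noteq> norm w" for t
  proof -
    have t0: "t > 0" using a c t by auto
    have cP: "continuous_on (path_image (circlepath 0 t)) \<Phi>"
      using t t0 by (intro continuous_on_subset[OF holomorphic_on_imp_continuous_on[OF Phi]]) auto
    have cI: "continuous_on (path_image (circlepath 0 t)) (\<lambda>\<omega>. 1 / (\<omega> - w))"
      using t t0 by (intro continuous_intros) auto
    have "contour_integral (circlepath 0 t) (\<lambda>\<omega>. H \<omega> * deriv \<psi> \<omega> / (\<psi> \<omega> - \<psi> w)) =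
        contour_integral (circlepath 0 t) (\<lambda>\<omega>. \<Phi> \<omega> + H w * (1 / (\<omega> - w)))"
    proof (rule contour_integral_cong[OF refl])
      fix \<omega> assume "\<omega> \<in> path_image (circlepath 0 t)"
      then have "norm \<omega> = t" using t0 by simp
      then have ne: "\<omega> \<noteq> w" and "\<omega> \<in> ?A" using t by auto
      then have "\<psi> \<omega> \<noteq> \<psi> w" using inj_onD[OF inj, of \<omega> w] wA sub ne by blast
      then have "H \<omega> * deriv \<psi> \<omega> / (\<psi> \<omega> - \<psi> w) = K \<omega> / (\<omega> - w)"
        using ne by (simp add: K_def D_def)
      then show "H \<omega> * deriv \<psi> \<omega> / (\<psi> \<omega> - \<psi> w) = \<Phi> \<omega> + H w * (1 / (\<omega> - w))"
        using ne Kw by (simp add: \<Phi>_def diff_divide_distrib)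
    qed
    also have "\<dots> = contour_integral (circlepath 0 t) \<Phi> + H w * contour_integral (circlepath 0 t) (\<lambda>\<omega>. 1 / (\<omega> - w))"
      using contour_integrable_continuous_circlepath[OF cP] contour_integrable_continuous_circlepath[OF cI]
      by (simp only: contour_integral_add contour_integral_lmul contour_integrable_lmul)
    also have "contour_integral (circlepath 0 t) (\<lambda>\<omega>. 1 / (\<omega> - w)) = 2 * pi * \<i> * winding_number (circlepath 0 t) w"
      using t t0 by (subst winding_number_valid_path) auto
    finally show ?thesis .
  qed
  have "winding_number (circlepath 0 s) w = 1"
    using w by (intro winding_number_circlepath) auto
  moreover have "winding_number (circlepath 0 r) w = 0"
    using w r0 by (intro winding_number_zero_outside[of _ "cball 0 r"]) auto
  moreover have "contour_integral (circlepath 0 r) \<Phi> = contour_integral (circlepath 0 s) \<Phi>"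
    using c w r0 rs by (intro contour_integral_circlepath_eq[OF Phi]) auto
  ultimately show ?thesis
    unfolding cauchy_def using split[of s] split[of r] c rs w by (simp add: field_simps)
qed

text \<open>Between the two circles, \<open>H\<close> is the difference of its Cauchy integrals over
  the outer and the inner one. So the outer integral, followed by \<open>H\<close> plus the inner
  integral nearer to the curve, is a single function \<open>h\<close>; its deviation
  \<open>E\<close> from \<open>H\<close> is the inner integral, which does not notice the unit
  circle and continues across it. Smallness of \<open>H\<close> is asked only in the band between
  the circles, so \<open>H\<close> may blow up at the curve.\<close>

lemma glue_single:
  assumes "a \<le> c" "c < r" "r < s" "s < 1"
  shows "\<exists>C>0. \<forall>H e. H holomorphic_on annulus c 1 \<longrightarrow> (\<forall>w. r \<le> norm w \<and> norm w \<le> s \<longrightarrow> norm (H w) \<le> e) \<longrightarrow>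
    (\<exists>h E. h holomorphic_on - \<psi> ` sphere 0 1 \<and> E holomorphic_on annulus s b \<and>
      (\<forall>w\<in>annulus s b. norm (E w) \<le> C * e) \<and> (\<forall>w\<in>annulus s 1. h (\<psi> w) = H w + E w) \<and>
      (\<forall>z. z \<notin> \<psi> ` annulus s 1 \<longrightarrow> norm (h z) \<le> C * e))"
proof -
  \<comment> \<open>Cutting halfway keeps every point at a fixed distance from the circle whose
    integral is used there: beyond radius \<open>m\<close> the inner one, elsewhere the outer
    one.\<close>
  define m where "m = (r + s) / 2"
  have m: "r < m" "m < s" using assms by (auto simp: m_def)
  have "\<psi> ` sphere 0 r \<subseteq> \<psi> ` annulus a m" "\<psi> ` sphere 0 s \<subseteq> \<psi> ` annulus m 1"
    using assms m by (auto intro!: image_mono)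
  moreover have "open (\<psi> ` annulus a m)" "open (\<psi> ` annulus m 1)"
    using assms m a b by (auto intro!: open_image)
  moreover have "a < r" "r < b" "a < s" "s < b" using assms b by auto
  ultimately have ex: "\<exists>C>0. \<forall>H e z. continuous_on (sphere 0 r) H \<longrightarrow> (\<forall>w\<in>sphere 0 r. norm (H w) \<le> e) \<longrightarrow>
       z \<notin> \<psi> ` annulus a m \<longrightarrow> norm (cauchy r H z) \<le> C * e"
     "\<exists>C>0. \<forall>H e z. continuous_on (sphere 0 s) H \<longrightarrow> (\<forall>w\<in>sphere 0 s. norm (H w) \<le> e) \<longrightarrow>
       z \<notin> \<psi> ` annulus m 1 \<longrightarrow> norm (cauchy s H z) \<le> C * e"
    by (intro cauchy_bound; simp)+
  obtain C0 where C0: "C0 > 0" "\<And>H e z. continuous_on (sphere 0 r) H \<Longrightarrow> (\<forall>w\<in>sphere 0 r. norm (H w) \<le> e) \<Longrightarrow>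
       z \<notin> \<psi> ` annulus a m \<Longrightarrow> norm (cauchy r H z) \<le> C0 * e"
    using ex(1) by blast
  obtain C1 where C1: "C1 > 0" "\<And>H e z. continuous_on (sphere 0 s) H \<Longrightarrow> (\<forall>w\<in>sphere 0 s. norm (H w) \<le> e) \<Longrightarrow>
       z \<notin> \<psi> ` annulus m 1 \<Longrightarrow> norm (cauchy s H z) \<le> C1 * e"
    using ex(2) by blast
  show ?thesis
  \<comment> \<open>\<open>C0\<close> and \<open>C1\<close> pay for the two Cauchy integrals; the 1
    pays for \<open>H\<close> itself, which is part of \<open>h\<close> between the radii
    \<open>m\<close> and \<open>s\<close>.\<close>
  proof (intro exI[of _ "C0 + C1 + 1"] conjI allI impI)
    show "C0 + C1 + 1 > 0" using C0 C1 by simp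
    fix H e
    assume H: "H holomorphic_on annulus c 1" and e: "\<forall>w. r \<le> norm w \<and> norm w \<le> s \<longrightarrow> norm (H w) \<le> e"
    have "norm (H (of_real r)) \<le> e" using e assms a by simp
    then have e0: "0 \<le> e" using norm_ge_zero order_trans by blast
    have contH: "continuous_on (sphere 0 t) H" if "c < t" "t < 1" for t
      using that by (intro continuous_on_subset[OF holomorphic_on_imp_continuous_on[OF H]]) auto
    have b0: "norm (cauchy r H z) \<le> C0 * e" if "z \<notin> \<psi> ` annulus a m" for z
      using that e assms by (intro C0 contH) auto
    have b1: "norm (cauchy s H z) \<le> C1 * e" if "z \<notin> \<psi> ` annulus m 1" for z
      using that e assms by (intro C1 contH) auto
    obtain g where g: "g holomorphic_on \<psi> ` annulus a b" "\<And>w. w \<in> annulus a b \<Longrightarrow> g (\<psi> w) = w"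
      using holomorphic_has_inverse[OF hol open_annulus inj] by metis
    \<comment> \<open>The cut at \<open>m\<close> is arbitrary: by the jump formula both expressions
      agree between the radii \<open>r\<close> and \<open>s\<close>, so \<open>h\<close> is given by
      one formula on each of two overlapping open sets.\<close>
    define h where "h z = (if z \<in> \<psi> ` annulus m 1 then H (g z) + cauchy r H z else cauchy s H z)" for z
    define E where "E w = cauchy r H (\<psi> w)" for w
    have le: "C0 * e \<le> (C0 + C1 + 1) * e" "C1 * e \<le> (C0 + C1 + 1) * e" "e + C0 * e \<le> (C0 + C1 + 1) * e"
      using e0 C0(1) C1(1) by (auto simp: algebra_simps)
    have sub: "annulus t 1 \<subseteq> annulus a b" if "a \<le> t" for t using that b by auto
    have sph: "sphere 0 t \<subseteq> annulus a b" if "a < t" "t \<le> 1" for t using that b by auto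
    have h1: "h z = H (g z) + cauchy r H z" if zr: "z \<in> \<psi> ` annulus r 1" for z
    proof (cases "z \<in> \<psi> ` annulus m 1")
      case False
      obtain w where w0: "z = \<psi> w" "w \<in> annulus r 1" using zr by blast
      then have w: "z = \<psi> w" "r < norm w" "norm w \<le> m" using False by auto
      then show ?thesis using False cauchy_jump[OF H, of r s w] assms m b g(2)[of w] by (simp add: h_def)
    qed (simp add: h_def)
    have h2: "h z = cauchy s H z" if zs: "z \<notin> \<psi> ` {w. s \<le> norm w \<and> norm w \<le> 1}" for z
    proof (cases "z \<in> \<psi> ` annulus m 1")
      case True
      then obtain w where w0: "z = \<psi> w" "w \<in> annulus m 1" by blast
      then have w: "z = \<psi> w" "m < norm w" "norm w < s" using zs by (auto simp: image_iff not_le)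
      then show ?thesis using True cauchy_jump[OF H, of r s w] assms m b g(2)[of w] by (simp add: h_def)
    qed (simp add: h_def)
    let ?U1 = "\<psi> ` annulus r 1" and ?U2 = "- \<psi> ` {w. s \<le> norm w \<and> norm w \<le> 1}"
      have cK: "compact (\<psi> ` {w. s \<le> norm w \<and> norm w \<le> 1})"
        using assms a b by (intro compact_continuous_image compact_norm_between continuous_on_subset[OF cont]) auto
      have o1: "open ?U1" using assms b by (intro open_image) auto
      have o2: "open ?U2" using cK compact_imp_closed by blast
      have "(\<lambda>z. H (g z) + cauchy r H z) holomorphic_on ?U1"
      proof (intro holomorphic_intros holomorphic_cauchy contH o1)
        have "H \<circ> g holomorphic_on ?U1"
        proof (rule holomorphic_on_compose_gen[OF _ H])
          show "g holomorphic_on ?U1" using sub[of r] assms by (intro holomorphic_on_subset[OF g(1)]) auto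
          show "g ` ?U1 \<subseteq> annulus c 1"
          proof (clarify)
            fix w assume "w \<in> annulus r 1"
            then show "g (\<psi> w) \<in> annulus c 1" using assms sub[of r] g(2)[of w] by auto
          qed
        qed
        then show "(\<lambda>z. H (g z)) holomorphic_on ?U1" by (simp add: o_def)
        show "?U1 \<inter> \<psi> ` sphere 0 r = {}"
          using assms by (intro image_disjoint sub sph) auto
      qed (use assms b in auto)
      then have H1: "h holomorphic_on ?U1"
        by (rule holomorphic_transform) (simp add: h1)
      have "cauchy s H holomorphic_on ?U2"
        using assms b by (intro holomorphic_cauchy contH o2) auto
      then have H2: "h holomorphic_on ?U2"
        by (rule holomorphic_transform) (simp add: h2)
      have "- \<psi> ` sphere 0 1 \<subseteq> ?U1 \<union> ?U2"
      proof
        fix z assume z: "z \<in> - \<psi> ` sphere 0 1"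
        show "z \<in> ?U1 \<union> ?U2"
        proof (cases "z \<in> ?U2")
          case False
          then obtain w where w: "z = \<psi> w" "s \<le> norm w" "norm w \<le> 1" by auto
          then have "norm w \<noteq> 1" using z by auto
          then show ?thesis using w assms by auto
        qed auto
      qed
      then have R1: "h holomorphic_on - \<psi> ` sphere 0 1"
        using holomorphic_on_Un[OF H1 H2 o1 o2] holomorphic_on_subset by blast
      have "cauchy r H \<circ> \<psi> holomorphic_on annulus s b"
      proof (rule holomorphic_on_compose_gen)
        show "\<psi> holomorphic_on annulus s b" using assms by (intro holomorphic_on_subset[OF hol]) auto
        show "cauchy r H holomorphic_on \<psi> ` annulus s b"
        proof (intro holomorphic_cauchy contH open_image)
          show "\<psi> ` annulus s b \<inter> \<psi> ` sphere 0 r = {}"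
            using assms by (intro image_disjoint sph) auto
        qed (use assms b in auto)
      qed auto
      then have R2: "E holomorphic_on annulus s b" by (simp add: E_def[abs_def] o_def)
      have R3: "norm (E w) \<le> (C0 + C1 + 1) * e" if "w \<in> annulus s b" for w
      proof -
        have "\<psi> ` {w} \<inter> \<psi> ` annulus a m = {}"
          using that assms m b by (intro image_disjoint) auto
        then show ?thesis using b0[of "\<psi> w"] le unfolding E_def by auto
      qed
      have R4: "h (\<psi> w) = H w + E w" if "w \<in> annulus s 1" for w
        using that h1[of "\<psi> w"] g(2)[of w] assms b by (auto simp: E_def)
      have R5: "norm (h z) \<le> (C0 + C1 + 1) * e" if z: "z \<notin> \<psi> ` annulus s 1" for z
      proof (cases "z \<in> \<psi> ` annulus m 1")
        case True
        then obtain w where w0: "z = \<psi> w" "w \<in> annulus m 1" by blast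
        then have w: "z = \<psi> w" "m < norm w" "norm w \<le> s" using z by (auto simp: image_iff not_le)
        have "\<psi> ` {w} \<inter> \<psi> ` annulus a m = {}"
          using w assms m b by (intro image_disjoint) auto
        then have "norm (cauchy r H z) \<le> C0 * e" using b0[of z] w(1) by auto
        moreover have "norm (H w) \<le> e" using e w m by auto
        moreover have hz: "h z = H w + cauchy r H z"
          using True g(2)[of w] w assms m b by (simp add: h_def)
        ultimately have "norm (h z) \<le> e + C0 * e"
          unfolding hz by (intro norm_triangle_mono)
        then show ?thesis using le(3) by (rule order_trans)
      next
        case False
        then show ?thesis using b1[OF False] le by (simp add: h_def)
      qed
    show "\<exists>h E. h holomorphic_on - \<psi> ` sphere 0 1 \<and> E holomorphic_on annulus s b \<and>
      (\<forall>w\<in>annulus s b. norm (E w) \<le> (C0 + C1 + 1) * e) \<and> (\<forall>w\<in>annulus s 1. h (\<psi> w) = H w + E w) \<and>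
      (\<forall>z. z \<notin> \<psi> ` annulus s 1 \<longrightarrow> norm (h z) \<le> (C0 + C1 + 1) * e)"
      using R1 R2 R3 R4 R5 by blast
  qed
qed

end

section \<open>The twisted reflection\<close>

lemma norm_adjoint_matrix: "norm (adjoint_matrix A) = norm (A :: complex^'n^'m)"
proof -
  have sq: "(norm B)\<^sup>2 = (\<Sum>i\<in>UNIV. \<Sum>j\<in>UNIV. (norm (B $ i $ j))\<^sup>2)" for B :: "complex^'p^'q"
    by (simp add: norm_vec_def L2_set_def sum_nonneg)
  have "(norm (adjoint_matrix A))\<^sup>2 = (norm A)\<^sup>2"
    unfolding sq adjoint_matrix_def by (subst sum.swap) simp
  then show ?thesis by simp
qed

text \<open>Schwarz reflection in the unit circle. Inversion in the circle and the adjoint are both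
  antiholomorphic, so together they preserve holomorphy.\<close>

definition reflect :: "(complex \<Rightarrow> complex^'n^'n) \<Rightarrow> complex \<Rightarrow> complex^'n^'n" where
  "reflect E w = adjoint_matrix (E (1 / cnj w))"

text \<open>On the unit circle \<open>reflect E\<close> is the adjoint of \<open>E\<close>. With \<open>v = w ^ N\<close>, \<open>twist N E\<close> is there the
  skew part of \<open>E\<close> plus \<open>(1 - v) / (1 + v)\<close> times its Hermitian part, and this factor is imaginary.\<close>

definition twist :: "nat \<Rightarrow> (complex \<Rightarrow> complex^'n^'n) \<Rightarrow> complex \<Rightarrow> complex^'n^'n" where
  "twist N E w = (\<chi> i j. (E w $ i $ j - w ^ N * reflect E w $ i $ j) / (1 + w ^ N))"

lemma hform_twist:
  "hform (twist N E w) x = (hform (E w) x - w ^ N * cnj (hform (E (1 / cnj w)) x)) / (1 + w ^ N)"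
proof -
  have "hform (twist N E w) x = (hform (E w) x - w ^ N * hform (reflect E w) x) / (1 + w ^ N)"
    unfolding hform_def twist_def
    by (simp add: sum_distrib_left sum_subtractf[symmetric] sum_divide_distrib algebra_simps
        diff_divide_distrib)
  then show ?thesis by (simp add: reflect_def hform_adjoint)
qed

text \<open>With v = w^N the difference is -v / (1 + v) times E plus its reflection. The factor v
  makes it tiny on smaller radii when N is large, while the denominator is all that can spoil it
  near the circle.\<close>

lemma norm_twist_diff:
  fixes E :: "complex \<Rightarrow> complex^'n^'n"
  assumes "1 + w ^ N \<noteq> 0"
  shows "norm (twist N E w - E w) \<le> norm (w ^ N) / norm (1 + w ^ N) * (norm (E w) + norm (E (1 / cnj w)))"
proof -
  let ?q = "w ^ N / (1 + w ^ N)" and ?B = "E w + reflect E w"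
  have ent: "norm ((twist N E w - E w) $ i $ j) = norm ?q * norm (?B $ i $ j)" for i j
  proof -
    have "(twist N E w - E w) $ i $ j = - ?q * ?B $ i $ j"
      using assms by (simp add: twist_def field_simps)
    then show ?thesis by (simp add: norm_mult norm_divide)
  qed
  have "norm ((twist N E w - E w) $ i) = norm ?q * norm (?B $ i)" for i
    unfolding norm_vec_def[of "(twist N E w - E w) $ i"] norm_vec_def[of "?B $ i"] ent
    by (rule L2_set_right_distrib[symmetric]) simp
  then have "norm (twist N E w - E w) = norm ?q * norm ?B"
    unfolding norm_vec_def[of "twist N E w - E w"] norm_vec_def[of "?B"]
    by (simp only:) (rule L2_set_right_distrib[symmetric], simp)
  also have "\<dots> \<le> norm ?q * (norm (E w) + norm (E (1 / cnj w)))"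
    using norm_triangle_ineq[of "E w" "reflect E w"]
    by (intro mult_left_mono) (auto simp: reflect_def norm_adjoint_matrix)
  finally show ?thesis by (simp add: norm_divide)
qed

lemma inverse_between:
  fixes r x :: real
  assumes "0 < r" "r < x" "x < 1 / r"
  shows "r < 1 / x" "1 / x < 1 / r"
proof -
  have "0 < x" using assms by simp
  moreover have "x * r < 1" using assms by (simp add: field_simps)
  ultimately show "r < 1 / x" "1 / x < 1 / r"
    using assms by (simp_all add: pos_less_divide_eq mult.commute divide_strict_left_mono)
qed

lemma inverse_cnj_annulus:
  assumes "0 < r" "w \<in> annulus r (1 / r)"
  shows "1 / cnj w \<in> annulus r (1 / r)"
  using assms inverse_between[of r "norm w"] by (simp add: norm_divide)

lemma matrix_holomorphic_reflect:
  assumes E: "E matrix_holomorphic_on annulus r (1 / r)" and r: "0 < r"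
  shows "reflect E matrix_holomorphic_on annulus r (1 / r)"
  unfolding matrix_holomorphic_on_def
proof (intro allI)
  fix i j
  let ?A = "annulus r (1 / r)"
  have img: "cnj ` ?A = ?A"
    by (auto simp: image_iff intro!: bexI[of _ "cnj _"])
  have "(\<lambda>z. E z $ j $ i) holomorphic_on ?A" using E by (auto simp: matrix_holomorphic_on_def)
  then have 1: "cnj \<circ> (\<lambda>z. E z $ j $ i) \<circ> cnj holomorphic_on ?A"
    by (intro holomorphic_on_compose_cnj_cnj) (auto simp: img)
  have "(cnj \<circ> (\<lambda>z. E z $ j $ i) \<circ> cnj) \<circ> (\<lambda>w. 1 / w) holomorphic_on ?A"
  proof (rule holomorphic_on_compose_gen[OF _ 1])
    show "(\<lambda>w. 1 / w) holomorphic_on ?A" using r by (intro holomorphic_intros) auto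
    show "(\<lambda>w. 1 / w) ` ?A \<subseteq> ?A"
      using r inverse_between[of r] by (auto simp: norm_divide)
  qed
  then show "(\<lambda>z. reflect E z $ i $ j) holomorphic_on ?A"
    by (rule holomorphic_transform) (simp add: reflect_def adjoint_matrix_def)
qed

lemma matrix_holomorphic_twist:
  assumes E: "E matrix_holomorphic_on annulus r (1 / r)" and r: "0 < r" and S: "S \<subseteq> annulus r (1 / r)"
    and nz: "\<And>w. w \<in> S \<Longrightarrow> 1 + w ^ N \<noteq> 0"
  shows "twist N E matrix_holomorphic_on S"
  using E matrix_holomorphic_reflect[OF E r] nz unfolding matrix_holomorphic_on_def twist_def
  by (auto intro!: holomorphic_intros intro: holomorphic_on_subset[OF _ S])

lemma one_plus_power_nz:
  fixes w :: complex
  assumes "norm w < 1" "0 < N"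
  shows "1 + w ^ N \<noteq> 0"
proof
  assume "1 + w ^ N = 0"
  then have "norm (w ^ N) = 1" by (metis add_eq_0_iff norm_minus_cancel norm_one)
  moreover have "norm w ^ N < 1" using assms by (simp add: power_less_one_iff)
  ultimately show False by (simp add: norm_power)
qed

lemma matrix_holomorphic_tendsto:
  fixes A :: "complex \<Rightarrow> complex^'n^'m"
  assumes "A matrix_holomorphic_on S" "open S" "w \<in> S"
  shows "(A \<longlongrightarrow> A w) (at w within T)"
proof (intro vec_tendstoI)
  fix i j
  have "isCont (\<lambda>z. A z $ i $ j) w"
    using assms holomorphic_on_imp_continuous_on[of "\<lambda>z. A z $ i $ j" S]
    by (auto simp: matrix_holomorphic_on_def continuous_on_eq_continuous_at)
  then show "((\<lambda>z. A z $ i $ j) \<longlongrightarrow> A w $ i $ j) (at w within T)"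
    unfolding isCont_def by (rule tendsto_within_subset) simp
qed

lemma matrix_holomorphic_continuous:
  fixes A :: "complex \<Rightarrow> complex^'n^'m"
  assumes "A matrix_holomorphic_on S"
  shows "continuous_on S A"
proof -
  have "continuous_on S (\<lambda>z. \<chi> i j. A z $ i $ j)"
    using assms unfolding matrix_holomorphic_on_def
    by (intro continuous_on_vec_lambda holomorphic_on_imp_continuous_on) auto
  then show ?thesis by simp
qed

text \<open>Multiply numerator and denominator by the conjugate of 1 + v. On the circle p = q, and
  only (1 - |v|^2) Re q = 0 survives; inside, this positive term has to beat the error caused by p -
  q.\<close>

lemma Re_twist_quotient:
  assumes "1 + v \<noteq> 0"
  shows "Re ((p - v * cnj q) / (1 + v)) =
    ((1 - (norm v)\<^sup>2) * Re q + Re ((1 + cnj v) * (p - q))) / (norm (1 + v))\<^sup>2"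
proof -
  have "(p - v * cnj q) / (1 + v) = ((p - v * cnj q) * cnj (1 + v)) / of_real ((norm (1 + v))\<^sup>2)"
    by (rule complex_div_cnj)
  then have "Re ((p - v * cnj q) / (1 + v)) = Re ((p - v * cnj q) * cnj (1 + v)) / (norm (1 + v))\<^sup>2"
    by (simp only: Re_divide_of_real)
  moreover have "Re ((p - v * cnj q) * cnj (1 + v)) = (1 - (norm v)\<^sup>2) * Re q + Re ((1 + cnj v) * (p - q))"
    unfolding cmod_power2 by (simp add: algebra_simps power2_eq_square)
  ultimately show ?thesis by simp
qed

lemma skew_hermitian_twist:
  assumes "norm w = 1" "1 + w ^ N \<noteq> 0"
  shows "skew_hermitian (twist N E w)"
  unfolding skew_hermitian_def
proof
  fix x
  have "w * cnj w = 1" using assms(1) complex_norm_square[of w] by simp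
  then have "1 / cnj w = w" by (metis nonzero_mult_div_cancel_right mult_zero_right zero_neq_one)
  then show "Re (hform (twist N E w) x) = 0"
    unfolding hform_twist Re_twist_quotient[OF assms(2)] using assms(1) by (simp add: norm_power)
qed

text \<open>Bernoulli's inequality for (1/x)^N, together with 1/x - 1 \<ge> 1 - x.\<close>

lemma power_mult_le_one:
  fixes x :: real
  assumes "0 < x" "x \<le> 1"
  shows "x ^ N * (1 + real N * (1 - x)) \<le> 1"
proof -
  have "1 / x - 1 - (1 - x) = (1 - x)\<^sup>2 / x" using assms by (simp add: field_simps power2_eq_square)
  also have "\<dots> \<ge> 0" using assms by simp
  finally have "1 + real N * (1 - x) \<le> 1 + real N * (1 / x - 1)"
    by (intro add_left_mono mult_left_mono) auto
  also have "\<dots> \<le> (1 + (1 / x - 1)) ^ N"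
    using assms by (intro Bernoulli_inequality) (simp add: field_simps)
  also have "\<dots> = 1 / x ^ N" by (simp add: power_divide)
  finally show ?thesis using assms(1) by (metis mult.commute pos_le_divide_eq zero_less_power)
qed

text \<open>The bound has to be free of N. With y = 1 - x, Bernoulli gives 1 - x^N \<ge> N y / (1 +
  N y), and in the denominator both 1 and N y are at most N (1 - s).\<close>

lemma one_minus_power_ge:
  fixes x s :: real
  assumes "s < x" "x < 1" "0 < s" "1 \<le> real N * (1 - s)"
  shows "(1 - x) / (2 * (1 - s)) \<le> 1 - x ^ N"
proof -
  let ?y = "1 - x"
  have y: "0 < ?y" "?y < 1 - s" and s1: "0 < 1 - s" using assms by auto
  have N0: "0 < N" using assms(4) by (cases N) auto
  have b: "x ^ N * (1 + real N * ?y) \<le> 1" using assms by (intro power_mult_le_one) auto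
  have pos: "0 < 1 + real N * ?y" using y by (simp add: add_pos_nonneg)
  have "real N * ?y \<le> real N * (1 - s)" using y by (intro mult_left_mono) auto
  then have "1 + real N * ?y \<le> 2 * (real N * (1 - s))" using assms(4) by linarith
  then have "?y * (1 + real N * ?y) \<le> ?y * (2 * (real N * (1 - s)))"
    using y by (intro mult_left_mono) auto
  also have "\<dots> = (2 * (1 - s)) * (real N * ?y)" by simp
  finally have "?y / (2 * (1 - s)) \<le> real N * ?y / (1 + real N * ?y)"
    using s1 pos by (simp add: field_simps)
  also have "\<dots> \<le> 1 - x ^ N" using b pos by (simp add: field_simps)
  finally show ?thesis .
qed

text \<open>Mean value inequality along the radial segment from \<open>w\<close> to its mirror
  image, whose length is exactly 1/|w| - |w|. The segment stays in a compact annulus on which the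
  derivatives of the entries are bounded.\<close>

lemma entry_lipschitz:
  fixes E :: "complex \<Rightarrow> complex^'n^'n"
  assumes E: "E matrix_holomorphic_on annulus r (1 / r)" and r: "0 < r" "r < t" "t < 1"
  shows "\<exists>L>0. \<forall>w. t \<le> norm w \<longrightarrow> norm w \<le> 1 \<longrightarrow>
    norm (E w - E (1 / cnj w)) \<le> L * (1 / norm w - norm w)"
proof -
  let ?A = "annulus r (1 / r)" and ?K = "{w::complex. t \<le> norm w \<and> norm w \<le> 1 / t}"
  have t0: "0 < t" using r by simp
  have "1 / t < 1 / r" using r by (simp add: frac_less2)
  then have KA: "?K \<subseteq> ?A" using r by auto
  have "\<exists>M. \<forall>w\<in>?K. norm (deriv (\<lambda>z. E z $ i $ j) w) \<le> M" for i j
  proof -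
    have "(\<lambda>z. E z $ i $ j) holomorphic_on ?A" using E by (simp add: matrix_holomorphic_on_def)
    then have "continuous_on ?K (deriv (\<lambda>z. E z $ i $ j))"
      by (intro continuous_on_subset[OF holomorphic_on_imp_continuous_on[OF holomorphic_deriv] KA]) auto
    then have "bounded (deriv (\<lambda>z. E z $ i $ j) ` ?K)"
      by (intro compact_imp_bounded compact_continuous_image compact_norm_between)
    then show ?thesis unfolding bounded_iff by auto
  qed
  then obtain M where M: "\<And>i j w. w \<in> ?K \<Longrightarrow> norm (deriv (\<lambda>z. E z $ i $ j) w) \<le> M i j" by metis
  define B where "B = 1 + (\<Sum>i\<in>UNIV. \<Sum>j\<in>UNIV. \<bar>M i j\<bar>)"
  have "\<bar>M i j\<bar> \<le> (\<Sum>i\<in>UNIV. \<Sum>j\<in>UNIV. \<bar>M i j\<bar>)" for i j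
  proof -
    have "\<bar>M i j\<bar> \<le> (\<Sum>j\<in>UNIV. \<bar>M i j\<bar>)" by (rule member_le_sum) auto
    also have "\<dots> \<le> (\<Sum>i\<in>UNIV. \<Sum>j\<in>UNIV. \<bar>M i j\<bar>)"
      by (rule member_le_sum) (auto intro: sum_nonneg)
    finally show ?thesis .
  qed
  then have MB: "M i j \<le> B" for i j by (smt (verit) B_def)
  have B0: "0 < B" unfolding B_def by (simp add: add_pos_nonneg sum_nonneg)
  have "norm (E w - E (1 / cnj w)) \<le> real CARD('n) * (real CARD('n) * (B * (1 / norm w - norm w)))"
    if w: "t \<le> norm w" "norm w \<le> 1" for w
  proof (rule norm_matrix_le_entries)
    fix i j
    have w0: "w \<noteq> 0" "norm w > 0" using w t0 by auto
    have cw: "1 / cnj w = of_real (1 / (norm w)\<^sup>2) * w"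
      using complex_norm_square[of w] w0 by (simp add: field_simps)
    have dw: "norm (w - 1 / cnj w) = 1 / norm w - norm w"
    proof -
      have "w - 1 / cnj w = of_real (1 - 1 / (norm w)\<^sup>2) * w" unfolding cw by (simp add: algebra_simps)
      then have "norm (w - 1 / cnj w) = \<bar>1 - 1 / (norm w)\<^sup>2\<bar> * norm w" by (simp only: norm_mult norm_of_real)
      also have "\<bar>1 - 1 / (norm w)\<^sup>2\<bar> = 1 / (norm w)\<^sup>2 - 1"
      proof -
        have "(norm w)\<^sup>2 \<le> 1" using w by (simp add: power_le_one)
        then show ?thesis using w0 by (simp add: abs_if field_simps)
      qed
      also have "(1 / (norm w)\<^sup>2 - 1) * norm w = 1 / norm w - norm w"
        using w0 by (simp add: left_diff_distrib power2_eq_square)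
      finally show ?thesis .
    qed
    have seg: "closed_segment w (1 / cnj w) \<subseteq> ?K"
    proof
      fix z assume "z \<in> closed_segment w (1 / cnj w)"
      then obtain u where u: "0 \<le> u" "u \<le> 1" "z = (1 - u) *\<^sub>R w + u *\<^sub>R (1 / cnj w)"
        by (auto simp: closed_segment_def)
      have "z = of_real ((1 - u) + u * (1 / (norm w)\<^sup>2)) * w"
        unfolding u cw by (simp add: scaleR_conv_of_real algebra_simps)
      then have nz: "norm z = \<bar>(1 - u) + u * (1 / (norm w)\<^sup>2)\<bar> * norm w"
        by (simp only: norm_mult norm_of_real)
      have "\<bar>(1 - u) + u * (1 / (norm w)\<^sup>2)\<bar> = (1 - u) + u * (1 / (norm w)\<^sup>2)"
        using u by (intro abs_of_nonneg) simp
      with nz have "norm z = ((1 - u) + u * (1 / (norm w)\<^sup>2)) * norm w" by (simp only:)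
      also have "\<dots> = (1 - u) * norm w + u * (1 / norm w)"
        using w0 by (simp add: distrib_right power2_eq_square)
      finally have nz: "norm z = (1 - u) * norm w + u * (1 / norm w)" .
      have wi: "norm w \<le> 1 / norm w" using w w0 by (simp add: field_simps mult_le_one)
      have "1 / norm w \<le> 1 / t" using w t0 by (simp add: frac_le)
      moreover have "norm w \<le> norm z" "norm z \<le> 1 / norm w"
        using convex_bound_le[of "norm w" "1 / norm w" "1 / norm w" "1 - u" u]
          mult_left_mono[OF wi u(1)] wi u unfolding nz by (auto simp: left_diff_distrib)
      ultimately show "z \<in> ?K" using w by simp
    qed
    have "norm (E w $ i $ j - E (1 / cnj w) $ i $ j) \<le> B * norm (w - 1 / cnj w)"
    proof (rule field_differentiable_bound[where S = "closed_segment w (1 / cnj w)" and f = "\<lambda>z. E z $ i $ j"])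
      fix z assume "z \<in> closed_segment w (1 / cnj w)"
      then have zK: "z \<in> ?K" using seg by blast
      then have "(\<lambda>z. E z $ i $ j) field_differentiable at z"
        using E KA by (auto simp: matrix_holomorphic_on_def intro!: holomorphic_on_imp_differentiable_at[of _ ?A])
      then show "((\<lambda>z. E z $ i $ j) has_field_derivative deriv (\<lambda>z. E z $ i $ j) z) (at z within closed_segment w (1 / cnj w))"
        by (simp add: field_differentiable_derivI has_field_derivative_at_within)
      show "norm (deriv (\<lambda>z. E z $ i $ j) z) \<le> B"
        using M[OF zK] MB order_trans by blast
    qed auto
    then show "norm ((E w - E (1 / cnj w)) $ i $ j) \<le> B * (1 / norm w - norm w)"
      by (simp add: dw)
  qed
  then show ?thesis
    using B0 by (intro exI[of _ "real CARD('n) * (real CARD('n) * B)"]) (auto simp: mult_ac)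
qed

text \<open>Since \<open>1 - \<bar>w\<bar>\<^sup>N\<close> grows like \<open>(1 - \<bar>w\<bar>) / (1 - s)\<close>, a narrow collar makes it dominate the
  Lipschitz error between \<open>E w\<close> and its reflection.\<close>

lemma accretive_twist:
  fixes E :: "complex \<Rightarrow> complex^'n^'n"
  assumes E: "E matrix_holomorphic_on annulus r (1 / r)" and r: "0 < r" "r < 1" and c: "0 < c"
    and acc: "\<And>w. w \<in> annulus r (1 / r) \<Longrightarrow> accretive c (E w)"
  shows "\<exists>t. r < t \<and> t < 1 \<and> (\<forall>s. t \<le> s \<longrightarrow> s < 1 \<longrightarrow>
    (\<forall>N w. 1 \<le> real N * (1 - s) \<longrightarrow> s < norm w \<longrightarrow> norm w < 1 \<longrightarrow> accretive 0 (twist N E w)))"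
proof -
  \<comment> \<open>Radii of at least 1/2 make 1/x - x at most 4 (1 - x).\<close>
  define q where "q = max (1/2) ((1 + r) / 2)"
  have q: "r < q" "q < 1" "1/2 \<le> q" using r by (auto simp: q_def less_max_iff_disj)
  obtain L where L: "L > 0" "\<And>w. q \<le> norm w \<Longrightarrow> norm w \<le> 1 \<Longrightarrow>
    norm (E w - E (1 / cnj w)) \<le> L * (1 / norm w - norm w)"
    using entry_lipschitz[OF E r(1) q(1,2)] by blast
  \<comment> \<open>The error term is at most 2 * L * 4 (1 - x), where 2 bounds |1 + v|. The gain is
    c (1 - |v|^2) \<ge> c (1 - x) / (2 (1 - s)). Comparing them asks for 16 L (1 - s) \<le>
    c.\<close>
  define t where "t = max q (1 - c / (16 * L))"
  have t: "q \<le> t" "t < 1" "1 - t \<le> c / (16 * L)" using q L c by (auto simp: t_def)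
  show ?thesis
  proof (intro exI[of _ t] conjI allI impI)
    show "r < t" "t < 1" using q t by auto
    fix s N w
    assume s: "t \<le> s" "s < 1" and N: "1 \<le> real N * (1 - s)" and w: "s < norm w" "norm (w::complex) < 1"
    have N0: "0 < N" using N by (cases N) auto
    note nz = one_plus_power_nz[OF w(2) N0]
    let ?x = "norm w" and ?v = "w ^ N"
    have x: "1/2 \<le> ?x" "0 < ?x" using w s t q by auto
    have "1 < 1 / r" using r by simp
    then have wA: "w \<in> annulus r (1 / r)" using w s t q by auto
    have "1 / ?x - ?x = (1 - ?x) * ((1 + ?x) / ?x)" using x by (simp add: field_simps)
    also have "\<dots> \<le> (1 - ?x) * 4"
      using x w by (intro mult_left_mono) (auto simp: field_simps)
    finally have d: "1 / ?x - ?x \<le> 4 * (1 - ?x)" by simp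
    have key: "8 * L * (1 - ?x) \<le> (1 - (norm ?v)\<^sup>2) * c"
    proof -
      have "16 * L * (1 - s) \<le> c" using t s L by (simp add: field_simps) (smt (verit) mult_left_mono)
      then have "8 * L * (1 - ?x) * (2 * (1 - s)) \<le> (1 - ?x) * c"
        using w mult_left_mono[of "16 * L * (1 - s)" c "1 - ?x"] by (simp add: algebra_simps)
      then have "8 * L * (1 - ?x) \<le> (1 - ?x) / (2 * (1 - s)) * c"
        using s by (simp add: field_simps)
      also have "\<dots> \<le> (1 - ?x ^ N) * c"
        using s t q c w N by (intro mult_right_mono one_minus_power_ge) auto
      also have "\<dots> \<le> (1 - (norm ?v)\<^sup>2) * c"
      proof -
        have "(?x ^ N)\<^sup>2 \<le> ?x ^ N" using w by (simp add: power2_eq_square power_le_one mult_left_le)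
        then show ?thesis using c by (intro mult_right_mono) (auto simp: norm_power)
      qed
      finally show ?thesis .
    qed
    show "accretive 0 (twist N E w)"
      unfolding accretive_def
    proof
      fix y :: "complex^'n"
      let ?p = "hform (E w) y" and ?q = "hform (E (1 / cnj w)) y"
      have v1: "norm ?v \<le> 1" using w by (simp add: norm_power power_le_one)
      have "norm ((1 + cnj ?v) * (?p - ?q)) \<le> 2 * (L * (1 / ?x - ?x) * (norm y)\<^sup>2)"
        unfolding norm_mult
      proof (intro mult_mono)
        show "norm (1 + cnj ?v) \<le> 2"
          using norm_triangle_ineq[of 1 "cnj ?v"] v1 by (simp only: complex_mod_cnj norm_one)
        have "norm (?p - ?q) \<le> norm (E w - E (1 / cnj w)) * (norm y)\<^sup>2"
          using norm_hform_le[of "E w - E (1 / cnj w)" y] by (simp add: hform_diff)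
        also have "\<dots> \<le> L * (1 / ?x - ?x) * (norm y)\<^sup>2"
          using s t w by (intro mult_right_mono L(2)) auto
        finally show "norm (?p - ?q) \<le> L * (1 / ?x - ?x) * (norm y)\<^sup>2" .
      qed auto
      also have "\<dots> \<le> 8 * L * (1 - ?x) * (norm y)\<^sup>2"
      proof -
        have "2 * (L * (1 / ?x - ?x)) \<le> 8 * L * (1 - ?x)" using mult_left_mono[OF d, of "2 * L"] L by simp
        then have "2 * (L * (1 / ?x - ?x)) * (norm y)\<^sup>2 \<le> 8 * L * (1 - ?x) * (norm y)\<^sup>2"
          by (rule mult_right_mono) simp
        then show ?thesis by (simp add: algebra_simps)
      qed
      also have "\<dots> \<le> (1 - (norm ?v)\<^sup>2) * c * (norm y)\<^sup>2"
        by (intro mult_right_mono key) simp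
      also have "\<dots> \<le> (1 - (norm ?v)\<^sup>2) * Re ?q"
      proof -
        have "c * (norm y)\<^sup>2 \<le> Re ?q"
          using acc[OF inverse_cnj_annulus[OF r(1) wA]] by (simp add: accretive_def)
        moreover have "0 \<le> 1 - (norm ?v)\<^sup>2" using v1 by (simp add: power_le_one)
        ultimately show ?thesis by (simp only: mult.assoc mult_left_mono)
      qed
      finally have "- Re ((1 + cnj ?v) * (?p - ?q)) \<le> (1 - (norm ?v)\<^sup>2) * Re ?q"
        using abs_Re_le_cmod[of "(1 + cnj ?v) * (?p - ?q)"] by linarith
      then show "0 * (norm y)\<^sup>2 \<le> Re (hform (twist N E w) y)"
        unfolding hform_twist Re_twist_quotient[OF nz] by (simp add: divide_nonneg_nonneg)
    qed
  qed
qed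

section \<open>Successive refinement\<close>

lemma matrix_holomorphic_on_subset:
  "F matrix_holomorphic_on S \<Longrightarrow> T \<subseteq> S \<Longrightarrow> F matrix_holomorphic_on T"
  unfolding matrix_holomorphic_on_def using holomorphic_on_subset by blast

lemma matrix_holomorphic_on_add:
  "F matrix_holomorphic_on S \<Longrightarrow> G matrix_holomorphic_on S \<Longrightarrow> (\<lambda>z. F z + G z) matrix_holomorphic_on S"
  unfolding matrix_holomorphic_on_def by (auto intro: holomorphic_on_add)

lemma matrix_holomorphic_on_diff:
  "F matrix_holomorphic_on S \<Longrightarrow> G matrix_holomorphic_on S \<Longrightarrow> (\<lambda>z. F z - G z) matrix_holomorphic_on S"
  unfolding matrix_holomorphic_on_def by (auto intro: holomorphic_on_diff)

lemma matrix_holomorphic_on_const: "(\<lambda>z. A) matrix_holomorphic_on S"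
  unfolding matrix_holomorphic_on_def by simp

text \<open>All coordinates are normalised so that the domain lies on the side |w| < 1. This makes
  the outer boundary and the boundaries of holes indistinguishable in what follows.\<close>

locale collared_domain =
  fixes \<Omega> :: "complex set" and m :: nat and \<psi> :: "nat \<Rightarrow> complex \<Rightarrow> complex" and R :: real
  assumes R: "1 < R"
    and open_dom: "open \<Omega>" and bounded_dom: "bounded \<Omega>"
    and hol: "\<And>k. k \<le> m \<Longrightarrow> \<psi> k holomorphic_on annulus (1 / R) R"
    and inj: "\<And>k. k \<le> m \<Longrightarrow> inj_on (\<psi> k) (annulus (1 / R) R)"
    and disj: "\<And>k l. k \<le> m \<Longrightarrow> l \<le> m \<Longrightarrow> k \<noteq> l \<Longrightarrow>
      \<psi> k ` annulus (1 / R) R \<inter> \<psi> l ` annulus (1 / R) R = {}"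
    and inside: "\<And>k w. k \<le> m \<Longrightarrow> w \<in> annulus (1 / R) 1 \<Longrightarrow> \<psi> k w \<in> \<Omega>"
    and outside: "\<And>k w. k \<le> m \<Longrightarrow> w \<in> annulus (1 / R) R \<Longrightarrow> 1 \<le> norm w \<Longrightarrow> \<psi> k w \<notin> \<Omega>"
    and frontier_dom: "frontier \<Omega> = (\<Union>k\<le>m. \<psi> k ` sphere 0 1)"
begin

lemma collar: "k \<le> m \<Longrightarrow> collar (\<psi> k) (1 / R) R"
  using R hol inj by unfold_locales auto

definition core :: "real \<Rightarrow> complex set" where
  "core r = \<Omega> - (\<Union>k\<le>m. \<psi> k ` annulus r 1)"

lemma R_pos: "0 < 1 / R" "1 / R < 1" using R by auto

lemma core_mono: "r \<le> s \<Longrightarrow> core r \<subseteq> core s"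
  unfolding core_def by fastforce

lemma dom_cases:
  assumes "z \<in> \<Omega>"
  obtains "z \<in> core r" | k w where "k \<le> m" "w \<in> annulus r 1" "z = \<psi> k w"
  using assms unfolding core_def by blast

lemma mem_annulus_R: "1 / R \<le> r \<Longrightarrow> w \<in> annulus r 1 \<Longrightarrow> w \<in> annulus (1 / R) R"
  using R by auto

text \<open>Add up the solutions for the single curves. Collars are disjoint, so near curve k the
  solution belonging to another curve l is small and holomorphic across curve k; it can therefore be
  counted as part of the residual there.\<close>

lemma glue_entry:
  assumes "1 / R \<le> c" "c < r" "r < s" "s < 1"
  shows "\<exists>C>0. \<forall>H e. (\<forall>k\<le>m. H k holomorphic_on annulus c 1) \<longrightarrow>
    (\<forall>k\<le>m. \<forall>w. r \<le> norm w \<and> norm w \<le> s \<longrightarrow> norm (H k w) \<le> e) \<longrightarrow>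
    (\<exists>h E. h holomorphic_on \<Omega> \<and> (\<forall>k\<le>m. E k holomorphic_on annulus s R \<and>
      (\<forall>w\<in>annulus s R. norm (E k w) \<le> C * e) \<and> (\<forall>w\<in>annulus s 1. h (\<psi> k w) = H k w + E k w)) \<and>
      (\<forall>z\<in>core s. norm (h z) \<le> C * e))"
proof -
  define Q where "Q k H b h E \<longleftrightarrow> h holomorphic_on - \<psi> k ` sphere 0 1 \<and> E holomorphic_on annulus s R \<and>
      (\<forall>w\<in>annulus s R. norm (E w) \<le> b) \<and> (\<forall>w\<in>annulus s 1. h (\<psi> k w) = H w + E w) \<and>
      (\<forall>z. z \<notin> \<psi> k ` annulus s 1 \<longrightarrow> norm (h z) \<le> b)" for k H b h E
  have "\<exists>C>0. \<forall>H e. H holomorphic_on annulus c 1 \<longrightarrow> (\<forall>w. r \<le> norm w \<and> norm w \<le> s \<longrightarrow> norm (H w) \<le> e) \<longrightarrow>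
      (\<exists>h E. Q k H (C * e) h E)" if "k \<le> m" for k
    unfolding Q_def using collar.glue_single[OF collar[OF that] assms] .
  then obtain C where C: "\<And>k. k \<le> m \<Longrightarrow> C k > 0"
    "\<And>k H e. k \<le> m \<Longrightarrow> H holomorphic_on annulus c 1 \<Longrightarrow> (\<forall>w. r \<le> norm w \<and> norm w \<le> s \<longrightarrow> norm (H w) \<le> e) \<Longrightarrow>
      \<exists>h E. Q k H (C k * e) h E"
    by metis
  have sphere_sub: "sphere 0 1 \<subseteq> annulus (1 / R) R" using R by auto
  have sub: "annulus s R \<subseteq> annulus (1 / R) R" using assms by auto
  show ?thesis
  proof (intro exI[of _ "\<Sum>k\<le>m. C k"] conjI allI impI)
    show "(\<Sum>k\<le>m. C k) > 0" using C(1) by (intro sum_pos) auto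
    fix H e
    assume H: "\<forall>k\<le>m. H k holomorphic_on annulus c 1"
      and He: "\<forall>k\<le>m. \<forall>w. r \<le> norm w \<and> norm w \<le> s \<longrightarrow> norm (H k w) \<le> e"
    have "\<exists>h E. Q k (H k) (C k * e) h E" if "k \<le> m" for k
      using H He that by (intro C(2)) auto
    then obtain h E where hE0: "\<And>k. k \<le> m \<Longrightarrow> Q k (H k) (C k * e) (h k) (E k)" by metis
    have h: "\<And>k. k \<le> m \<Longrightarrow> h k holomorphic_on - \<psi> k ` sphere 0 1"
       and E: "\<And>k. k \<le> m \<Longrightarrow> E k holomorphic_on annulus s R"
       and Eb: "\<And>k w. k \<le> m \<Longrightarrow> w\<in>annulus s R \<Longrightarrow> norm (E k w) \<le> C k * e"
       and hE: "\<And>k w. k \<le> m \<Longrightarrow> w\<in>annulus s 1 \<Longrightarrow> h k (\<psi> k w) = H k w + E k w"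
       and hb: "\<And>k z. k \<le> m \<Longrightarrow> z \<notin> \<psi> k ` annulus s 1 \<Longrightarrow> norm (h k z) \<le> C k * e"
      using hE0 unfolding Q_def by auto
    have sph: "\<psi> k w \<notin> \<Omega>" if "k \<le> m" "w \<in> sphere 0 1" for k w
      using outside[OF that(1), of w] sphere_sub that(2) by auto
    have sub1: "annulus s 1 \<subseteq> annulus (1 / R) R" using R assms by auto
    have notl: "\<psi> k w \<notin> \<psi> l ` annulus s 1" if "k \<le> m" "l \<le> m" "l \<noteq> k" "w \<in> annulus s R" for k l w
      using disj[of k l] that sub sub1 by blast
    define E' where "E' k w = E k w + (\<Sum>l\<in>{..m}-{k}. h l (\<psi> k w))" for k w
    have splitsum: "(\<Sum>l\<le>m. f l) = f k + (\<Sum>l\<in>{..m}-{k}. f l)" if "k \<le> m" for k and f :: "nat \<Rightarrow> complex"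
      using that by (intro sum.remove) auto
    have splitC: "(\<Sum>l\<le>m. C l) * e = C k * e + (\<Sum>l\<in>{..m}-{k}. C l * e)" if "k \<le> m" for k
      using that by (subst sum_distrib_right, intro sum.remove) auto
    have R1: "(\<lambda>z. \<Sum>k\<le>m. h k z) holomorphic_on \<Omega>"
      using sph by (intro holomorphic_on_sum holomorphic_on_subset[OF h]) auto
    have R2: "E' k holomorphic_on annulus s R" if k: "k \<le> m" for k
    proof -
      have "h l \<circ> \<psi> k holomorphic_on annulus s R" if l: "l \<in> {..m} - {k}" for l
      proof (rule holomorphic_on_compose_gen[OF holomorphic_on_subset[OF hol[OF k] sub] h])
        show "\<psi> k ` annulus s R \<subseteq> - \<psi> l ` sphere 0 1"
          using disj[of k l] l k sub sphere_sub by blast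
      qed (use l in auto)
      then show ?thesis
        unfolding E'_def[abs_def] o_def by (intro holomorphic_intros E[OF k]) auto
    qed
    have R3: "norm (E' k w) \<le> (\<Sum>k\<le>m. C k) * e" if k: "k \<le> m" and w: "w \<in> annulus s R" for k w
      unfolding E'_def splitC[OF k]
      using hb notl[OF k _ _ w] k by (intro norm_triangle_mono Eb k w sum_norm_le) auto
    have R4: "(\<Sum>k\<le>m. h k (\<psi> k' w)) = H k' w + E' k' w" if "k' \<le> m" "w \<in> annulus s 1" for k' w
      unfolding E'_def splitsum[OF that(1)] using hE[OF that] by simp
    have R5: "norm (\<Sum>k\<le>m. h k z) \<le> (\<Sum>k\<le>m. C k) * e" if "z \<in> core s" for z
      unfolding sum_distrib_right using that by (intro sum_norm_le hb) (auto simp: core_def)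
    show "\<exists>h E. h holomorphic_on \<Omega> \<and> (\<forall>k\<le>m. E k holomorphic_on annulus s R \<and>
      (\<forall>w\<in>annulus s R. norm (E k w) \<le> (\<Sum>k\<le>m. C k) * e) \<and> (\<forall>w\<in>annulus s 1. h (\<psi> k w) = H k w + E k w)) \<and>
      (\<forall>z\<in>core s. norm (h z) \<le> (\<Sum>k\<le>m. C k) * e)"
      by (intro exI[of _ "\<lambda>z. \<Sum>k\<le>m. h k z"] exI[of _ E'] conjI allI impI ballI R1 R2 R3 R4 R5)
  qed
qed

definition glued :: "(nat \<Rightarrow> complex \<Rightarrow> complex^'n^'n) \<Rightarrow> real \<Rightarrow> real \<Rightarrow> (complex \<Rightarrow> complex^'n^'n) \<Rightarrow>
    (nat \<Rightarrow> complex \<Rightarrow> complex^'n^'n) \<Rightarrow> bool" where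
  "glued H s t h E \<longleftrightarrow> h matrix_holomorphic_on \<Omega> \<and> (\<forall>k\<le>m. E k matrix_holomorphic_on annulus s R \<and>
      (\<forall>w\<in>annulus s R. norm (E k w) \<le> t) \<and> (\<forall>w\<in>annulus s 1. h (\<psi> k w) = H k w + E k w)) \<and>
      (\<forall>z\<in>core s. norm (h z) \<le> t)"

text \<open>Entrywise application of the scalar case. The gluing constant and the passage from
  entries to the Hilbert-Schmidt norm are absorbed into \<open>d\<close>, so the target accuracy
  \<open>t\<close> can be prescribed first.\<close>

lemma glue:
  assumes "1 / R \<le> c" "c < r" "r < s" "s < 1" and t: "0 < t"
  shows "\<exists>d>0. \<forall>H :: nat \<Rightarrow> complex \<Rightarrow> complex^'n^'n. (\<forall>k\<le>m. H k matrix_holomorphic_on annulus c 1) \<longrightarrow>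
    (\<forall>k\<le>m. \<forall>w. r \<le> norm w \<and> norm w \<le> s \<longrightarrow> norm (H k w) \<le> d) \<longrightarrow> (\<exists>h E. glued H s t h E)"
proof -
  obtain C where C: "C > 0" "\<And>H e. (\<forall>k\<le>m. H k holomorphic_on annulus c 1) \<Longrightarrow>
    (\<forall>k\<le>m. \<forall>w. r \<le> norm w \<and> norm w \<le> s \<longrightarrow> norm (H k w) \<le> e) \<Longrightarrow>
    (\<exists>h E. h holomorphic_on \<Omega> \<and> (\<forall>k\<le>m. E k holomorphic_on annulus s R \<and>
      (\<forall>w\<in>annulus s R. norm (E k w) \<le> C * e) \<and> (\<forall>w\<in>annulus s 1. h (\<psi> k w) = H k w + E k w)) \<and>
      (\<forall>z\<in>core s. norm (h z) \<le> C * e))"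
    using glue_entry[OF assms(1-4)] by blast
  let ?D = "real CARD('n) * real CARD('n)"
  have D: "?D > 0" by simp
  show ?thesis
  proof (intro exI[of _ "t / (C * ?D)"] conjI allI impI)
    show "t / (C * ?D) > 0" using t C by simp
    fix H :: "nat \<Rightarrow> complex \<Rightarrow> complex^'n^'n"
    assume H: "\<forall>k\<le>m. H k matrix_holomorphic_on annulus c 1"
      and He: "\<forall>k\<le>m. \<forall>w. r \<le> norm w \<and> norm w \<le> s \<longrightarrow> norm (H k w) \<le> t / (C * ?D)"
    define Q where "Q i j h E \<longleftrightarrow> h holomorphic_on \<Omega> \<and> (\<forall>k\<le>m. E k holomorphic_on annulus s R \<and>
      (\<forall>w\<in>annulus s R. norm (E k w) \<le> t / ?D) \<and>
      (\<forall>w\<in>annulus s 1. h (\<psi> k w) = H k w $ i $ j + E k w)) \<and>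
      (\<forall>z\<in>core s. norm (h z) \<le> t / ?D)" for i j h E
    have tD: "C * (t / (C * ?D)) = t / ?D" using C by simp
    have "\<exists>h E. Q i j h E" for i j
      unfolding Q_def tD[symmetric]
    proof (rule C(2)[of "\<lambda>k w. H k w $ i $ j"])
      show "\<forall>k\<le>m. (\<lambda>w. H k w $ i $ j) holomorphic_on annulus c 1"
        using H by (simp add: matrix_holomorphic_on_def)
      show "\<forall>k\<le>m. \<forall>w. r \<le> norm w \<and> norm w \<le> s \<longrightarrow> norm (H k w $ i $ j) \<le> t / (C * ?D)"
        using He norm_entry_le order_trans by blast
    qed
    then obtain h E where hE0: "\<And>i j. Q i j (h i j) (E i j)" by metis
    have h: "\<And>i j. h i j holomorphic_on \<Omega>"
      and E: "\<And>i j k. k \<le> m \<Longrightarrow> E i j k holomorphic_on annulus s R"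
      and Eb: "\<And>i j k w. k \<le> m \<Longrightarrow> w \<in> annulus s R \<Longrightarrow> norm (E i j k w) \<le> t / ?D"
      and hE: "\<And>i j k w. k \<le> m \<Longrightarrow> w \<in> annulus s 1 \<Longrightarrow> h i j (\<psi> k w) = H k w $ i $ j + E i j k w"
      and hb: "\<And>i j z. z \<in> core s \<Longrightarrow> norm (h i j z) \<le> t / ?D"
      using hE0 unfolding Q_def by auto
    define h' :: "complex \<Rightarrow> complex^'n^'n" where "h' z = (\<chi> i j. h i j z)" for z
    define E' :: "nat \<Rightarrow> complex \<Rightarrow> complex^'n^'n" where "E' k z = (\<chi> i j. E i j k z)" for k z
    have bnd: "norm A \<le> t" if "\<And>i j. norm (A $ i $ j) \<le> t / ?D" for A :: "complex^'n^'n"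
      using norm_matrix_le_entries[OF that] by simp
    have R1: "h' matrix_holomorphic_on \<Omega>" using h by (simp add: matrix_holomorphic_on_def h'_def)
    have R2: "E' k matrix_holomorphic_on annulus s R" if "k \<le> m" for k
      using E[OF that] by (simp add: matrix_holomorphic_on_def E'_def)
    have R3: "norm (E' k w) \<le> t" if "k \<le> m" "w \<in> annulus s R" for k w
      using Eb[OF that] by (intro bnd) (simp add: E'_def)
    have R4: "h' (\<psi> k w) = H k w + E' k w" if "k \<le> m" "w \<in> annulus s 1" for k w
      using hE[OF that] by (simp add: vec_eq_iff h'_def E'_def)
    have R5: "norm (h' z) \<le> t" if "z \<in> core s" for z
      using hb[OF that] by (intro bnd) (simp add: h'_def)
    show "\<exists>h E. glued H s t h E"
      unfolding glued_def by (intro exI[of _ h'] exI[of _ E'] conjI allI impI ballI R1 R2 R3 R4 R5)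
  qed
qed

text \<open>\<open>G\<close> has vanishing real part on the boundary up to the small error \<open>E\<close>, which continues
  across the boundary; \<open>P\<close> carries the poles on the boundary.\<close>

definition stage :: "(complex \<Rightarrow> complex^'n^'n) \<Rightarrow> (nat \<Rightarrow> complex \<Rightarrow> complex^'n^'n) \<Rightarrow>
    (nat \<Rightarrow> complex \<Rightarrow> complex^'n^'n) \<Rightarrow> real \<Rightarrow> bool" where
  "stage G P E r \<longleftrightarrow> 1 / R \<le> r \<and> r < 1 \<and> G matrix_holomorphic_on \<Omega> \<and> (\<forall>z\<in>\<Omega>. accretive 0 (G z)) \<and>
    (\<exists>c>0. \<forall>k\<le>m. E k matrix_holomorphic_on annulus r (1 / r) \<and>
      (\<forall>w\<in>annulus r (1 / r). accretive c (E k w)) \<and>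
      (\<forall>w\<in>annulus r 1. accretive 0 (P k w) \<and> G (\<psi> k w) = P k w + E k w))"

text \<open>The correction \<open>twist\<close> minus \<open>E\<close> is small in the gluing band
  but may be unbounded at the circle, where its poles are handed to \<open>P'\<close>. Gluing leaves
  a residual of norm at most u/2; adding u times the identity makes it strictly accretive again,
  which is what the next use of \<open>accretive_twist\<close> requires. The order of choices is
  collar radius, gluing threshold \<open>d\<close>, and only then N.\<close>

lemma refine_stage:
  fixes G :: "complex \<Rightarrow> complex^'n^'n"
  assumes st: "stage G P E r" and r': "r' < 1" and tau: "0 < \<tau>"
  shows "\<exists>G' P' E' s N. stage G' P' E' s \<and> r \<le> s \<and> r' \<le> s \<and> 0 < N \<and>
    (\<forall>z\<in>core s. norm (G' z - G z) \<le> \<tau>) \<and>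
    (\<forall>k\<le>m. (\<forall>w\<in>annulus s (1 / s). norm (E' k w) \<le> \<tau>) \<and>
      (\<forall>w\<in>annulus s 1. P' k w = P k w + twist N (E k) w \<and>
        norm (G' (\<psi> k w) - G (\<psi> k w)) \<le> (norm (E k w) + norm (E k (1 / cnj w))) / norm (1 + w ^ N) + \<tau>))"
proof -
  obtain c where r: "1 / R \<le> r" "r < 1" and G: "G matrix_holomorphic_on \<Omega>" "\<And>z. z \<in> \<Omega> \<Longrightarrow> accretive 0 (G z)"
    and c: "c > 0" and E: "\<And>k. k \<le> m \<Longrightarrow> E k matrix_holomorphic_on annulus r (1 / r)"
    and Eacc: "\<And>k w. k \<le> m \<Longrightarrow> w \<in> annulus r (1 / r) \<Longrightarrow> accretive c (E k w)"
    and P: "\<And>k w. k \<le> m \<Longrightarrow> w \<in> annulus r 1 \<Longrightarrow> accretive 0 (P k w)"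
    and GPE: "\<And>k w. k \<le> m \<Longrightarrow> w \<in> annulus r 1 \<Longrightarrow> G (\<psi> k w) = P k w + E k w"
    using st unfolding stage_def by blast
  have r0: "0 < r" using r R_pos by linarith
  have "\<exists>t. r < t \<and> t < 1 \<and> (\<forall>s. t \<le> s \<longrightarrow> s < 1 \<longrightarrow>
    (\<forall>N w. 1 \<le> real N * (1 - s) \<longrightarrow> s < norm w \<longrightarrow> norm w < 1 \<longrightarrow> accretive 0 (twist N (E k) w)))"
    if "k \<le> m" for k
    using accretive_twist[OF E[OF that] r0 r(2) c Eacc[OF that]] .
  then obtain t where t: "\<And>k. k \<le> m \<Longrightarrow> r < t k" "\<And>k. k \<le> m \<Longrightarrow> t k < 1"
    "\<And>k s N w. k \<le> m \<Longrightarrow> t k \<le> s \<Longrightarrow> s < 1 \<Longrightarrow> 1 \<le> real N * (1 - s) \<Longrightarrow> s < norm w \<Longrightarrow> norm w < 1 \<Longrightarrow>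
      accretive 0 (twist N (E k) w)"
    by metis
  \<comment> \<open>Beyond all the radii \<open>t k\<close>, so that the twists will be accretive at
    every curve, and beyond the prescribed \<open>r'\<close>.\<close>
  define q where "q = Max (insert r' (t ` {..m}))"
  have q: "r' \<le> q" "\<And>k. k \<le> m \<Longrightarrow> t k \<le> q" "q < 1"
    using r' t(2) Max_ge[of "insert r' (t ` {..m})"] unfolding q_def
    by (blast, blast, simp)
  have rq: "r < q" using t(1)[of 0] q(2)[of 0] by simp
  \<comment> \<open>\<open>q1\<close> and \<open>s\<close> cut the interval from \<open>q\<close> to
    1 into thirds: gluing happens between them, and the new collar starts at
    \<open>s\<close>.\<close>
  define q1 where "q1 = (2 * q + 1) / 3"
  define s where "s = (q + 2) / 3"
  have s: "q < q1" "q1 < s" "s < 1" using q(3) by (auto simp: q1_def s_def)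
  have s0: "0 < s" using s rq r0 by simp
  define D where "D = norm (mat 1 :: complex^'n^'n)"
  \<comment> \<open>\<open>D\<close> is the Hilbert-Schmidt norm of the identity, so a residual of
    norm at most \<open>u\<close> plus the shift by u times the identity stays within
    \<open>\<tau>\<close>.\<close>
  define u where "u = \<tau> / (1 + D)"
  have D0: "0 \<le> D" by (simp add: D_def)
  then have u: "0 < u" using tau by (simp add: u_def)
  have "u * (1 + D) = \<tau>" using D0 unfolding u_def by simp
  then have uD: "u + u * D = \<tau>" by (simp add: algebra_simps)
  have "1 / R \<le> q" using r rq by simp
  from glue[OF this s, of "u / 2"] u
  obtain d where d: "d > 0" and gl: "\<And>H :: nat \<Rightarrow> complex \<Rightarrow> complex^'n^'n. (\<forall>k\<le>m. H k matrix_holomorphic_on annulus q 1) \<Longrightarrow>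
    (\<forall>k\<le>m. \<forall>w. q1 \<le> norm w \<and> norm w \<le> s \<longrightarrow> norm (H k w) \<le> d) \<Longrightarrow>
    \<exists>h E. glued H s (u / 2) h E" by auto
  let ?K = "{w::complex. q1 \<le> norm w \<and> norm w \<le> 1 / q1}"
  have q10: "0 < q1" using s rq r0 by simp
  have "1 / q1 < 1 / r" using rq r0 s by (simp add: frac_less2)
  then have KA: "?K \<subseteq> annulus r (1 / r)" using s rq by auto
  have "\<forall>k\<in>{..m}. \<exists>M. \<forall>w\<in>?K. norm (E k w) \<le> M"
  proof
    fix k assume "k \<in> {..m}"
    then have "continuous_on ?K (E k)"
      using E by (intro continuous_on_subset[OF matrix_holomorphic_continuous KA]) auto
    then have "bounded (E k ` ?K)" by (intro compact_imp_bounded compact_continuous_image compact_norm_between)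
    then show "\<exists>M. \<forall>w\<in>?K. norm (E k w) \<le> M" unfolding bounded_iff by auto
  qed
  then obtain M0 where M0: "\<And>k w. k \<le> m \<Longrightarrow> w \<in> ?K \<Longrightarrow> norm (E k w) \<le> M0 k"
    unfolding bchoice_iff by (metis atMost_iff)
  define M where "M = Max (insert 0 (M0 ` {..m}))"
  have M: "norm (E k w) \<le> M" if "k \<le> m" "w \<in> ?K" for k w
    using M0[OF that] that(1) Max_ge[of "insert 0 (M0 ` {..m})" "M0 k"] by (force simp: M_def)
  have M_nonneg: "0 \<le> M" by (simp add: M_def)
  \<comment> \<open>N must satisfy three conditions: s^N < 1/2 keeps |1 + w^N| above 1/2 in the
    gluing band; then s^N * 4 M bounds the correction there and must be below \<open>d\<close>; and
    N (1 - s) \<ge> 1 is the hypothesis under which the twist is accretive.\<close>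
  have "(\<lambda>N. s ^ N * (4 * M)) \<longlonglongrightarrow> 0"
    using s s0 by (intro tendsto_mult_left_zero LIMSEQ_realpow_zero) auto
  then have "\<forall>\<^sub>F N in sequentially. s ^ N * (4 * M) < d"
    using d by (rule order_tendstoD)
  moreover have "\<forall>\<^sub>F N in sequentially. s ^ N < 1 / 2"
    using s s0 by (intro order_tendstoD[OF LIMSEQ_realpow_zero]) auto
  moreover have "\<forall>\<^sub>F N in sequentially. 1 / (1 - s) \<le> real N"
    using filterlim_real_sequentially by (auto simp: filterlim_at_top)
  ultimately have "\<forall>\<^sub>F N in sequentially. s ^ N * (4 * M) < d \<and> s ^ N < 1 / 2 \<and> 1 / (1 - s) \<le> real N"
    by eventually_elim auto
  then obtain N where N: "s ^ N * (4 * M) < d" "s ^ N < 1 / 2" "1 / (1 - s) \<le> real N"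
    unfolding eventually_sequentially by blast
  have Ns: "1 \<le> real N * (1 - s)" using N(3) s by (simp add: field_simps)
  have N0: "0 < N" using Ns by (cases N) auto
  define H where "H k w = twist N (E k) w - E k w" for k w
  have "1 < 1 / r" using r0 r(2) by simp
  then have qA: "annulus q 1 \<subseteq> annulus r (1 / r)" using rq by auto
  have H_hol: "H k matrix_holomorphic_on annulus q 1" if "k \<le> m" for k
  proof -
    have "twist N (E k) matrix_holomorphic_on annulus q 1"
      using one_plus_power_nz N0 by (intro matrix_holomorphic_twist[OF E[OF that] r0 qA]) auto
    then show ?thesis
      unfolding H_def[abs_def]
      by (intro matrix_holomorphic_on_diff matrix_holomorphic_on_subset[OF E[OF that] qA])
  qed
  have H_small: "norm (H k w) \<le> d" if k: "k \<le> m" and w: "q1 \<le> norm w" "norm w \<le> s" for k w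
  proof -
    have w1: "norm w < 1" using w s by simp
    have q1i: "1 < 1 / q1" using q10 s by simp
    have wK: "w \<in> ?K" using w w1 q1i by auto
    have "0 < norm w" using w q10 by linarith
    then have "1 \<le> 1 / norm w" "1 / norm w \<le> 1 / q1"
      using w w1 q10 by (auto simp: le_divide_eq intro: divide_left_mono)
    then have w'K: "1 / cnj w \<in> ?K" using s by (simp add: norm_divide)
    have wn: "norm (w ^ N) \<le> s ^ N" using w by (simp add: norm_power power_mono)
    have "1 - norm (w ^ N) \<le> norm (1 + w ^ N)" by (metis norm_one norm_diff_ineq)
    then have half: "1 / 2 \<le> norm (1 + w ^ N)" using wn N(2) by linarith
    have "norm (H k w) \<le> norm (w ^ N) / norm (1 + w ^ N) * (norm (E k w) + norm (E k (1 / cnj w)))"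
      unfolding H_def by (rule norm_twist_diff[OF one_plus_power_nz[OF w1 N0]])
    also have "\<dots> \<le> s ^ N / (1 / 2) * (M + M)"
      using half wn s0 M_nonneg M[OF k wK] M[OF k w'K] by (intro mult_mono frac_le add_mono) auto
    also have "\<dots> = s ^ N * (4 * M)" by simp
    finally show ?thesis using N(1) by simp
  qed
  have "\<forall>k\<le>m. H k matrix_holomorphic_on annulus q 1"
    and "\<forall>k\<le>m. \<forall>w. q1 \<le> norm w \<and> norm w \<le> s \<longrightarrow> norm (H k w) \<le> d"
    using H_hol H_small by auto
  from gl[OF this] obtain h e where "glued H s (u / 2) h e" by blast
  then have h: "h matrix_holomorphic_on \<Omega>" and e: "\<And>k. k \<le> m \<Longrightarrow> e k matrix_holomorphic_on annulus s R"
    and eb: "\<And>k w. k \<le> m \<Longrightarrow> w \<in> annulus s R \<Longrightarrow> norm (e k w) \<le> u / 2"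
    and he: "\<And>k w. k \<le> m \<Longrightarrow> w \<in> annulus s 1 \<Longrightarrow> h (\<psi> k w) = H k w + e k w"
    and hb: "\<And>z. z \<in> core s \<Longrightarrow> norm (h z) \<le> u / 2"
    unfolding glued_def by auto
  define G' where "G' z = G z + (h z + u *\<^sub>R mat 1)" for z
  define P' where "P' k w = P k w + twist N (E k) w" for k w
  define E' where "E' k w = e k w + u *\<^sub>R mat 1" for k w
  have sub1: "annulus s 1 \<subseteq> annulus s R" using R by auto
  have "1 / R \<le> s" using r rq s by simp
  then have "1 / s \<le> R" using s0 R by (simp add: field_simps)
  then have subR: "annulus s (1 / s) \<subseteq> annulus s R" by auto
  have uI: "norm (u *\<^sub>R (mat 1 :: complex^'n^'n)) = u * D" using u by (simp add: D_def)
  have close: "norm (A + u *\<^sub>R mat 1) \<le> \<tau>" if "norm A \<le> u / 2" for A :: "complex^'n^'n"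
    using norm_triangle_ineq[of A "u *\<^sub>R mat 1"] uI uD u that by linarith
  have acc_half: "accretive (u / 2) (A + u *\<^sub>R mat 1)" if "norm A \<le> u / 2" for A :: "complex^'n^'n"
    by (rule accretive_mono[OF accretive_add[OF accretive_norm[of A] accretive_scaled_mat1[of u]]])
       (use that in simp)
  have subr: "annulus s 1 \<subseteq> annulus r 1" using s rq by auto
  have G'PE: "G' (\<psi> k w) = P' k w + E' k w" if "k \<le> m" "w \<in> annulus s 1" for k w
    using GPE[OF that(1), of w] he[OF that] that(2) subr
    by (auto simp: G'_def P'_def E'_def H_def)
  have P'acc: "accretive 0 (P' k w)" if "k \<le> m" "w \<in> annulus s 1" for k w
    using accretive_add[OF P[OF that(1), of w] t(3)[OF that(1), of s N w]] q(2)[OF that(1)] s Ns that subr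
    by (auto simp: P'_def)
  have E'acc: "accretive (u / 2) (E' k w)" if "k \<le> m" "w \<in> annulus s R" for k w
    unfolding E'_def using eb[OF that] by (rule acc_half)
  have st': "stage G' P' E' s"
    unfolding stage_def
  proof (intro conjI exI[of _ "u / 2"] allI impI ballI)
    show "1 / R \<le> s" "s < 1" "0 < u / 2" using r rq s u by auto
    show "G' matrix_holomorphic_on \<Omega>"
      unfolding G'_def[abs_def]
      by (intro matrix_holomorphic_on_add matrix_holomorphic_on_const G(1) h)
    \<comment> \<open>Away from the collars \<open>h\<close> is small and the shift by u dominates
      it. In a collar \<open>h\<close> can be large, and accretivity comes instead from the
      splitting into \<open>P'\<close> and \<open>E'\<close>.\<close>
    show "accretive 0 (G' z)" if "z \<in> \<Omega>" for z
    proof (rule dom_cases[OF that, of s])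
      assume 1: "z \<in> core s"
      show ?thesis
        unfolding G'_def
        by (rule accretive_mono[OF accretive_add[OF G(2)[OF that] acc_half[OF hb[OF 1]]]]) (use u in simp)
    next
      fix k w assume 2: "k \<le> m" "w \<in> annulus s 1" "z = \<psi> k w"
      then have "accretive (0 + u / 2) (G' z)"
        unfolding 2 G'PE[OF 2(1,2)] using sub1 by (intro accretive_add P'acc E'acc) auto
      then show ?thesis by (rule accretive_mono) (use u in simp)
    qed
    fix k assume k: "k \<le> m"
    show "E' k matrix_holomorphic_on annulus s (1 / s)"
      unfolding E'_def[abs_def]
      by (intro matrix_holomorphic_on_add matrix_holomorphic_on_const matrix_holomorphic_on_subset[OF e[OF k] subR])
    show "accretive (u / 2) (E' k w)" if "w \<in> annulus s (1 / s)" for w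
      using that subR by (intro E'acc k) auto
    show "accretive 0 (P' k w)" "G' (\<psi> k w) = P' k w + E' k w" if "w \<in> annulus s 1" for w
      using that k by (auto intro!: P'acc G'PE)
  qed
  have b1: "norm (G' z - G z) \<le> \<tau>" if "z \<in> core s" for z
    using close[OF hb[OF that]] by (simp add: G'_def)
  have b2: "norm (E' k w) \<le> \<tau>" if "k \<le> m" "w \<in> annulus s (1 / s)" for k w
    unfolding E'_def using that subR by (intro close eb) auto
  have b3: "norm (G' (\<psi> k w) - G (\<psi> k w)) \<le>
      (norm (E k w) + norm (E k (1 / cnj w))) / norm (1 + w ^ N) + \<tau>"
    if k: "k \<le> m" and w: "w \<in> annulus s 1" for k w
  proof -
    have w1: "norm w < 1" using w by simp
    have "G' (\<psi> k w) - G (\<psi> k w) = H k w + (e k w + u *\<^sub>R mat 1)"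
      using he[OF k w] by (simp add: G'_def)
    then have "norm (G' (\<psi> k w) - G (\<psi> k w)) \<le> norm (H k w) + norm (e k w + u *\<^sub>R mat 1)"
      by (simp add: norm_triangle_ineq)
    moreover have "norm (H k w) \<le> norm (w ^ N) / norm (1 + w ^ N) * (norm (E k w) + norm (E k (1 / cnj w)))"
      unfolding H_def by (rule norm_twist_diff[OF one_plus_power_nz[OF w1 N0]])
    moreover have "\<dots> \<le> 1 / norm (1 + w ^ N) * (norm (E k w) + norm (E k (1 / cnj w)))"
      using w1 by (intro mult_right_mono divide_right_mono) (auto simp: norm_power power_le_one)
    moreover have "norm (e k w + u *\<^sub>R mat 1) \<le> \<tau>" using k w sub1 by (intro close eb) auto
    ultimately show ?thesis by simp
  qed
  have "r \<le> s" "r' \<le> s" using rq s q(1) by auto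
  then show ?thesis
    by (intro exI[of _ G'] exI[of _ P'] exI[of _ E'] exI[of _ s] exI[of _ N] conjI ballI allI impI st' N0 b1 b2 b3)
       (simp_all add: P'_def)
qed

text \<open>\<open>F\<close> need not extend to the boundary, but in a collar its dilation
  \<open>F (\<psi> k (t * w))\<close> does, and it inherits the accretivity constant. For t near 1
  the two differ little in the gluing band, so the dilations can be glued to \<open>F\<close>. There
  are no poles yet, whence \<open>P\<close> = 0, and a residual of norm at most c/2 leaves strict
  accretivity without a shift.\<close>

lemma initial_stage:
  fixes F :: "complex \<Rightarrow> complex^'n^'n"
  assumes F: "F matrix_holomorphic_on \<Omega>" and c: "c > 0" and Facc: "\<And>z. z \<in> \<Omega> \<Longrightarrow> accretive c (F z)"
    and r: "r < 1" and tau: "0 < \<tau>"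
  shows "\<exists>G E s. stage G (\<lambda>k w. 0) E s \<and> r \<le> s \<and> (\<forall>z\<in>core r. norm (G z - F z) \<le> \<tau>)"
proof -
  obtain q' where q': "1 / R < q'" "q' < 1" using dense[OF R_pos(2)] by blast
  define q where "q = max q' r"
  have q: "1 / R < q" "q < 1" "r \<le> q"
    using q' r unfolding q_def by auto
  define q1 where "q1 = (2 * q + 1) / 3"
  define s where "s = (q + 2) / 3"
  have s: "q < q1" "q1 < s" "s < 1" using q(2) by (auto simp: q1_def s_def)
  have s0: "0 < q" using q R_pos by linarith
  define u where "u = min \<tau> (c / 2)"
  have u: "0 < u" "u \<le> \<tau>" "u \<le> c / 2" using tau c by (auto simp: u_def)
  from glue[OF less_imp_le[OF q(1)] s u(1)]
  obtain d where d: "d > 0" and gl: "\<And>H :: nat \<Rightarrow> complex \<Rightarrow> complex^'n^'n. (\<forall>k\<le>m. H k matrix_holomorphic_on annulus q 1) \<Longrightarrow>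
    (\<forall>k\<le>m. \<forall>w. q1 \<le> norm w \<and> norm w \<le> s \<longrightarrow> norm (H k w) \<le> d) \<Longrightarrow>
    \<exists>h E. glued H s (u) h E" by blast
  let ?A = "annulus (1 / R) 1"
  have F\<psi>: "(\<lambda>w. F (\<psi> k w)) matrix_holomorphic_on ?A" if k: "k \<le> m" for k
    unfolding matrix_holomorphic_on_def
  proof (intro allI)
    fix i j
    have "(\<lambda>z. F z $ i $ j) \<circ> \<psi> k holomorphic_on ?A"
      using F inside[OF k] R by (intro holomorphic_on_compose_gen[of _ _ _ \<Omega>] holomorphic_on_subset[OF hol[OF k]])
        (auto simp: matrix_holomorphic_on_def)
    then show "(\<lambda>w. F (\<psi> k w) $ i $ j) holomorphic_on ?A" by (simp add: o_def)
  qed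
  \<comment> \<open>Room below the gluing band: multiplying by t must not leave the compact set on
    which uniform continuity is used.\<close>
  have "1 / R < q1" using q s by simp
  then obtain q0 where q0: "1 / R < q0" "q0 < q1" using dense by blast
  let ?K = "{w::complex. q0 \<le> norm w \<and> norm w \<le> s}"
  have KA: "?K \<subseteq> ?A" using q0 s by auto
  define near where "near k e \<longleftrightarrow> 0 < e \<and>
    (\<forall>w\<in>?K. \<forall>w'\<in>?K. dist w' w < e \<longrightarrow> dist (F (\<psi> k w')) (F (\<psi> k w)) < d)" for k e
  have "\<exists>e. near k e" if "k \<le> m" for k
  proof -
    have "continuous_on ?K (\<lambda>w. F (\<psi> k w))"
      using F\<psi>[OF that] by (intro continuous_on_subset[OF matrix_holomorphic_continuous KA]) auto
    then have "uniformly_continuous_on ?K (\<lambda>w. F (\<psi> k w))"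
      by (rule compact_uniformly_continuous) (rule compact_norm_between)
    then show ?thesis
      using d unfolding uniformly_continuous_on_def near_def by blast
  qed
  then obtain e0 where "\<And>k. k \<le> m \<Longrightarrow> near k (e0 k)" by metis
  then have e0: "\<And>k. k \<le> m \<Longrightarrow> e0 k > 0"
    "\<And>k w w'. k \<le> m \<Longrightarrow> w \<in> ?K \<Longrightarrow> w' \<in> ?K \<Longrightarrow> dist w' w < e0 k \<Longrightarrow> dist (F (\<psi> k w')) (F (\<psi> k w)) < d"
    unfolding near_def by auto
  define e1 where "e1 = Min (e0 ` {..m})"
  have e1: "e1 > 0" "\<And>k. k \<le> m \<Longrightarrow> e1 \<le> e0 k" using e0(1) by (auto simp: e1_def)
  \<comment> \<open>Beyond \<open>s\<close>, the bound q0 / q1 keeps t w in \<open>?K\<close> for w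
    in the gluing band, 1 - e1 / 2 makes t w close enough to w there, and 1 / R / q keeps t w in the
    collar for all |w| > q.\<close>
  define t where "t = max (max s (q0 / q1)) (max (1 - e1 / 2) (1 / R / q))"
  have q01: "0 < q1" using s s0 by simp
  have "q0 / q1 < 1" "1 / R / q < 1"
    using q q0 s0 q01 by (simp_all only: divide_less_eq_1_pos)
  have t: "s \<le> t" "q0 / q1 \<le> t" "1 - e1 / 2 \<le> t" "1 / R / q \<le> t" "t < 1"
    using s \<open>q0 / q1 < 1\<close> \<open>1 / R / q < 1\<close> e1 by (auto simp: t_def)
  have t0: "0 < t" using t(1) s q01 by linarith
  have tq: "1 / R \<le> t * q" using t(4) s0 by (simp only: pos_divide_le_eq)
  have tA: "of_real t * w \<in> ?A" if "q < norm w" "norm w < 1 / t" for w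
  proof -
    have "t * q < t * norm w" using that t0 by simp
    then have "1 / R < t * norm w" using tq by linarith
    moreover have "t * norm w < 1" using that(2) t0 by (simp add: field_simps)
    ultimately show ?thesis using t0 by (simp add: norm_mult)
  qed
  define H where "H k w = F (\<psi> k (of_real t * w)) - F (\<psi> k w)" for k w
  have F\<psi>t: "(\<lambda>w. F (\<psi> k (of_real t * w))) matrix_holomorphic_on annulus q (1 / t)" if k: "k \<le> m" for k
    unfolding matrix_holomorphic_on_def
  proof (intro allI)
    fix i j
    have "(\<lambda>w. F (\<psi> k w) $ i $ j) \<circ> (\<lambda>w. of_real t * w) holomorphic_on annulus q (1 / t)"
      using F\<psi>[OF k] tA by (intro holomorphic_on_compose_gen[of _ _ _ ?A] holomorphic_intros)
        (auto simp: matrix_holomorphic_on_def)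
    then show "(\<lambda>w. F (\<psi> k (of_real t * w)) $ i $ j) holomorphic_on annulus q (1 / t)" by (simp add: o_def)
  qed
  have t1: "1 < 1 / t" using t t0 by simp
  have H_hol: "H k matrix_holomorphic_on annulus q 1" if k: "k \<le> m" for k
  proof -
    have sub: "annulus q 1 \<subseteq> annulus q (1 / t)" "annulus q 1 \<subseteq> ?A" using t1 q by auto
    show ?thesis
      unfolding H_def[abs_def]
      using matrix_holomorphic_on_diff matrix_holomorphic_on_subset F\<psi>[OF k] F\<psi>t[OF k] sub by blast
  qed
  have H_small: "norm (H k w) \<le> d" if k: "k \<le> m" and w: "q1 \<le> norm w" "norm w \<le> s" for k w
  proof -
    have "q0 \<le> t * q1" using t(2) q01 by (simp only: pos_divide_le_eq)
    also have "\<dots> \<le> t * norm w" using w t0 by simp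
    finally have 1: "q0 \<le> t * norm w" .
    have "t * norm w \<le> 1 * norm w" using t by (intro mult_right_mono) auto
    then have twK: "of_real t * w \<in> ?K" using 1 w t0 by (simp add: norm_mult)
    have wK: "w \<in> ?K" using w q0 by simp
    have "of_real t * w - w = of_real (t - 1) * w" by (simp add: algebra_simps)
    then have "dist (of_real t * w) w = \<bar>t - 1\<bar> * norm w" by (simp only: dist_norm norm_mult norm_of_real)
    also have "\<dots> \<le> (e1 / 2) * 1" using t w s e1 by (intro mult_mono) auto
    also have "\<dots> < e0 k" using e1 e1(2)[OF k] by simp
    finally have "dist (F (\<psi> k (of_real t * w))) (F (\<psi> k w)) < d" using e0(2)[OF k wK twK] by simp
    then show ?thesis by (simp add: H_def dist_norm)
  qed
  have "\<forall>k\<le>m. H k matrix_holomorphic_on annulus q 1"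
    and "\<forall>k\<le>m. \<forall>w. q1 \<le> norm w \<and> norm w \<le> s \<longrightarrow> norm (H k w) \<le> d"
    using H_hol H_small by auto
  from gl[OF this] obtain h e where "glued H s (u) h e" by blast
  then have h: "h matrix_holomorphic_on \<Omega>" and e: "\<And>k. k \<le> m \<Longrightarrow> e k matrix_holomorphic_on annulus s R"
    and eb: "\<And>k w. k \<le> m \<Longrightarrow> w \<in> annulus s R \<Longrightarrow> norm (e k w) \<le> u"
    and he: "\<And>k w. k \<le> m \<Longrightarrow> w \<in> annulus s 1 \<Longrightarrow> h (\<psi> k w) = H k w + e k w"
    and hb: "\<And>z. z \<in> core s \<Longrightarrow> norm (h z) \<le> u"
    unfolding glued_def by auto
  define G where "G z = F z + h z" for z
  define E where "E k w = F (\<psi> k (of_real t * w)) + e k w" for k w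
  have half: "accretive (c / 2) (A + B)" if "accretive c A" "norm B \<le> u" for A B :: "complex^'n^'n"
    using accretive_add[OF that(1) accretive_norm[of B]] by (rule accretive_mono) (use that u in simp)
  have tR: "1 / t \<le> R"
  proof -
    have "1 / R \<le> t" using q s t by simp
    then show ?thesis using t0 R by (simp add: field_simps)
  qed
  have sub: "annulus t (1 / t) \<subseteq> annulus s R" "annulus t (1 / t) \<subseteq> annulus q (1 / t)"
    using tR t s by auto
  have Eacc: "accretive (c / 2) (E k w)" if k: "k \<le> m" and w: "w \<in> annulus s R" "norm w < 1 / t" for k w
  proof -
    have "of_real t * w \<in> ?A" using w s by (intro tA) auto
    then show ?thesis
      unfolding E_def by (intro half eb k w Facc inside)
  qed
  have subt: "annulus t 1 \<subseteq> annulus s R" "annulus t 1 \<subseteq> annulus s 1" using t R by auto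
  have GE: "G (\<psi> k w) = E k w" if "k \<le> m" "w \<in> annulus s 1" for k w
    using he[OF that] by (simp add: G_def E_def H_def)
  have "stage G (\<lambda>k w. 0) E t"
    unfolding stage_def
  proof (intro conjI exI[of _ "c / 2"] allI impI ballI)
    show "1 / R \<le> t" "t < 1" "0 < c / 2" using q s t c by auto
    show "G matrix_holomorphic_on \<Omega>"
      unfolding G_def[abs_def] by (rule matrix_holomorphic_on_add[OF F h])
    show "accretive 0 (G z)" if "z \<in> \<Omega>" for z
    proof -
      have "accretive (c / 2) (G z)"
      proof (rule dom_cases[OF that, of s])
        assume "z \<in> core s"
        then show ?thesis unfolding G_def by (intro half Facc that hb)
      next
        fix k w assume 2: "k \<le> m" "w \<in> annulus s 1" "z = \<psi> k w"
        then show ?thesis unfolding 2 GE[OF 2(1,2)] using R t1 by (intro Eacc) auto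
      qed
      then show ?thesis by (rule accretive_mono) (use c in simp)
    qed
    fix k assume k: "k \<le> m"
    show "E k matrix_holomorphic_on annulus t (1 / t)"
      unfolding E_def[abs_def]
      using matrix_holomorphic_on_add matrix_holomorphic_on_subset e[OF k] F\<psi>t[OF k] sub by blast
    show "accretive (c / 2) (E k w)" if "w \<in> annulus t (1 / t)" for w
      using that sub by (intro Eacc k) auto
    show "accretive 0 (0 :: complex^'n^'n)" by (simp add: accretive_def hform_def)
    show "G (\<psi> k w) = 0 + E k w" if "w \<in> annulus t 1" for w
      using GE[OF k, of w] that subt by auto
  qed
  moreover have "norm (G z - F z) \<le> \<tau>" if "z \<in> core r" for z
  proof -
    have "z \<in> core s" using that core_mono[of r s] q s by auto
    then show ?thesis using hb[of z] u by (simp add: G_def)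
  qed
  ultimately show ?thesis using q s t by (intro exI[of _ G] exI[of _ E] exI[of _ t]) auto
qed

end

section \<open>The limit and its boundary values\<close>

lemma geometric_convergence:
  fixes f :: "nat \<Rightarrow> 'a::banach"
  assumes a: "0 \<le> a" and step: "\<And>n. j \<le> n \<Longrightarrow> norm (f (Suc n) - f n) \<le> a * (1/4) ^ n"
  shows "convergent f" "\<And>n. j \<le> n \<Longrightarrow> norm (f n - lim f) \<le> 2 * a * (1/4) ^ n"
proof -
  \<comment> \<open>The factor 1 - 4^-k makes the induction close. Summing the series exactly would
    give 4/3 in place of 2.\<close>
  have bound: "norm (f (n + k) - f n) \<le> 2 * a * (1/4) ^ n * (1 - (1/4) ^ k)" if n: "j \<le> n" for n k
  proof (induction k)
    case (Suc k)
    have "norm (f (n + Suc k) - f n) \<le> norm (f (Suc (n + k)) - f (n + k)) + norm (f (n + k) - f n)"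
      using norm_triangle_ineq[of "f (Suc (n + k)) - f (n + k)" "f (n + k) - f n"] by simp
    also have "\<dots> \<le> a * (1/4) ^ (n + k) + 2 * a * (1/4) ^ n * (1 - (1/4) ^ k)"
      using n by (intro add_mono step Suc) simp
    also have "\<dots> \<le> 2 * a * (1/4) ^ n * (1 - (1/4) ^ Suc k)"
      using a by (simp add: power_add algebra_simps)
    finally show ?case .
  qed simp
  have bound': "norm (f p - f n) \<le> 2 * a * (1/4) ^ n" if "j \<le> n" "n \<le> p" for n p
  proof -
    have "norm (f (n + (p - n)) - f n) \<le> 2 * a * (1/4) ^ n * (1 - (1/4) ^ (p - n))"
      by (rule bound[OF that(1)])
    also have "\<dots> \<le> 2 * a * (1/4) ^ n * 1" using a by (intro mult_left_mono) auto
    finally show ?thesis using that by simp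
  qed
  have "(\<lambda>n. 2 * a * (1/4 :: real) ^ n) \<longlonglongrightarrow> 0"
    by (intro tendsto_mult_right_zero LIMSEQ_realpow_zero) auto
  have "Cauchy f"
  proof (rule CauchyI)
    fix e :: real assume "0 < e"
    then have "\<forall>\<^sub>F n in sequentially. 2 * a * (1/4) ^ n < e / 2"
      using \<open>(\<lambda>n. 2 * a * (1/4 :: real) ^ n) \<longlonglongrightarrow> 0\<close> by (intro order_tendstoD) auto
    then obtain n0 where n0: "\<And>n. n \<ge> n0 \<Longrightarrow> 2 * a * (1/4) ^ n < e / 2"
      unfolding eventually_sequentially by blast
    define n where "n = max j n0"
    show "\<exists>M. \<forall>p\<ge>M. \<forall>q\<ge>M. norm (f p - f q) < e"
    proof (intro exI[of _ n] allI impI)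
      fix p q assume "n \<le> p" "n \<le> q"
      then have "norm (f p - f n) \<le> 2 * a * (1/4) ^ n" "norm (f q - f n) \<le> 2 * a * (1/4) ^ n"
        by (auto intro!: bound' simp: n_def)
      moreover have "2 * a * (1/4) ^ n < e / 2" by (rule n0) (simp add: n_def)
      moreover have "norm (f p - f q) \<le> norm (f p - f n) + norm (f q - f n)"
        using norm_triangle_ineq4[of "f p - f n" "f q - f n"] by simp
      ultimately show "norm (f p - f q) < e" by linarith
    qed
  qed
  then show conv: "convergent f" by (rule Cauchy_convergent)
  show "norm (f n - lim f) \<le> 2 * a * (1/4) ^ n" if "j \<le> n" for n
  proof (rule tendsto_upperbound)
    show "(\<lambda>p. norm (f n - f p)) \<longlonglongrightarrow> norm (f n - lim f)"
      using conv by (intro tendsto_intros) (simp add: convergent_LIMSEQ_iff)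
    show "\<forall>\<^sub>F p in sequentially. norm (f n - f p) \<le> 2 * a * (1/4) ^ n"
      using eventually_ge_at_top[of n]
    proof eventually_elim
      case (elim p)
      show ?case using bound'[OF that elim] by (simp add: norm_minus_commute)
    qed
  qed simp
qed

lemma holomorphic_locally_lipschitz:
  assumes "f holomorphic_on S" "open S" "x \<in> S"
  shows "\<exists>e>0. \<exists>C>0. ball x e \<subseteq> S \<and> (\<forall>y\<in>ball x e. \<forall>z\<in>ball x e. norm (f y - f z) \<le> C * norm (y - z))"
proof -
  obtain e where e: "e > 0" "cball x e \<subseteq> S" using assms open_contains_cball by blast
  have "continuous_on (cball x e) (deriv f)"
    using e by (intro continuous_on_subset[OF holomorphic_on_imp_continuous_on[OF holomorphic_deriv[OF assms(1,2)]]])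
  then have "bounded (deriv f ` cball x e)" by (intro compact_imp_bounded compact_continuous_image) auto
  then obtain C where C: "C > 0" "\<And>y. y \<in> cball x e \<Longrightarrow> norm (deriv f y) \<le> C" unfolding bounded_pos by auto
  have "norm (f y - f z) \<le> C * norm (y - z)" if "y \<in> ball x e" "z \<in> ball x e" for y z
  proof (rule field_differentiable_bound[OF convex_ball[of x e]])
    fix w assume w: "w \<in> ball x e"
    then have "f field_differentiable at w"
      using e assms by (intro holomorphic_on_imp_differentiable_at[of f S]) auto
    then show "(f has_field_derivative deriv f w) (at w within ball x e)"
      by (simp add: field_differentiable_derivI has_field_derivative_at_within)
    show "norm (deriv f w) \<le> C" using w by (intro C) auto
  qed (use that in auto)
  moreover have "ball x e \<subseteq> S" using e ball_subset_cball by blast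
  ultimately show ?thesis using e(1) C(1) by blast
qed

lemma thin_annulus:
  assumes "open U" "sphere 0 1 \<subseteq> U"
  shows "\<exists>r. 0 < r \<and> r < 1 \<and> (annulus r (1 / r) :: complex set) \<subseteq> U"
proof -
  obtain e where e: "e > 0" "(\<Union>x\<in>sphere 0 1. ball x e) \<subseteq> U"
    using compact_subset_open_imp_ball_epsilon_subset[OF _ assms] by auto
  show ?thesis
  \<comment> \<open>Since 1 / (1 + e) > 1 - e, both edges of this annulus are within
    \<open>e\<close> of the circle; \<open>sgn w\<close> is the nearest point of the circle.\<close>
  proof (intro exI[of _ "1 / (1 + e)"] conjI subsetI)
    fix w :: complex assume "w \<in> annulus (1 / (1 + e)) (1 / (1 / (1 + e)))"
    then have w: "1 / (1 + e) < norm w" "norm w < 1 + e" by auto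
    have w0: "0 < norm w" using w(1) e(1) by (meson less_trans zero_less_divide_1_iff add_pos_pos zero_less_one)
    have "norm (sgn w - w) = \<bar>1 - norm w\<bar>"
    proof -
      have "sgn w - w = of_real (1 - norm w) * sgn w"
        using w0 by (simp add: sgn_eq field_simps)
      then show ?thesis using w0 by (simp only: norm_mult norm_of_real norm_sgn; simp)
    qed
    moreover have "1 - norm w < e"
    proof -
      have "1 - e < 1 / (1 + e)" using e(1) by (simp add: field_simps)
      then show ?thesis using w by linarith
    qed
    ultimately have "w \<in> ball (sgn w) e" using w by (simp add: dist_norm)
    moreover have "sgn w \<in> sphere 0 1" using w0 by (simp add: norm_sgn)
    ultimately show "w \<in> U" using e(2) by blast
  qed (use e in auto)
qed

section \<open>Compact subsets and approach regions in collar coordinates\<close>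

context collared_domain
begin

text \<open>A compact subset of the domain misses the boundary, so its complement pulls back to an
  open neighbourhood of the unit circle, which contains a thin annulus. Finitely many curves allow a
  common radius.\<close>

lemma compact_subset_core:
  assumes "compact K" "K \<subseteq> \<Omega>"
  shows "\<exists>r<1. \<forall>s\<ge>r. K \<subseteq> core s"
proof -
  have "\<exists>r<1. K \<inter> \<psi> k ` annulus r 1 = {} \<and> 1 / R \<le> r" if k: "k \<le> m" for k
  proof -
    let ?U = "annulus (1 / R) R \<inter> \<psi> k -` (- K)"
    have "open ?U"
      using assms(1) hol[OF k]
      by (intro continuous_open_preimage holomorphic_on_imp_continuous_on) (auto simp: compact_imp_closed)
    moreover have "sphere 0 1 \<subseteq> ?U"
      using outside[OF k] assms(2) R by auto
    ultimately obtain r where r: "0 < r" "r < 1" "annulus r (1 / r) \<subseteq> ?U" using thin_annulus by blast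
    have "1 < 1 / r" using r by simp
    then have "annulus (max r (1 / R)) 1 \<subseteq> annulus r (1 / r)" by auto
    then have "K \<inter> \<psi> k ` annulus (max r (1 / R)) 1 = {}" using r(3) by auto
    then show ?thesis using r R_pos by (intro exI[of _ "max r (1 / R)"]) auto
  qed
  then obtain r where r: "\<And>k. k \<le> m \<Longrightarrow> r k < 1" "\<And>k. k \<le> m \<Longrightarrow> K \<inter> \<psi> k ` annulus (r k) 1 = {}" by metis
  define q where "q = Max (r ` {..m})"
  have q: "q < 1" "\<And>k. k \<le> m \<Longrightarrow> r k \<le> q" using r(1) by (auto simp: q_def)
  have "K \<subseteq> core s" if "q \<le> s" for s
  proof -
    have "annulus s 1 \<subseteq> annulus (r k) 1" if "k \<le> m" for k using q(2)[OF that] \<open>q \<le> s\<close> by auto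
    then show ?thesis using r(2) assms(2) unfolding core_def by blast
  qed
  then show ?thesis using q by blast
qed

text \<open>In the coordinate g(z) an approach region becomes a Stolz angle. The point of the circle
  below g(z) gives a boundary point at distance O(1 - |g(z)|) from z, by the Lipschitz bound for
  \<open>\<psi> k\<close>; the Lipschitz bound for the inverse turns the distance from z to the
  boundary point back into |g(z) - w0|.\<close>

lemma approach_region_stolz:
  assumes k: "k \<le> m" and w0: "norm w0 = 1"
  shows "\<exists>M\<ge>1. \<exists>g. (g \<longlongrightarrow> w0) (at (\<psi> k w0) within approach_region \<Omega> \<alpha> (\<psi> k w0)) \<and>
    (\<forall>\<^sub>F z in at (\<psi> k w0) within approach_region \<Omega> \<alpha> (\<psi> k w0).
      \<psi> k (g z) = z \<and> 1 / R < norm (g z) \<and> norm (g z) < 1 \<and> norm (g z - w0) \<le> M * (1 - norm (g z)))"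
proof -
  let ?A = "annulus (1 / R) R" and ?p = "\<psi> k w0"
  have w0A: "w0 \<in> ?A" using w0 R by simp
  obtain g where g: "g holomorphic_on \<psi> k ` ?A" "\<And>w. w \<in> ?A \<Longrightarrow> g (\<psi> k w) = w"
    using holomorphic_has_inverse[OF hol[OF k] open_annulus inj[OF k]] by metis
  have op: "open (\<psi> k ` ?A)" by (rule open_mapping_thm3[OF hol[OF k] open_annulus inj[OF k]])
  obtain e C where e: "e > 0" "C > 0" "ball w0 e \<subseteq> ?A"
    "\<And>y z. y \<in> ball w0 e \<Longrightarrow> z \<in> ball w0 e \<Longrightarrow> norm (\<psi> k y - \<psi> k z) \<le> C * norm (y - z)"
    using holomorphic_locally_lipschitz[OF hol[OF k] open_annulus w0A] by blast
  obtain e' C' where e': "e' > 0" "C' > 0" "ball ?p e' \<subseteq> \<psi> k ` ?A"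
    "\<And>y z. y \<in> ball ?p e' \<Longrightarrow> z \<in> ball ?p e' \<Longrightarrow> norm (g y - g z) \<le> C' * norm (y - z)"
    using holomorphic_locally_lipschitz[OF g(1) op, of ?p] w0A by blast
  have gp: "g ?p = w0" by (rule g(2)[OF w0A])
  have "isCont g ?p"
    using g(1) op w0A by (metis continuous_on_eq_continuous_at holomorphic_on_imp_continuous_on imageI)
  then have glim: "(g \<longlongrightarrow> w0) (at ?p within T)" for T
    unfolding isCont_def gp by (rule tendsto_within_subset) simp
  let ?T = "approach_region \<Omega> \<alpha> ?p"
  \<comment> \<open>Product of the two Lipschitz constants and the opening of the region;
    \<open>\<bar>\<alpha>\<bar>\<close> appears since the sign of \<open>\<alpha>\<close> is not
    fixed here. The maximum with 1 guarantees that the angle contains the radius.\<close>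
  define M where "M = max 1 (C' * ((1 + \<bar>\<alpha>\<bar>) * C))"
  have ev1: "\<forall>\<^sub>F z in at ?p within ?T. dist (g z) w0 < e / 2" using glim e(1) by (intro tendstoD) auto
  have ev2: "\<forall>\<^sub>F z in at ?p within ?T. z \<in> ball ?p e'"
    using e'(1) by (intro eventually_at_topological[THEN iffD2] exI[of _ "ball ?p e'"]) auto
  have ev3: "\<forall>\<^sub>F z in at ?p within ?T. z \<in> ?T" by (auto simp: eventually_at_filter)
  have "\<forall>\<^sub>F z in at ?p within ?T. \<psi> k (g z) = z \<and> 1 / R < norm (g z) \<and> norm (g z) < 1 \<and>
      norm (g z - w0) \<le> M * (1 - norm (g z))"
    using ev1 ev2 ev3
  proof eventually_elim
    case (elim z)
    obtain w where w: "w \<in> ?A" "z = \<psi> k w" using elim(2) e'(3) by blast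
    have gz: "g z = w" using g(2) w by simp
    have zO: "z \<in> \<Omega>" and zd: "dist z ?p < (1 + \<alpha>) * infdist z (frontier \<Omega>)"
      using elim(3) by (auto simp: approach_region_def)
    have w1: "norm w < 1" using outside[OF k w(1)] zO w(2) by force
    have wpos: "0 < norm w" using w(1) R_pos by (simp only: mem_annulus) linarith
    have d1: "1 - norm w \<le> norm (w - w0)"
      using norm_triangle_ineq2[of w0 w] w0 by (simp add: norm_minus_commute)
    have sw: "norm (w - sgn w) = 1 - norm w"
    proof -
      have "w - sgn w = of_real (norm w - 1) * sgn w" using wpos by (simp add: sgn_eq field_simps)
      then have "norm (w - sgn w) = \<bar>norm w - 1\<bar>" using wpos by (simp only: norm_mult norm_of_real norm_sgn; simp)
      then show ?thesis using w1 by simp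
    qed
    have near: "norm (w - w0) < e / 2" using elim(1) gz by (simp add: dist_norm)
    have "norm (sgn w - w0) \<le> norm (w - sgn w) + norm (w - w0)"
      using norm_triangle_ineq4[of "w - w0" "w - sgn w"] by simp
    then have sb: "sgn w \<in> ball w0 e" using near d1 sw by (simp add: dist_norm norm_minus_commute)
    have wb: "w \<in> ball w0 e" using near e(1) by (simp add: dist_norm norm_minus_commute)
    have "sgn w \<in> sphere 0 1" using wpos by (simp add: norm_sgn)
    then have "\<psi> k (sgn w) \<in> frontier \<Omega>" unfolding frontier_dom using k by blast
    then have "infdist z (frontier \<Omega>) \<le> dist z (\<psi> k (sgn w))" by (rule infdist_le)
    also have "\<dots> \<le> C * norm (w - sgn w)" using e(4)[OF wb sb] by (simp add: w(2) dist_norm)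
    finally have id: "infdist z (frontier \<Omega>) \<le> C * (1 - norm w)" by (simp only: sw)
    have "norm (w - w0) = norm (g z - g ?p)" by (simp add: gz gp)
    also have "\<dots> \<le> C' * dist z ?p" using e'(4)[of z ?p] elim(2) e'(1) by (simp add: dist_norm)
    also have "\<dots> \<le> C' * ((1 + \<bar>\<alpha>\<bar>) * (C * (1 - norm w)))"
    proof (intro mult_left_mono)
      have "(1 + \<alpha>) * infdist z (frontier \<Omega>) \<le> (1 + \<bar>\<alpha>\<bar>) * infdist z (frontier \<Omega>)"
        by (intro mult_right_mono infdist_nonneg) simp
      also have "\<dots> \<le> (1 + \<bar>\<alpha>\<bar>) * (C * (1 - norm w))" using id by (intro mult_left_mono) auto
      finally show "dist z ?p \<le> (1 + \<bar>\<alpha>\<bar>) * (C * (1 - norm w))" using zd by linarith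
    qed (use e'(2) in simp)
    also have "\<dots> = C' * ((1 + \<bar>\<alpha>\<bar>) * C) * (1 - norm w)" by simp
    also have "\<dots> \<le> M * (1 - norm w)" unfolding M_def using w1 by (intro mult_right_mono) auto
    finally show ?case using w w1 gz by auto
  qed
  then show ?thesis using glim by (intro exI[of _ M]) (auto simp: M_def)
qed

end

text \<open>What iterating \<open>refine_stage\<close> with accuracy a * 16^-n delivers.
  \<open>s_ge\<close> forces the collars to shrink to the boundary.\<close>

locale refined_sequence = collared_domain +
  fixes G :: "nat \<Rightarrow> complex \<Rightarrow> complex^'n^'n"
    and P E :: "nat \<Rightarrow> nat \<Rightarrow> complex \<Rightarrow> complex^'n^'n"
    and s :: "nat \<Rightarrow> real" and N :: "nat \<Rightarrow> nat" and a :: real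
  assumes stage: "\<And>n. stage (G n) (P n) (E n) (s n)"
    and s_mono: "\<And>n. s n \<le> s (Suc n)" and s_ge: "\<And>n. 1 - 1 / real (Suc n) \<le> s n"
    and N_pos: "\<And>n. 0 < N n"
    and a: "0 < a" and P0: "P 0 = (\<lambda>k w. 0)"
    and core_step: "\<And>n z. z \<in> core (s (Suc n)) \<Longrightarrow> norm (G (Suc n) z - G n z) \<le> a * (1/16) ^ n"
    and E_small: "\<And>n k w. k \<le> m \<Longrightarrow> w \<in> annulus (s (Suc n)) (1 / s (Suc n)) \<Longrightarrow> norm (E (Suc n) k w) \<le> a * (1/16) ^ n"
    and P_step: "\<And>n k w. k \<le> m \<Longrightarrow> w \<in> annulus (s (Suc n)) 1 \<Longrightarrow> P (Suc n) k w = P n k w + twist (N n) (E n k) w"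
    and collar_step: "\<And>n k w. k \<le> m \<Longrightarrow> w \<in> annulus (s (Suc n)) 1 \<Longrightarrow>
      norm (G (Suc n) (\<psi> k w) - G n (\<psi> k w)) \<le> (norm (E n k w) + norm (E n k (1 / cnj w))) / norm (1 + w ^ N n) + a * (1/16) ^ n"
begin

section \<open>Convergence in the interior\<close>

definition limit :: "complex \<Rightarrow> complex^'n^'n" where
  "limit z = lim (\<lambda>n. G n z)"

lemma s_bounds: "1 / R \<le> s n" "s n < 1" "0 < s n"
proof -
  show "1 / R \<le> s n" "s n < 1" using stage[of n] unfolding stage_def by auto
  then show "0 < s n" using R_pos(1) by linarith
qed

lemma G_holomorphic: "G n matrix_holomorphic_on \<Omega>"
  and G_accretive: "z \<in> \<Omega> \<Longrightarrow> accretive 0 (G n z)"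
  and E_holomorphic: "k \<le> m \<Longrightarrow> E n k matrix_holomorphic_on annulus (s n) (1 / s n)"
  and G_eq: "k \<le> m \<Longrightarrow> w \<in> annulus (s n) 1 \<Longrightarrow> G n (\<psi> k w) = P n k w + E n k w"
  using stage[of n] unfolding stage_def by auto

lemma s_le: "i \<le> j \<Longrightarrow> s i \<le> s j"
  by (rule lift_Suc_mono_le[of s, OF s_mono])

lemma pow16_le: "(1/16 :: real) ^ n \<le> (1/4) ^ n"
  by (intro power_mono) auto

lemma core_step4:
  assumes "z \<in> core (s j)" "j \<le> n"
  shows "norm (G (Suc n) z - G n z) \<le> a * (1/4) ^ n"
proof -
  have "z \<in> core (s (Suc n))" using core_mono[OF s_le[of j "Suc n"]] assms by auto
  then have "norm (G (Suc n) z - G n z) \<le> a * (1/16) ^ n" by (rule core_step)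
  also have "\<dots> \<le> a * (1/4) ^ n" using a pow16_le by simp
  finally show ?thesis .
qed

lemma limit_core:
  assumes "z \<in> core (s j)"
  shows "(\<lambda>n. G n z) \<longlonglongrightarrow> limit z" and "\<And>n. j \<le> n \<Longrightarrow> norm (G n z - limit z) \<le> 2 * a * (1/4) ^ n"
proof -
  note gc = geometric_convergence[where f = "\<lambda>n. G n z" and j = j and a = a]
  show "(\<lambda>n. G n z) \<longlonglongrightarrow> limit z"
    using gc(1)[OF _ core_step4[OF assms]] a unfolding limit_def by (simp add: convergent_LIMSEQ_iff)
  show "norm (G n z - limit z) \<le> 2 * a * (1/4) ^ n" if "j \<le> n" for n
    using gc(2)[OF _ core_step4[OF assms] that] a unfolding limit_def by simp
qed

lemma compact_subset_core_s:
  assumes "compact K" "K \<subseteq> \<Omega>"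
  obtains j where "K \<subseteq> core (s j)"
proof -
  obtain r where r: "r < 1" "\<And>t. r \<le> t \<Longrightarrow> K \<subseteq> core t" using compact_subset_core[OF assms] by blast
  obtain j where "1 / real (Suc j) < 1 - r" using r(1) nat_approx_posE[of "1 - r"] by auto
  then have "r \<le> s j" using s_ge[of j] by linarith
  then show ?thesis using r that by blast
qed

lemma limit_tendsto:
  assumes "z \<in> \<Omega>"
  shows "(\<lambda>n. G n z) \<longlonglongrightarrow> limit z"
proof -
  obtain j where "{z} \<subseteq> core (s j)" using compact_subset_core_s[of "{z}"] assms by auto
  then show ?thesis using limit_core by auto
qed

lemma limit_accretive: "z \<in> \<Omega> \<Longrightarrow> accretive 0 (limit z)"
  unfolding accretive_def
proof
  fix x assume z: "z \<in> \<Omega>"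
  have "(\<lambda>n. Re (hform (G n z) x)) \<longlonglongrightarrow> Re (hform (limit z) x)"
    by (intro tendsto_Re tendsto_hform limit_tendsto z)
  then show "0 * (norm x)\<^sup>2 \<le> Re (hform (limit z) x)"
    using G_accretive[OF z] by (intro tendsto_lowerbound[of _ _ sequentially]) (auto simp: accretive_def)
qed

lemma limit_holomorphic: "limit matrix_holomorphic_on \<Omega>"
  unfolding matrix_holomorphic_on_def
proof (intro allI)
  fix i j
  show "(\<lambda>z. limit z $ i $ j) holomorphic_on \<Omega>"
  proof (rule holomorphic_uniform_sequence[OF open_dom])
    show "(\<lambda>z. G n z $ i $ j) holomorphic_on \<Omega>" for n
      using G_holomorphic by (simp add: matrix_holomorphic_on_def)
    fix x assume "x \<in> \<Omega>"
    then obtain d where d: "d > 0" "cball x d \<subseteq> \<Omega>" using open_dom open_contains_cball by blast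
    obtain l where l: "cball x d \<subseteq> core (s l)" using compact_subset_core_s[OF _ d(2)] by auto
    have "uniform_limit (cball x d) (\<lambda>n z. G n z $ i $ j) (\<lambda>z. limit z $ i $ j) sequentially"
    proof (rule uniform_limitI)
      fix e :: real assume "0 < e"
      have "(\<lambda>n. 2 * a * (1/4 :: real) ^ n) \<longlonglongrightarrow> 0"
        by (intro tendsto_mult_right_zero LIMSEQ_realpow_zero) auto
      then have "\<forall>\<^sub>F n in sequentially. 2 * a * (1/4) ^ n < e" using \<open>0 < e\<close> by (rule order_tendstoD)
      then show "\<forall>\<^sub>F n in sequentially. \<forall>z\<in>cball x d. dist (G n z $ i $ j) (limit z $ i $ j) < e"
        using eventually_ge_at_top[of l]
      proof eventually_elim
        case (elim n)
        show ?case
        proof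
          fix z assume "z \<in> cball x d"
          then have "norm (G n z - limit z) \<le> 2 * a * (1/4) ^ n" using l elim by (intro limit_core(2)[of z l]) auto
          then show "dist (G n z $ i $ j) (limit z $ i $ j) < e"
            using norm_entry_le[of "G n z - limit z" i j] elim by (simp add: dist_norm)
        qed
      qed
    qed
    then show "\<exists>d>0. cball x d \<subseteq> \<Omega> \<and> uniform_limit (cball x d) (\<lambda>n z. G n z $ i $ j) (\<lambda>z. limit z $ i $ j) sequentially"
      using d by blast
  qed
qed

text \<open>Here n is positive because \<open>E n\<close> is known to be small only from index 1 on,
  with bound 16 a 16^-n. Two such terms divided by 4^-n give 32 a 4^-n, and the direct error a 16^-n
  rounds the constant up to 33.\<close>

lemma collar_step_good:
  assumes k: "k \<le> m" and w: "1 / R < norm w" "norm w < 1" and n: "0 < n"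
    and good: "w \<in> annulus (s (Suc n)) 1 \<Longrightarrow> (1/4) ^ n \<le> norm (1 + w ^ N n)"
  shows "norm (G (Suc n) (\<psi> k w) - G n (\<psi> k w)) \<le> 33 * a * (1/4) ^ n"
proof (cases "w \<in> annulus (s (Suc n)) 1")
  case True
  obtain l where l: "n = Suc l" using n by (cases n) auto
  have w1: "1 < 1 / s n" and sw: "s n < norm w" using s_bounds[of n] s_mono[of n] True by auto
  have wA: "w \<in> annulus (s n) (1 / s n)" using w w1 sw by auto
  have E1: "norm (E n k w) \<le> a * (1/16) ^ l" using E_small[OF k, of w l] wA l by simp
  have E2: "norm (E n k (1 / cnj w)) \<le> a * (1/16) ^ l"
    using E_small[OF k, of "1 / cnj w" l] inverse_cnj_annulus[OF s_bounds(3) wA] l by simp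
  have p: "(0::real) < (1/4) ^ n" by simp
  have "norm (G (Suc n) (\<psi> k w) - G n (\<psi> k w)) \<le>
      (norm (E n k w) + norm (E n k (1 / cnj w))) / norm (1 + w ^ N n) + a * (1/16) ^ n"
    by (rule collar_step[OF k True])
  also have "\<dots> \<le> (a * (1/16) ^ l + a * (1/16) ^ l) / (1/4) ^ n + a * (1/16) ^ n"
    using E1 E2 good[OF True] p a by (intro add_right_mono frac_le add_mono) auto
  also have "(a * (1/16) ^ l + a * (1/16) ^ l) / (1/4) ^ n = 32 * a * (1/4 :: real) ^ n"
  proof -
    have "(1/16 :: real) ^ l = 16 * ((1/4) ^ n * (1/4) ^ n)"
      unfolding l by (simp add: power_mult_distrib[symmetric])
    then show ?thesis by simp
  qed
  also have "32 * a * (1/4) ^ n + a * (1/16) ^ n \<le> 33 * a * (1/4) ^ n"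
    using a pow16_le[of n] by simp
  finally show ?thesis .
next
  case False
  have wA: "w \<in> annulus (1 / R) 1" "w \<in> annulus (1 / R) R" using w R by auto
  \<comment> \<open>A collar point below radius \<open>s (Suc n)\<close> belongs to none of the
    thinner collars, because the collars are disjoint and \<open>\<psi> k\<close> is injective. So
    the interior estimate covers it.\<close>
  have "\<psi> k w \<notin> \<psi> l ` annulus (s (Suc n)) 1" if l: "l \<le> m" for l
  proof
    assume "\<psi> k w \<in> \<psi> l ` annulus (s (Suc n)) 1"
    then obtain w' where w': "w' \<in> annulus (s (Suc n)) 1" "\<psi> k w = \<psi> l w'" by blast
    have w'A: "w' \<in> annulus (1 / R) R" by (rule mem_annulus_R[OF s_bounds(1) w'(1)])
    have "k = l" using disj[OF k l] wA(2) w'A w'(2) by blast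
    then have "w = w'" using inj_onD[OF inj[OF k] _ wA(2) w'A] w'(2) by simp
    then show False using False w'(1) by simp
  qed
  then have "\<psi> k w \<in> core (s (Suc n))" using inside[OF k wA(1)] by (auto simp: core_def)
  then have "norm (G (Suc n) (\<psi> k w) - G n (\<psi> k w)) \<le> a * (1/16) ^ n" by (rule core_step)
  also have "\<dots> \<le> a * (1/4) ^ n" using a pow16_le by simp
  also have "\<dots> \<le> 33 * a * (1/4) ^ n" using a by simp
  finally show ?thesis .
qed

text \<open>Suppose |1 + w^N| < q = 4^-n. Then |w|^N \<ge> 1 - q, and Bernoulli gives N (1 - |w|)
  \<le> 2 q whatever N is. The Stolz condition turns this into |w^N - w0^N| \<le> 2 M q, so |1 +
  w0^N| < (1 + 2 M) q, which for large n is at most 2^-n and contradicts the choice of w0.\<close>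

lemma stolz_step:
  assumes k: "k \<le> m" and w0: "norm w0 = 1" and M: "1 \<le> M"
    and ev: "\<forall>\<^sub>F n in sequentially. (1/2) ^ n \<le> norm (1 + w0 ^ N n)"
  shows "\<exists>j. \<forall>n\<ge>j. \<forall>w. 1 / R < norm w \<longrightarrow> norm w < 1 \<longrightarrow> norm (w - w0) \<le> M * (1 - norm w) \<longrightarrow>
    norm (G (Suc n) (\<psi> k w) - G n (\<psi> k w)) \<le> 33 * a * (1/4) ^ n"
proof -
  have "(\<lambda>n. (1 + 2 * M) * (1/2 :: real) ^ n) \<longlonglongrightarrow> 0"
    by (intro tendsto_mult_right_zero LIMSEQ_realpow_zero) auto
  then have "\<forall>\<^sub>F n in sequentially. (1 + 2 * M) * (1/2) ^ n < 1" by (rule order_tendstoD) simp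
  then have "\<forall>\<^sub>F n in sequentially. (1 + 2 * M) * (1/2) ^ n < 1 \<and> (1/2) ^ n \<le> norm (1 + w0 ^ N n) \<and> 0 < n"
    using ev eventually_gt_at_top[of 0] by eventually_elim auto
  then obtain j where j: "\<And>n. j \<le> n \<Longrightarrow> (1 + 2 * M) * (1/2) ^ n < 1"
    "\<And>n. j \<le> n \<Longrightarrow> (1/2) ^ n \<le> norm (1 + w0 ^ N n)" "\<And>n. j \<le> n \<Longrightarrow> 0 < n"
    unfolding eventually_sequentially by blast
  have "norm (G (Suc n) (\<psi> k w) - G n (\<psi> k w)) \<le> 33 * a * (1/4) ^ n"
    if n: "j \<le> n" and w: "1 / R < norm w" "norm w < 1" "norm (w - w0) \<le> M * (1 - norm w)" for n w
  proof (rule collar_step_good[OF k w(1,2) j(3)[OF n]], rule ccontr)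
    assume "\<not> (1/4) ^ n \<le> norm (1 + w ^ N n)"
    then have small: "norm (1 + w ^ N n) < (1/4) ^ n" by simp
    define q :: real where "q = (1/4) ^ n"
    define y where "y = real (N n) * (1 - norm w)"
    have q: "0 < q" "q \<le> 1/4"
    proof -
      show "0 < q" by (simp add: q_def)
      have "(1/4 :: real) ^ n \<le> (1/4) ^ 1" using j(3)[OF n] by (intro power_decreasing) auto
      then show "q \<le> 1/4" by (simp add: q_def)
    qed
    have y0: "0 \<le> y" using w by (simp add: y_def)
    have wpos: "0 < norm w" using w R_pos by linarith
    have "1 - norm (w ^ N n) \<le> norm (1 + w ^ N n)" by (metis norm_one norm_diff_ineq)
    then have big: "1 - q \<le> norm w ^ N n" using small by (simp add: q_def norm_power)
    have "norm w ^ N n * (1 + y) \<le> 1" unfolding y_def using w wpos by (intro power_mult_le_one) auto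
    then have "(1 - q) * (1 + y) \<le> 1" using mult_right_mono[OF big, of "1 + y"] y0 by linarith
    then have "y * (1 - q) \<le> q" by (simp add: algebra_simps)
    moreover have "y * (3/4) \<le> y * (1 - q)" using y0 q by (intro mult_left_mono) auto
    ultimately have y2: "y \<le> 2 * q" using y0 q by linarith
    have "norm (w ^ N n - w0 ^ N n) \<le> real (N n) * norm (w - w0)"
      using w w0 by (intro norm_power_diff) auto
    also have "\<dots> \<le> real (N n) * (M * (1 - norm w))" using w(3) by (intro mult_left_mono) auto
    also have "\<dots> = M * y" by (simp add: y_def)
    also have "\<dots> \<le> M * (2 * q)" using y2 M by (intro mult_left_mono) auto
    finally have "norm (w ^ N n - w0 ^ N n) \<le> M * (2 * q)" .
    moreover have "norm (1 + w0 ^ N n) \<le> norm (1 + w ^ N n) + norm (w ^ N n - w0 ^ N n)"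
      using norm_triangle_ineq4[of "1 + w ^ N n" "w ^ N n - w0 ^ N n"] by simp
    ultimately have "norm (1 + w0 ^ N n) < (1 + 2 * M) * q" using small by (simp add: q_def algebra_simps)
    also have "\<dots> = (1 + 2 * M) * (1/2) ^ n * (1/2) ^ n"
      by (simp add: q_def power_mult_distrib[symmetric])
    also have "\<dots> \<le> 1 * (1/2) ^ n" using j(1)[OF n] by (intro mult_right_mono) auto
    finally show False using j(2)[OF n] by simp
  qed
  then show ?thesis by blast
qed

text \<open>\<open>P n\<close> is a finite sum of twists. Each one is continuous at w0, because w0
  is not a pole, and skew there. The limit is unrestricted; the restriction to angles enters only
  when n tends to infinity.\<close>

lemma P_boundary:
  assumes k: "k \<le> m" and w0: "norm w0 = 1" and nz: "\<And>n. 1 + w0 ^ N n \<noteq> 0"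
  shows "\<exists>L. skew_hermitian L \<and> (P n k \<longlongrightarrow> L) (at w0 within ball 0 1)"
proof (induction n)
  case 0
  have "skew_hermitian (0 :: complex^'n^'n)" by (simp add: skew_hermitian_def hform_def)
  then show ?case unfolding P0 by (intro exI[of _ 0]) simp
next
  case (Suc n)
  then obtain L where L: "skew_hermitian L" "(P n k \<longlongrightarrow> L) (at w0 within ball 0 1)" by blast
  let ?A = "annulus (s n) (1 / s n)"
  have w0A: "w0 \<in> ?A" using w0 s_bounds[of n] by simp
  define S where "S = ?A \<inter> {w. 1 + w ^ N n \<noteq> 0}"
  have "open {w::complex. 1 + w ^ N n \<noteq> 0}"
    by (intro open_Collect_neq continuous_intros)
  then have "open S" unfolding S_def by (intro open_Int) auto
  moreover have "twist (N n) (E n k) matrix_holomorphic_on S"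
    unfolding S_def by (rule matrix_holomorphic_twist[OF E_holomorphic[OF k] s_bounds(3)]) auto
  ultimately have tw: "(twist (N n) (E n k) \<longlongrightarrow> twist (N n) (E n k) w0) (at w0 within ball 0 1)"
    using w0A nz[of n] by (intro matrix_holomorphic_tendsto[of _ S]) (auto simp: S_def)
  have "((\<lambda>w. P n k w + twist (N n) (E n k) w) \<longlongrightarrow> L + twist (N n) (E n k) w0) (at w0 within ball 0 1)"
    by (intro tendsto_add L tw)
  moreover have "\<forall>\<^sub>F w in at w0 within ball 0 1. P n k w + twist (N n) (E n k) w = P (Suc n) k w"
  proof -
    have "\<forall>\<^sub>F w in at w0 within ball 0 1. w \<in> annulus (s (Suc n)) (1 / s (Suc n)) \<and> w \<in> ball 0 1"
      unfolding eventually_at_topological using w0 s_bounds[of "Suc n"]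
      by (intro exI[of _ "annulus (s (Suc n)) (1 / s (Suc n))"]) auto
    then show ?thesis
    proof eventually_elim
      case (elim w)
      then have "w \<in> annulus (s (Suc n)) 1" by simp
      then show ?case using P_step[OF k] by simp
    qed
  qed
  ultimately have "(P (Suc n) k \<longlongrightarrow> L + twist (N n) (E n k) w0) (at w0 within ball 0 1)"
    by (rule Lim_transform_eventually)
  moreover have "skew_hermitian (L + twist (N n) (E n k) w0)"
    using L(1) skew_hermitian_twist[OF w0 nz, of n "E n k"] by (simp add: skew_hermitian_def hform_add)
  ultimately show ?case by blast
qed

text \<open>Interchange of limits: in a fixed Stolz angle the \<open>G n\<close> eventually converge
  uniformly at geometric rate, and each has a boundary limit, a skew part plus
  \<open>E n k w0\<close>. As the latter tends to 0, the limit of these limits is skew.\<close>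

lemma limit_stolz:
  assumes k: "k \<le> m" and w0: "norm w0 = 1" and nz: "\<And>n. 1 + w0 ^ N n \<noteq> 0"
    and ev: "\<forall>\<^sub>F n in sequentially. (1/2) ^ n \<le> norm (1 + w0 ^ N n)"
  shows "\<exists>L. skew_hermitian L \<and> (\<forall>M\<ge>1. ((\<lambda>w. limit (\<psi> k w)) \<longlongrightarrow> L)
    (at w0 within {w. 1 / R < norm w \<and> norm w < 1 \<and> norm (w - w0) \<le> M * (1 - norm w)}))"
proof -
  define D where "D M = {w. 1 / R < norm w \<and> norm w < 1 \<and> norm (w - w0) \<le> M * (1 - norm w)}" for M
  have Dball: "D M \<subseteq> ball 0 1" for M by (auto simp: D_def)
  \<comment> \<open>The radius to w0 lies in every angle with M \<ge> 1; for M = 1 the set is just a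
    piece of that radius. Nontriviality is needed to pass bounds to the boundary limits.\<close>
  have nontriv: "at w0 within D M \<noteq> bot" if M: "1 \<le> M" for M
  proof -
    have "w0 islimpt D M"
      unfolding islimpt_approachable
    proof (intro allI impI)
      fix e :: real assume e: "0 < e"
      obtain d where "0 < d" "d < min e (1 - 1 / R)"
        using dense[of 0 "min e (1 - 1 / R)"] e R_pos by auto
      then have "d < 1 - 1 / R" and d: "0 < d" "d < e" by auto
      then have d: "0 < d" "d < e" "d < 1" "1 / R < 1 - d" using R_pos(1) by linarith+
      have nw: "norm (of_real (1 - d) * w0) = 1 - d" using d w0 by (simp only: norm_mult norm_of_real; simp)
      have "of_real (1 - d) * w0 - w0 = of_real (- d) * w0" by (simp add: algebra_simps)
      then have dw: "norm (of_real (1 - d) * w0 - w0) = d" using d w0 by (simp only: norm_mult norm_of_real; simp)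
      have "d \<le> M * (1 - (1 - d))" using M d mult_right_mono[OF M, of d] by simp
      then have "of_real (1 - d) * w0 \<in> D M" unfolding D_def mem_Collect_eq nw dw using d by simp
      moreover have "of_real (1 - d) * w0 \<noteq> w0" using dw d by auto
      moreover have "dist (of_real (1 - d) * w0) w0 < e" using dw d unfolding dist_norm by linarith
      ultimately show "\<exists>x'\<in>D M. x' \<noteq> w0 \<and> dist x' w0 < e" by blast
    qed
    then show ?thesis by (simp add: trivial_limit_within)
  qed
  have "\<exists>L. skew_hermitian L \<and> (P n k \<longlongrightarrow> L) (at w0 within ball 0 1)" for n
    by (rule P_boundary[OF k w0 nz])
  then obtain LP where LP: "\<And>n. skew_hermitian (LP n)" "\<And>n. (P n k \<longlongrightarrow> LP n) (at w0 within ball 0 1)" by metis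
  define L where "L n = LP n + E n k w0" for n
  have w0A: "w0 \<in> annulus (s n) (1 / s n)" for n using w0 s_bounds[of n] by simp
  have Glim: "((\<lambda>w. G n (\<psi> k w)) \<longlongrightarrow> L n) (at w0 within ball 0 1)" for n
  proof -
    have "((\<lambda>w. P n k w + E n k w) \<longlongrightarrow> L n) (at w0 within ball 0 1)"
      unfolding L_def by (intro tendsto_add LP matrix_holomorphic_tendsto[OF E_holomorphic[OF k]] w0A) auto
    moreover have "\<forall>\<^sub>F w in at w0 within ball 0 1. P n k w + E n k w = G n (\<psi> k w)"
    proof -
      have "\<forall>\<^sub>F w in at w0 within ball 0 1. w \<in> annulus (s n) (1 / s n) \<and> w \<in> ball 0 1"
        unfolding eventually_at_topological using w0A
        by (intro exI[of _ "annulus (s n) (1 / s n)"]) auto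
      then show ?thesis
      proof eventually_elim
        case (elim w)
        then have "w \<in> annulus (s n) 1" by simp
        then show ?case using G_eq[OF k] by simp
      qed
    qed
    ultimately show ?thesis by (rule Lim_transform_eventually)
  qed
  have GlimD: "((\<lambda>w. G n (\<psi> k w)) \<longlongrightarrow> L n) (at w0 within D M)" for n M
    by (rule tendsto_within_subset[OF Glim Dball])
  have evD: "\<forall>\<^sub>F w in at w0 within D M. w \<in> D M" for M by (auto simp: eventually_at_filter)
  have steps: "\<exists>j. \<forall>n\<ge>j. \<forall>w\<in>D M. norm (G (Suc n) (\<psi> k w) - G n (\<psi> k w)) \<le> 33 * a * (1/4) ^ n"
    if "1 \<le> M" for M
    using stolz_step[OF k w0 that ev] unfolding D_def by blast
  \<comment> \<open>The boundary limits \<open>L n\<close> do not depend on the aperture, so their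
    convergence is established along the radius alone.\<close>
  obtain j where j: "\<And>n w. j \<le> n \<Longrightarrow> w \<in> D 1 \<Longrightarrow> norm (G (Suc n) (\<psi> k w) - G n (\<psi> k w)) \<le> 33 * a * (1/4) ^ n"
    using steps[of 1] by auto
  have "norm (L (Suc n) - L n) \<le> 33 * a * (1/4) ^ n" if n: "j \<le> n" for n
  proof (rule tendsto_upperbound[OF _ _ nontriv[of 1]])
    show "((\<lambda>w. norm (G (Suc n) (\<psi> k w) - G n (\<psi> k w))) \<longlongrightarrow> norm (L (Suc n) - L n)) (at w0 within D 1)"
      by (intro tendsto_intros GlimD)
    show "\<forall>\<^sub>F w in at w0 within D 1. norm (G (Suc n) (\<psi> k w) - G n (\<psi> k w)) \<le> 33 * a * (1/4) ^ n"
      using evD by eventually_elim (rule j[OF n])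
  qed simp
  then have Lconv: "L \<longlonglongrightarrow> lim L"
    using geometric_convergence(1)[of "33 * a" j L] a by (simp add: convergent_LIMSEQ_iff)
  have skew: "skew_hermitian (lim L)"
    unfolding skew_hermitian_def
  proof
    fix x
    have "(\<lambda>n. Re (hform (L (Suc n)) x)) \<longlonglongrightarrow> Re (hform (lim L) x)"
      by (intro tendsto_Re tendsto_hform LIMSEQ_Suc Lconv)
    moreover have "(\<lambda>n. Re (hform (L (Suc n)) x)) \<longlonglongrightarrow> 0"
    proof (rule tendsto_rabs_zero_cancel, rule tendsto_sandwich[OF _ _ tendsto_const])
      show "\<forall>\<^sub>F n in sequentially. \<bar>Re (hform (L (Suc n)) x)\<bar> \<le> a * (1/16) ^ n * (norm x)\<^sup>2"
      proof (rule always_eventually, rule allI)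
        fix n
        have "Re (hform (L (Suc n)) x) = Re (hform (E (Suc n) k w0) x)"
          using LP(1)[of "Suc n"] by (simp add: L_def hform_add skew_hermitian_def)
        also have "\<bar>\<dots>\<bar> \<le> norm (E (Suc n) k w0) * (norm x)\<^sup>2"
          using abs_Re_le_cmod norm_hform_le order_trans by blast
        also have "\<dots> \<le> a * (1/16) ^ n * (norm x)\<^sup>2"
          by (intro mult_right_mono E_small[OF k w0A]) simp
        finally show "\<bar>Re (hform (L (Suc n)) x)\<bar> \<le> a * (1/16) ^ n * (norm x)\<^sup>2" .
      qed
      show "(\<lambda>n. a * (1/16) ^ n * (norm x)\<^sup>2) \<longlonglongrightarrow> 0"
        by (intro tendsto_mult_left_zero tendsto_mult_right_zero LIMSEQ_realpow_zero) auto
    qed simp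
    ultimately show "Re (hform (lim L) x) = 0" using LIMSEQ_unique by blast
  qed
  have "((\<lambda>w. limit (\<psi> k w)) \<longlongrightarrow> lim L) (at w0 within D M)" if M: "1 \<le> M" for M
  proof (rule swap_uniform_limit[OF _ Lconv])
    show "\<forall>\<^sub>F n in sequentially. ((\<lambda>w. G n (\<psi> k w)) \<longlongrightarrow> L n) (at w0 within D M)"
      by (simp add: GlimD)
    obtain l where l: "\<And>n w. l \<le> n \<Longrightarrow> w \<in> D M \<Longrightarrow> norm (G (Suc n) (\<psi> k w) - G n (\<psi> k w)) \<le> 33 * a * (1/4) ^ n"
      using steps[OF M] by auto
    show "uniform_limit (D M) (\<lambda>n w. G n (\<psi> k w)) (\<lambda>w. limit (\<psi> k w)) sequentially"
    proof (rule uniform_limitI)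
      fix e :: real assume "0 < e"
      have "(\<lambda>n. 2 * (33 * a) * (1/4 :: real) ^ n) \<longlonglongrightarrow> 0"
        by (intro tendsto_mult_right_zero LIMSEQ_realpow_zero) auto
      then have "\<forall>\<^sub>F n in sequentially. 2 * (33 * a) * (1/4) ^ n < e" using \<open>0 < e\<close> by (rule order_tendstoD)
      then show "\<forall>\<^sub>F n in sequentially. \<forall>w\<in>D M. dist (G n (\<psi> k w)) (limit (\<psi> k w)) < e"
        using eventually_ge_at_top[of l]
      proof eventually_elim
        case (elim n)
        show ?case
        proof
          fix w assume w: "w \<in> D M"
          have "norm (G n (\<psi> k w) - limit (\<psi> k w)) \<le> 2 * (33 * a) * (1/4) ^ n"
            unfolding limit_def
            using geometric_convergence(2)[where f = "\<lambda>n. G n (\<psi> k w)" and j = l and a = "33 * a"] l w elim a by simp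
          then show "dist (G n (\<psi> k w)) (limit (\<psi> k w)) < e" using elim by (simp add: dist_norm)
        qed
      qed
    qed
  qed simp
  then show ?thesis using skew unfolding D_def by blast
qed

text \<open>The aperture M depends on \<alpha>, but \<open>L\<close> was obtained for all apertures
  at once, so it serves every approach region.\<close>

lemma cayley_limit_nontangential:
  assumes k: "k \<le> m" and w0: "norm w0 = 1" and nz: "\<And>n. 1 + w0 ^ N n \<noteq> 0"
    and ev: "\<forall>\<^sub>F n in sequentially. (1/2) ^ n \<le> norm (1 + w0 ^ N n)"
  shows "\<exists>L. has_nontangential_limit \<Omega> (\<lambda>z. cayley (limit z)) (\<psi> k w0) L \<and> unitary_matrix L"
proof -
  obtain L where L: "skew_hermitian L" "\<And>M. 1 \<le> M \<Longrightarrow> ((\<lambda>w. limit (\<psi> k w)) \<longlongrightarrow> L)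
    (at w0 within {w. 1 / R < norm w \<and> norm w < 1 \<and> norm (w - w0) \<le> M * (1 - norm w)})"
    using limit_stolz[OF assms] by blast
  have "has_nontangential_limit \<Omega> (\<lambda>z. cayley (limit z)) (\<psi> k w0) (cayley L)"
    unfolding has_nontangential_limit_def
  proof (intro allI impI)
    fix \<alpha> :: real assume "0 < \<alpha>"
    let ?F = "at (\<psi> k w0) within approach_region \<Omega> \<alpha> (\<psi> k w0)"
    obtain M g where M: "1 \<le> M" and g: "(g \<longlongrightarrow> w0) ?F"
      and gD: "\<forall>\<^sub>F z in ?F. \<psi> k (g z) = z \<and> 1 / R < norm (g z) \<and> norm (g z) < 1 \<and> norm (g z - w0) \<le> M * (1 - norm (g z))"
      using approach_region_stolz[OF k w0] by blast
    let ?D = "{w. 1 / R < norm w \<and> norm w < 1 \<and> norm (w - w0) \<le> M * (1 - norm w)}"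
    have "filterlim g (at w0 within ?D) ?F"
      unfolding filterlim_at using g gD w0 by (auto elim!: eventually_mono)
    then have "((\<lambda>z. limit (\<psi> k (g z))) \<longlongrightarrow> L) ?F" by (rule filterlim_compose[OF L(2)[OF M]])
    moreover have "\<forall>\<^sub>F z in ?F. limit (\<psi> k (g z)) = limit z" using gD by eventually_elim simp
    ultimately have "(limit \<longlongrightarrow> L) ?F" by (rule Lim_transform_eventually)
    moreover have "\<forall>\<^sub>F z in ?F. accretive 0 (limit z)"
      by (auto simp: eventually_at_filter approach_region_def limit_accretive)
    ultimately show "((\<lambda>z. cayley (limit z)) \<longlongrightarrow> cayley L) ?F"
      by (intro tendsto_cayley skew_hermitian_accretive L(1))
  qed
  then show ?thesis using unitary_cayley[OF L(1)] by blast
qed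

end

lemma (in collared_domain) refined_sequence_exists:
  fixes F :: "complex \<Rightarrow> complex^'n^'n"
  assumes F: "F matrix_holomorphic_on \<Omega>" "c > 0" "\<And>z. z \<in> \<Omega> \<Longrightarrow> accretive c (F z)"
    and r: "r < 1" and e: "0 < e"
  shows "\<exists>G P E s N a. refined_sequence \<Omega> m \<psi> R G P E s N a \<and>
    (\<forall>z\<in>core r. norm (refined_sequence.limit G z - F z) \<le> e)"
proof -
  \<comment> \<open>\<open>limit\<close> is within 2 a = e / 2 of \<open>G 0\<close>, and
    \<open>G 0\<close> is taken within e / 2 of \<open>F\<close>.\<close>
  define a where "a = e / 4"
  have a: "0 < a" using e by (simp add: a_def)
  \<comment> \<open>The state of the recursion carries a clause for n = 0 so that the initial data
    survive the dependent choice.\<close>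
  define good where "good n x \<longleftrightarrow> (case x of (G :: complex \<Rightarrow> complex^'n^'n, P, E, s) \<Rightarrow>
    stage G P E s \<and> 1 - 1 / real (Suc n) \<le> s \<and>
    (n = 0 \<longrightarrow> P = (\<lambda>k w. 0) \<and> r \<le> s \<and> (\<forall>z\<in>core r. norm (G z - F z) \<le> e / 2)))" for n x
  define step where "step n N x y \<longleftrightarrow> (case x of (G :: complex \<Rightarrow> complex^'n^'n, P, E :: nat \<Rightarrow> complex \<Rightarrow> complex^'n^'n, s) \<Rightarrow>
    case y of (G', P', E' :: nat \<Rightarrow> complex \<Rightarrow> complex^'n^'n, s') \<Rightarrow>
    s \<le> s' \<and> 0 < N \<and> (\<forall>z\<in>core s'. norm (G' z - G z) \<le> a * (1/16) ^ n) \<and>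
    (\<forall>k\<le>m. (\<forall>w\<in>annulus s' (1 / s'). norm (E' k w) \<le> a * (1/16) ^ n) \<and>
      (\<forall>w\<in>annulus s' 1. P' k w = P k w + twist N (E k) w \<and>
        norm (G' (\<psi> k w) - G (\<psi> k w)) \<le> (norm (E k w) + norm (E k (1 / cnj w))) / norm (1 + w ^ N) + a * (1/16) ^ n)))"
    for n N x y
  have "\<exists>x. good 0 x"
  proof -
    obtain G E s where "stage G (\<lambda>k w. 0) E s" "r \<le> s" "\<forall>z\<in>core r. norm (G z - F z) \<le> e / 2"
      using initial_stage[OF F r, of "e / 2"] e by auto
    moreover then have "0 \<le> s" using R_pos unfolding stage_def by linarith
    ultimately have "good 0 (G, \<lambda>k w. 0, E, s)" by (simp add: good_def)
    then show ?thesis by blast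
  qed
  moreover have "\<exists>y. good (Suc n) y \<and> (\<exists>N. step n N x y)" if x: "good n x" for n x
  proof -
    obtain G P E s where xe: "x = (G, P, E, s)" by (cases x) auto
    have st: "stage G P E s" using x by (simp add: good_def xe)
    obtain G' P' E' s' N where y: "stage G' P' E' s'" "s \<le> s'" "1 - 1 / real (Suc (Suc n)) \<le> s'" "0 < N"
      "\<forall>z\<in>core s'. norm (G' z - G z) \<le> a * (1/16) ^ n"
      "\<forall>k\<le>m. (\<forall>w\<in>annulus s' (1 / s'). norm (E' k w) \<le> a * (1/16) ^ n) \<and>
      (\<forall>w\<in>annulus s' 1. P' k w = P k w + twist N (E k) w \<and>
        norm (G' (\<psi> k w) - G (\<psi> k w)) \<le> (norm (E k w) + norm (E k (1 / cnj w))) / norm (1 + w ^ N) + a * (1/16) ^ n)"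
      using refine_stage[OF st, of "1 - 1 / real (Suc (Suc n))" "a * (1/16) ^ n"] a by (auto simp del: of_nat_Suc)
    have "good (Suc n) (G', P', E', s')" using y(1,3) by (simp add: good_def)
    moreover have "step n N x (G', P', E', s')" using y(2,4-6) by (simp add: step_def xe)
    ultimately show ?thesis by blast
  qed
  \<comment> \<open>N belongs to a transition rather than to a state, so it is hidden in the step
    relation and extracted afterwards.\<close>
  ultimately obtain X where X: "\<And>n. good n (X n)" "\<And>n. \<exists>N. step n N (X n) (X (Suc n))"
    using dependent_nat_choice[of good "\<lambda>n x y. \<exists>N. step n N x y"] by metis
  then obtain N where N: "\<And>n. step n (N n) (X n) (X (Suc n))" by metis
  define G where "G n = fst (X n)" for n
  define P where "P n = fst (snd (X n))" for n
  define E where "E n = fst (snd (snd (X n)))" for n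
  define s where "s n = snd (snd (snd (X n)))" for n
  have Xn: "X n = (G n, P n, E n, s n)" for n by (simp add: G_def P_def E_def s_def)
  have step': "s n \<le> s (Suc n) \<and> 0 < N n \<and> (\<forall>z\<in>core (s (Suc n)). norm (G (Suc n) z - G n z) \<le> a * (1/16) ^ n) \<and>
    (\<forall>k\<le>m. (\<forall>w\<in>annulus (s (Suc n)) (1 / s (Suc n)). norm (E (Suc n) k w) \<le> a * (1/16) ^ n) \<and>
      (\<forall>w\<in>annulus (s (Suc n)) 1. P (Suc n) k w = P n k w + twist (N n) (E n k) w \<and>
        norm (G (Suc n) (\<psi> k w) - G n (\<psi> k w)) \<le>
          (norm (E n k w) + norm (E n k (1 / cnj w))) / norm (1 + w ^ N n) + a * (1/16) ^ n))" for n
    using N[of n] unfolding Xn step_def prod.case .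
  have good': "stage (G n) (P n) (E n) (s n)" "1 - 1 / real (Suc n) \<le> s n" for n
    using X(1)[of n] unfolding Xn good_def prod.case by blast+
  have good0: "P 0 = (\<lambda>k w. 0)" "r \<le> s 0" "\<And>z. z \<in> core r \<Longrightarrow> norm (G 0 z - F z) \<le> e / 2"
    using X(1)[of 0] unfolding Xn good_def prod.case by blast+
  interpret refined_sequence \<Omega> m \<psi> R G P E s N a
    by unfold_locales (use step' good' good0 a in blast)+
  have "norm (limit z - F z) \<le> e" if z: "z \<in> core r" for z
  proof -
    have "z \<in> core (s 0)" using z core_mono[OF good0(2)] by blast
    then have "norm (G 0 z - limit z) \<le> 2 * a" using limit_core(2)[of z 0 0] by simp
    moreover have "norm (limit z - F z) \<le> norm (G 0 z - limit z) + norm (G 0 z - F z)"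
      using norm_triangle_ineq4[of "G 0 z - F z" "G 0 z - limit z"] by simp
    ultimately show ?thesis using good0(3)[OF z] by (simp add: a_def)
  qed
  then show ?thesis using refined_sequence_axioms by blast
qed

section \<open>Exceptional boundary points\<close>

text \<open>The bound does not involve N: there are O(N) places where w^N = -1, and each contributes
  an interval of length 2 e / N. The 16 is generous; the cover below has total length at most 8
  e.\<close>

lemma emeasure_near_minus_one:
  assumes N: "0 < N" and e: "0 < e" "e \<le> 1/4" and sig: "\<sigma> = 1 \<or> \<sigma> = (- 1 :: real)"
  shows "emeasure lborel {t \<in> {0..1::real}. norm (1 + cis (2 * pi * (\<sigma> * t)) ^ N) < e} \<le> ennreal (16 * e)"
proof -
  \<comment> \<open>Intervals around the solutions of \<sigma> t N = l - 1/2. The index range used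
    below is large enough for both signs of \<sigma>.\<close>
  let ?I = "\<lambda>l::int. {\<sigma> * (of_int l - 1/2) / real N - e / real N .. \<sigma> * (of_int l - 1/2) / real N + e / real N}"
  have sub: "{t \<in> {0..1::real}. norm (1 + cis (2 * pi * (\<sigma> * t)) ^ N) < e} \<subseteq> (\<Union>l\<in>{- int N..int N + 1}. ?I l)"
  proof
    fix t assume "t \<in> {t \<in> {0..1::real}. norm (1 + cis (2 * pi * (\<sigma> * t)) ^ N) < e}"
    then have t: "0 \<le> t" "t \<le> 1" and small: "norm (1 + cis (2 * pi * (\<sigma> * t)) ^ N) < e" by auto
    define z where "z = cis (2 * pi * (\<sigma> * t)) ^ N"
    have ze: "z = exp (\<i> * of_real (2 * pi * (\<sigma> * t * real N)))"
      unfolding z_def Complex.DeMoivre by (simp add: cis_conv_exp mult_ac)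
    define u where "u = - (1 + z)"
    have u: "norm u < e" unfolding u_def norm_minus_cancel using small by (simp add: z_def)
    have z0: "z \<noteq> 0" by (simp add: ze)
    have "1 + u = - z" by (simp add: u_def)
    then have "exp (Ln (1 + u)) = - z" using z0 by simp
    also have "\<dots> = exp (\<i> * of_real (2 * pi * (\<sigma> * t * real N)) + \<i> * pi)"
      unfolding ze exp_add by (simp add: exp_eq_polar)
    finally obtain l :: int where l: "Ln (1 + u) = \<i> * of_real (2 * pi * (\<sigma> * t * real N)) + \<i> * pi + (of_int (2 * l) * pi) * \<i>"
      unfolding exp_eq by blast
    then have "Im (Ln (1 + u)) = 2 * pi * (\<sigma> * t * real N) + pi + 2 * of_int l * pi" by simp
    then have im: "Im (Ln (1 + u)) = 2 * pi * (\<sigma> * t * real N + 1/2 + of_int l)" by (simp add: algebra_simps)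
    \<comment> \<open>For |u| < 1/2 one has |Ln (1 + u)| \<le> 2 |u|. The imaginary part is 2 pi
      times the offset of \<sigma> t N from a half-integer, so that offset is at most e.\<close>
    have "\<bar>Im (Ln (1 + u))\<bar> \<le> 2 * e"
      using abs_Im_le_cmod[of "Ln (1 + u)"] norm_Ln_le[of u] u e by linarith
    then have "2 * (pi * \<bar>\<sigma> * t * real N + 1/2 + of_int l\<bar>) \<le> 2 * e"
      unfolding im abs_mult by simp
    moreover have "1 * \<bar>\<sigma> * t * real N + 1/2 + of_int l\<bar> \<le> pi * \<bar>\<sigma> * t * real N + 1/2 + of_int l\<bar>"
      using pi_gt3 by (intro mult_right_mono) auto
    ultimately have d: "\<bar>\<sigma> * t * real N - (of_int (- l) - 1/2)\<bar> \<le> e" by simp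
    define p where "p = - l"
    have d': "\<bar>\<sigma> * t * real N - (of_int p - 1/2)\<bar> \<le> e" using d by (simp add: p_def)
    have tN: "0 \<le> t * real N" "t * real N \<le> real N" using t by (auto simp: mult_left_le_one_le)
    have "- real N \<le> \<sigma> * t * real N" "\<sigma> * t * real N \<le> real N" using tN sig by auto
    then have "real_of_int p < real N + 1" "- real N - 1 < real_of_int p" using d' e by linarith+
    then have pr: "p \<in> {- int N..int N + 1}" by simp
    have ss: "\<sigma> * \<sigma> = 1" using sig by auto
    have "\<bar>t * real N - \<sigma> * (of_int p - 1/2)\<bar> = \<bar>\<sigma>\<bar> * \<bar>\<sigma> * t * real N - (of_int p - 1/2)\<bar>"
      unfolding abs_mult[symmetric] right_diff_distrib using ss by (simp add: mult.assoc[symmetric])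
    then have "\<bar>t * real N - \<sigma> * (of_int p - 1/2)\<bar> \<le> e" using d' sig by auto
    then have "\<sigma> * (of_int p - 1/2) - e \<le> t * real N" "t * real N \<le> \<sigma> * (of_int p - 1/2) + e" by linarith+
    then have "t \<in> ?I p" using N by (simp add: diff_divide_distrib[symmetric] add_divide_distrib[symmetric] pos_divide_le_eq pos_le_divide_eq)
    then show "t \<in> (\<Union>l\<in>{- int N..int N + 1}. ?I l)" using pr by blast
  qed
  have "emeasure lborel {t \<in> {0..1::real}. norm (1 + cis (2 * pi * (\<sigma> * t)) ^ N) < e} \<le> emeasure lborel (\<Union>l\<in>{- int N..int N + 1}. ?I l)"
    by (rule emeasure_mono[OF sub]) auto
  also have "\<dots> \<le> (\<Sum>l\<in>{- int N..int N + 1}. emeasure lborel (?I l))"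
    by (intro emeasure_subadditive_finite) auto
  also have "\<dots> = (\<Sum>l\<in>{- int N..int N + 1}. ennreal (2 * (e / real N)))"
    using e by (intro sum.cong refl) simp
  also have "\<dots> = ennreal (real (nat (2 * int N + 2)) * (2 * (e / real N)))"
    by (subst sum_ennreal) (use e in simp_all)
  also have "\<dots> \<le> ennreal (16 * e)"
  proof (rule ennreal_leI)
    have "real (nat (2 * int N + 2)) * (2 * (e / real N)) = 4 * e + 4 * e / real N"
      using N by (simp add: nat_add_distrib nat_mult_distrib field_simps)
    also have "4 * e / real N \<le> 4 * e" using N e by (simp add: field_simps)
    finally show "real (nat (2 * int N + 2)) * (2 * (e / real N)) \<le> 16 * e" using e by simp
  qed
  finally show ?thesis .
qed

text \<open>The first clause keeps the point off the poles of every single stage; the second is what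
  Borel-Cantelli provides and only concerns late stages.\<close>

definition resonance_free :: "(nat \<Rightarrow> nat) \<Rightarrow> complex \<Rightarrow> bool" where
  "resonance_free N w \<longleftrightarrow> (\<forall>n. 1 + w ^ N n \<noteq> 0) \<and> (\<forall>\<^sub>F n in sequentially. (1/2) ^ n \<le> norm (1 + w ^ N n))"

lemma AE_resonance_free:
  assumes N: "\<And>n. 0 < N n" and sig: "\<sigma> = 1 \<or> \<sigma> = (- 1 :: real)"
  shows "AE t in lebesgue_on {0..1}. resonance_free N (cis (2 * pi * (\<sigma> * t)))"
proof -
  let ?M = "lebesgue_on {0..1::real}"
  define A where "A n e = {t \<in> {0..1::real}. norm (1 + cis (2 * pi * (\<sigma> * t)) ^ N n) < e}" for n e
  have Ab: "A n e \<in> sets borel" for n e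
  proof -
    have "open {t::real. norm (1 + cis (2 * pi * (\<sigma> * t)) ^ N n) < e}"
      by (intro open_Collect_less continuous_intros)
    moreover have "A n e = {0..1} \<inter> {t. norm (1 + cis (2 * pi * (\<sigma> * t)) ^ N n) < e}" by (auto simp: A_def)
    ultimately show ?thesis by auto
  qed
  have AM: "A n e \<in> sets ?M" for n e
  proof -
    have "A n e \<in> sets lebesgue" using Ab[of n e] by (simp add: sets_completionI_sets)
    moreover have "A n e \<subseteq> {0..1}" by (auto simp: A_def)
    ultimately show ?thesis by (simp add: sets_restrict_space_iff)
  qed
  have emA: "emeasure ?M (A n e) \<le> ennreal (16 * e)" if "0 < e" "e \<le> 1/4" for n e
  proof -
    have "emeasure ?M (A n e) = emeasure lebesgue (A n e)"
      by (intro emeasure_restrict_space) (auto simp: A_def)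
    also have "\<dots> = emeasure lborel (A n e)" using Ab by (simp add: emeasure_completion)
    also have "\<dots> \<le> ennreal (16 * e)" unfolding A_def by (rule emeasure_near_minus_one[OF N that sig])
    finally show ?thesis .
  qed
  have fin: "emeasure ?M B < \<infinity>" for B
  proof -
    have "emeasure ?M B \<le> emeasure ?M (space ?M)" by (rule emeasure_space)
    also have "\<dots> = emeasure lebesgue {0..1::real}" by (simp add: emeasure_restrict_space space_restrict_space)
    also have "\<dots> < \<infinity>" by (simp add: emeasure_completion)
    finally show ?thesis .
  qed
  \<comment> \<open>The shift by 2 keeps the threshold at most 1/4, where the measure bound applies;
    it is undone at the end of the proof.\<close>
  have "AE t in ?M. \<forall>\<^sub>F n in sequentially. t \<in> space ?M - A (n + 2) ((1/2) ^ (n + 2))"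
  proof (rule borel_cantelli_AE1)
    show "summable (\<lambda>n. measure ?M (A (n + 2) ((1/2) ^ (n + 2))))"
    proof (rule summable_comparison_test[OF _ summable_mult[OF summable_geometric, of "1/2 :: real" 16]])
      show "\<exists>l. \<forall>n\<ge>l. norm (measure ?M (A (n + 2) ((1/2) ^ (n + 2)))) \<le> 16 * (1/2) ^ n"
      proof (intro exI allI impI)
        fix n
        have p: "(1/2 :: real) ^ n \<le> 1" by (intro power_le_one) auto
        have "emeasure ?M (A (n + 2) ((1/2) ^ (n + 2))) \<le> ennreal (16 * (1/2) ^ (n + 2))"
          by (rule emA) (use p in simp_all)
        then have "measure ?M (A (n + 2) ((1/2) ^ (n + 2))) \<le> 16 * (1/2) ^ (n + 2)"
          unfolding measure_def by (rule enn2real_leI[rotated]) simp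
        also have "16 * (1/2 :: real) ^ (n + 2) \<le> 16 * (1/2) ^ n"
          by (intro mult_left_mono power_decreasing) auto
        finally show "norm (measure ?M (A (n + 2) ((1/2) ^ (n + 2)))) \<le> 16 * (1/2) ^ n"
          using measure_nonneg[of ?M "A (n + 2) ((1/2) ^ (n + 2))"] by (simp only: real_norm_def abs_of_nonneg)
      qed
    qed simp
  qed (use AM fin in auto)
  moreover have "AE t in ?M. \<forall>n. 1 + cis (2 * pi * (\<sigma> * t)) ^ N n \<noteq> 0"
    unfolding AE_all_countable
  proof
    fix n
    \<comment> \<open>The poles of one stage lie in all the sets with thresholds 2^-(j + 2), whose
      measures tend to 0.\<close>
    let ?Z = "\<Inter>j. A n ((1/2) ^ (j + 2))"
    have "emeasure ?M ?Z \<le> ennreal (16 * (1/2) ^ (j + 2))" for j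
    proof -
      have p: "(1/2 :: real) ^ j \<le> 1" by (intro power_le_one) auto
      have "emeasure ?M ?Z \<le> emeasure ?M (A n ((1/2) ^ (j + 2)))" by (intro emeasure_mono AM) auto
      also have "\<dots> \<le> ennreal (16 * (1/2) ^ (j + 2))" by (rule emA) (use p in simp_all)
      finally show ?thesis .
    qed
    moreover have "(\<lambda>j. ennreal (16 * (1/2) ^ (j + 2))) \<longlonglongrightarrow> ennreal 0"
      by (intro tendsto_ennrealI tendsto_mult_right_zero LIMSEQ_ignore_initial_segment LIMSEQ_realpow_zero) auto
    ultimately have "emeasure ?M ?Z \<le> ennreal 0" by (intro LIMSEQ_le_const) auto
    then have "?Z \<in> null_sets ?M" using AM by (auto simp: null_sets_def)
    moreover have "{t \<in> space ?M. \<not> 1 + cis (2 * pi * (\<sigma> * t)) ^ N n \<noteq> 0} \<subseteq> ?Z"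
      by (auto simp: A_def space_restrict_space)
    ultimately show "AE t in ?M. 1 + cis (2 * pi * (\<sigma> * t)) ^ N n \<noteq> 0" by (rule AE_I'[rotated, rotated]) 
  qed
  ultimately show ?thesis
  proof eventually_elim
    case (elim t)
    have "\<forall>\<^sub>F n in sequentially. (1/2) ^ (n + 2) \<le> norm (1 + cis (2 * pi * (\<sigma> * t)) ^ N (n + 2))"
      using elim(1) by eventually_elim (auto simp: A_def space_restrict_space)
    then have "\<forall>\<^sub>F n in sequentially. (1/2) ^ n \<le> norm (1 + cis (2 * pi * (\<sigma> * t)) ^ N n)"
      by (subst (asm) eventually_sequentially_seg)
    then show ?case using elim(2) by (simp add: resonance_free_def)
  qed
qed

section \<open>Transfer from Lebesgue measure to arc length\<close>

lemma sets_resonance_free: "{w. resonance_free N w} \<in> sets borel"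
proof -
  have "{w. resonance_free N w} = (\<Inter>n. {w. 1 + w ^ N n \<noteq> 0}) \<inter> (\<Union>j. \<Inter>n\<in>{j..}. {w. (1/2) ^ n \<le> norm (1 + w ^ N n)})"
    by (auto simp: resonance_free_def eventually_sequentially)
  moreover have "{w::complex. 1 + w ^ N n \<noteq> 0} \<in> sets borel" for n
    by (intro borel_open open_Collect_neq continuous_intros)
  moreover have "{w::complex. (1/2) ^ n \<le> norm (1 + w ^ N n)} \<in> sets borel" for n
    by (intro borel_closed closed_Collect_le continuous_intros)
  ultimately show ?thesis by auto
qed

text \<open>Unfolding the image measure and then the density reduces the claim to Lebesgue measure
  on the parameter interval, since a density creates no new sets of positive measure. What remains
  is measurability of the curve, the density and the set of good points.\<close>

lemma AE_arc_length_resonance_free: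
  assumes N: "\<And>n. 0 < N n" and sig: "\<sigma> = 1 \<or> \<sigma> = (- 1 :: real)"
    and psi: "\<psi> holomorphic_on U" "open U" "sphere 0 1 \<subseteq> U" "inj_on \<psi> U"
    and gam: "\<And>t. t \<in> {0..1} \<Longrightarrow> \<gamma> t = \<psi> (cis (2 * pi * (\<sigma> * t)))"
  shows "AE p in arc_length_measure \<gamma>. \<exists>w. norm w = 1 \<and> p = \<psi> w \<and> resonance_free N w"
proof -
  let ?L = "lebesgue_on {0..1::real}"
  let ?d = "\<lambda>t. ennreal (norm (vector_derivative \<gamma> (at t within {0..1})))"
  define c where "c t = cis (2 * pi * (\<sigma> * t))" for t
  have cS: "c t \<in> sphere 0 1" for t by (simp add: c_def)
  have cU: "c t \<in> U" for t using cS psi(3) by blast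
  have cont_c: "continuous_on S c" for S unfolding c_def by (intro continuous_intros)
  have contpsi: "continuous_on U \<psi>" by (rule holomorphic_on_imp_continuous_on[OF psi(1)])
  have "continuous_on {0..1} (\<lambda>t. \<psi> (c t))"
    by (rule continuous_on_compose2[OF contpsi cont_c]) (use cU in auto)
  then have "continuous_on {0..1} \<gamma>"
    by (subst continuous_on_cong[OF refl gam]) (auto simp: c_def)
  then have meas_gam: "\<gamma> \<in> borel_measurable ?L"
    by (rule continuous_imp_measurable_on_sets_lebesgue) simp
  \<comment> \<open>The speed in closed form; being continuous, it shows that the density is
    measurable.\<close>
  define d where "d t = norm (deriv \<psi> (c t)) * (2 * pi)" for t
  have vd: "norm (vector_derivative \<gamma> (at t within {0..1})) = d t" if t: "t \<in> {0..1}" for t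
  proof -
    have "((\<lambda>z. exp (\<i> * (2 * pi * \<sigma> * z))) has_field_derivative
        exp (\<i> * (2 * pi * \<sigma> * of_real t)) * (\<i> * (2 * pi * \<sigma>))) (at (of_real t))"
      by (auto intro!: derivative_eq_intros)
    from has_vector_derivative_real_field[OF this]
    have cd: "(c has_vector_derivative (2 * pi * \<sigma>) *\<^sub>R (\<i> * c t)) (at t within {0..1})"
      unfolding c_def[abs_def] cis_conv_exp by (simp add: scaleR_conv_of_real mult_ac)
    have "\<psi> field_differentiable at (c t)"
      using psi(1,2) cU by (rule holomorphic_on_imp_differentiable_at)
    then have "(\<psi> has_field_derivative deriv \<psi> (c t)) (at (c t))"
      by (rule field_differentiable_derivI)
    from field_vector_diff_chain_within[OF cd has_field_derivative_at_within[OF this]]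
    have "(\<psi> \<circ> c has_vector_derivative (2 * pi * \<sigma>) *\<^sub>R (\<i> * c t) * deriv \<psi> (c t)) (at t within {0..1})" .
    then have "(\<gamma> has_vector_derivative (2 * pi * \<sigma>) *\<^sub>R (\<i> * c t) * deriv \<psi> (c t)) (at t within {0..1})"
      by (rule has_vector_derivative_transform[OF t, rotated]) (simp add: gam c_def)
    then have "vector_derivative \<gamma> (at t within {0..1}) = (2 * pi * \<sigma>) *\<^sub>R (\<i> * c t) * deriv \<psi> (c t)"
      by (intro vector_derivative_within_closed_interval) (use t in auto)
    then show ?thesis using sig by (auto simp: d_def norm_mult c_def)
  qed
  have "continuous_on {0..1} (\<lambda>t. deriv \<psi> (c t))"
    by (rule continuous_on_compose2[OF holomorphic_on_imp_continuous_on[OF holomorphic_deriv[OF psi(1,2)]] cont_c])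
      (use cU in auto)
  then have "continuous_on {0..1} (\<lambda>t. ennreal (d t))"
    unfolding d_def by (intro continuous_on_ennreal continuous_intros)
  then have "(\<lambda>t. ennreal (d t)) \<in> borel_measurable ?L"
    by (rule continuous_imp_measurable_on_sets_lebesgue) simp
  then have meas_d: "?d \<in> borel_measurable ?L"
    by (rule measurable_cong[THEN iffD1, rotated]) (simp add: vd space_restrict_space)
  obtain g where g: "g holomorphic_on \<psi> ` U" "\<And>w. w \<in> U \<Longrightarrow> g (\<psi> w) = w"
    using holomorphic_has_inverse[OF psi(1,2,4)] by metis
  let ?K = "\<psi> ` sphere 0 1"
  let ?Z = "{p. \<exists>w. norm w = 1 \<and> p = \<psi> w \<and> resonance_free N w}"
  \<comment> \<open>The good set is a preimage under the inverse \<open>g\<close>, which is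
    continuous on the compact curve, of a Borel set; hence it is Borel.\<close>
  have Zeq: "?Z = g -` {w. resonance_free N w} \<inter> ?K"
    using g(2) psi(3) by (auto simp: image_iff) force+
  have "compact ?K" by (intro compact_continuous_image continuous_on_subset[OF contpsi psi(3)]) auto
  then have K: "?K \<in> sets borel" by (simp add: borel_compact)
  have "continuous_on ?K g"
    by (rule continuous_on_subset[OF holomorphic_on_imp_continuous_on[OF g(1)]]) (use psi(3) in blast)
  then have "g \<in> borel_measurable (restrict_space borel ?K)"
    by (rule borel_measurable_continuous_on_restrict)
  then have "g -` {w. resonance_free N w} \<inter> space (restrict_space borel ?K) \<in> sets (restrict_space borel ?K)"
    by (rule measurable_sets[OF _ sets_resonance_free])
  then have Z: "?Z \<in> sets borel"
    unfolding Zeq using K by (simp add: sets_restrict_space_iff space_restrict_space)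
  have "AE t in ?L. 0 < ?d t \<longrightarrow> (\<exists>w. norm w = 1 \<and> \<gamma> t = \<psi> w \<and> resonance_free N w)"
  proof -
    have "AE t in ?L. t \<in> space ?L" by (rule AE_space)
    then show ?thesis using AE_resonance_free[of N \<sigma>, OF N sig]
    proof eventually_elim
      case (elim t)
      then have "norm (c t) = 1" "\<gamma> t = \<psi> (c t)" "resonance_free N (c t)"
        using gam[of t] by (auto simp: c_def space_restrict_space)
      then show ?case by blast
    qed
  qed
  then have "AE t in density ?L ?d. \<exists>w. norm w = 1 \<and> \<gamma> t = \<psi> w \<and> resonance_free N w"
    unfolding AE_density[OF meas_d] .
  then show ?thesis
    unfolding arc_length_measure_def using meas_gam Z by (subst AE_distr_iff) auto
qed

section \<open>Conformal collars of the boundary curves\<close>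

text \<open>Stated with a filter at 1 from the left, so that the finitely many conditions on the
  collar width can later be imposed together.\<close>

lemma eventually_thin_annulus:
  assumes "open U" "sphere 0 1 \<subseteq> U"
  shows "\<forall>\<^sub>F r in at_left 1. (annulus r (1 / r) :: complex set) \<subseteq> U"
proof -
  obtain r where r: "0 < r" "r < 1" "(annulus r (1 / r) :: complex set) \<subseteq> U" using thin_annulus[OF assms] by blast
  have "annulus q (1 / q) \<subseteq> (annulus r (1 / r) :: complex set)" if "r < q" for q
    using that r(1) frac_less2[of 1 1 r q] by auto
  then show ?thesis unfolding eventually_at_left_field using r by blast
qed

text \<open>Otherwise pairs of distinct points with equal values accumulate, by compactness, at two
  points of the circle with equal values. Injectivity on the circle identifies these, and the
  nonzero derivative makes \<open>f\<close> injective near that point, a contradiction.\<close>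

lemma eventually_inj_on_annulus:
  assumes f: "f holomorphic_on U" "open U" "sphere 0 1 \<subseteq> U"
    and inj: "inj_on f (sphere 0 1)" and der: "\<And>w. w \<in> sphere 0 1 \<Longrightarrow> deriv f w \<noteq> 0"
  shows "\<forall>\<^sub>F r in at_left 1. inj_on f (annulus r (1 / r))"
proof -
  obtain r0 where r0: "0 < r0" "r0 < 1" "(annulus r0 (1 / r0) :: complex set) \<subseteq> U" using thin_annulus[OF f(2,3)] by blast
  define r1 where "r1 = (r0 + 1) / 2"
  have r1: "0 < r1" "r0 < r1" "r1 < 1" using r0 by (auto simp: r1_def)
  let ?K = "{w::complex. r1 \<le> norm w \<and> norm w \<le> 1 / r1}"
  have "1 / r1 < 1 / r0" using r0 r1 by (simp add: frac_less2)
  then have KU: "?K \<subseteq> U" using r0(3) r1 by auto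
  have contf: "continuous_on U f" by (rule holomorphic_on_imp_continuous_on[OF f(1)])
  define q where "q n = 1 - (1 - r1) / real (Suc n)" for n
  have q: "r1 \<le> q n" "q n < 1" for n
  proof -
    have "(1 - r1) / real (Suc n) \<le> (1 - r1) / 1" using r1 by (intro divide_left_mono) auto
    then show "r1 \<le> q n" by (simp add: q_def)
    show "q n < 1" using r1 by (simp add: q_def)
  qed
  have "(\<lambda>n. 1 - (1 - r1) * inverse (real (Suc n))) \<longlonglongrightarrow> 1 - (1 - r1) * 0"
    by (intro tendsto_intros LIMSEQ_inverse_real_of_nat)
  then have qlim: "q \<longlonglongrightarrow> 1" unfolding q_def[abs_def] by (simp add: divide_inverse)
  have "\<exists>n. inj_on f (annulus (q n) (1 / q n))"
  proof (rule ccontr)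
    assume "\<nexists>n. inj_on f (annulus (q n) (1 / q n))"
    then have "\<forall>n. \<exists>x y. x \<in> annulus (q n) (1 / q n) \<and> y \<in> annulus (q n) (1 / q n) \<and> f x = f y \<and> x \<noteq> y"
      unfolding inj_on_def by blast
    then obtain x y where xy: "\<And>n. x n \<in> annulus (q n) (1 / q n)" "\<And>n. y n \<in> annulus (q n) (1 / q n)"
      "\<And>n. f (x n) = f (y n)" "\<And>n. x n \<noteq> y n" by metis
    have inK: "w \<in> ?K" if "w \<in> annulus (q n) (1 / q n)" for w n
    proof -
      have "1 / q n \<le> 1 / r1" using q[of n] r1 by (simp add: frac_le)
      then show ?thesis using that q(1)[of n] by auto
    qed
    have "compact (?K \<times> ?K)" by (intro compact_Times compact_norm_between)
    then obtain l h where l: "l \<in> ?K \<times> ?K" "strict_mono (h :: nat \<Rightarrow> nat)" "((\<lambda>n. (x n, y n)) \<circ> h) \<longlonglongrightarrow> l"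
      unfolding compact_def using inK xy(1,2) by (metis (no_types, lifting) mem_Sigma_iff)
    obtain a b where ab: "l = (a, b)" by (cases l)
    have xa: "(\<lambda>n. x (h n)) \<longlonglongrightarrow> a" and yb: "(\<lambda>n. y (h n)) \<longlonglongrightarrow> b"
      using tendsto_fst[OF l(3)] tendsto_snd[OF l(3)] by (auto simp: ab o_def)
    have qh: "(\<lambda>n. q (h n)) \<longlonglongrightarrow> 1" using LIMSEQ_subseq_LIMSEQ[OF qlim l(2)] by (simp add: o_def)
    then have qh': "(\<lambda>n. 1 / q (h n)) \<longlonglongrightarrow> 1" using tendsto_divide[OF tendsto_const qh, of 1] by simp
    have unit: "norm c = 1" if z: "(\<lambda>n. z (h n)) \<longlonglongrightarrow> c" "\<And>n. z n \<in> annulus (q n) (1 / q n)" for z c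
    proof -
      have "(\<lambda>n. norm (z (h n))) \<longlonglongrightarrow> 1"
        by (rule tendsto_sandwich[OF _ _ qh qh']) (use z(2) in \<open>auto intro!: always_eventually less_imp_le\<close>)
      then show ?thesis using LIMSEQ_unique tendsto_norm[OF z(1)] by blast
    qed
    have na: "norm a = 1" and nb: "norm b = 1" using unit[OF xa xy(1)] unit[OF yb xy(2)] by auto
    have xyU: "x n \<in> U" "y n \<in> U" for n using inK[OF xy(1)] inK[OF xy(2)] KU by blast+
    have aU: "a \<in> U" "b \<in> U" using na nb f(3) by auto
    have fa: "(\<lambda>n. f (x (h n))) \<longlonglongrightarrow> f a"
      by (rule continuous_on_tendsto_compose[OF contf xa aU(1)]) (simp add: xyU)
    have fb: "(\<lambda>n. f (y (h n))) \<longlonglongrightarrow> f b"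
      by (rule continuous_on_tendsto_compose[OF contf yb aU(2)]) (simp add: xyU)
    have "f a = f b" using fa fb LIMSEQ_unique unfolding xy(3) by blast
    then have "a = b" using inj_onD[OF inj] na nb by simp
    obtain e where e: "e > 0" "ball a e \<subseteq> U" "inj_on f (ball a e)"
      using has_complex_derivative_locally_injective[OF f(1) aU(1) f(2) der] na by auto
    have "\<forall>\<^sub>F n in sequentially. x (h n) \<in> ball a e \<and> y (h n) \<in> ball a e"
      using tendstoD[OF xa e(1)] tendstoD[OF yb e(1)]
      by eventually_elim (auto simp: dist_commute \<open>a = b\<close>)
    then obtain n where "x (h n) \<in> ball a e" "y (h n) \<in> ball a e" unfolding eventually_sequentially by blast
    then show False using inj_onD[OF e(3) xy(3)[of "h n"]] xy(4)[of "h n"] by blast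
  qed
  then obtain n where n: "inj_on f (annulus (q n) (1 / q n))" by blast
  have "annulus p (1 / p) \<subseteq> (annulus (q n) (1 / q n) :: complex set)" if "q n < p" for p
    using that q(1)[of n] r1(1) frac_less2[of 1 1 "q n" p] by auto
  then have "inj_on f (annulus p (1 / p))" if "q n < p" for p
    using inj_on_subset[OF n] that by simp
  then show ?thesis
    unfolding eventually_at_left_field by (intro exI[of _ "q n"] conjI allI impI q(2))
qed

text \<open>A simple closed path identifies only its endpoints. Choosing parameters in the half-open
  interval therefore gives injectivity on the circle.\<close>

lemma analytic_curve_parametrization:
  assumes "simple_analytic_closed_curve \<gamma>"
  shows "\<exists>U \<phi>. open U \<and> sphere 0 1 \<subseteq> U \<and> \<phi> holomorphic_on U \<and> (\<forall>w\<in>sphere 0 1. deriv \<phi> w \<noteq> 0) \<and>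
    inj_on \<phi> (sphere 0 1) \<and> path_image \<gamma> = \<phi> ` sphere 0 1 \<and> (\<forall>t\<in>{0..1}. \<gamma> t = \<phi> (cis (2 * pi * t)))"
proof -
  from assms obtain U \<phi> where sp: "simple_path \<gamma>" and U: "open U" "sphere 0 1 \<subseteq> U" "\<phi> holomorphic_on U"
      "\<forall>w\<in>sphere 0 1. deriv \<phi> w \<noteq> 0" "\<forall>t\<in>{0..1}. \<gamma> t = \<phi> (cis (2 * pi * t))"
    unfolding simple_analytic_closed_curve_def by blast
  have ex: "\<exists>t. 0 \<le> t \<and> t < 1 \<and> w = cis (2 * pi * t)" if w: "w \<in> sphere 0 1" for w
  proof -
    obtain t where "0 \<le> t" "t < 2 * pi" "w = cis t"
    proof -
      have "w = cis (Arg2pi w)" using w Arg2pi_eq[of w] by (simp add: cis_conv_exp)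
      then show ?thesis using that[of "Arg2pi w"] Arg2pi_ge_0[of w] Arg2pi_lt_2pi[of w] by simp
    qed
    then show ?thesis by (intro exI[of _ "t / (2 * pi)"]) (auto simp: field_simps)
  qed
  have inj: "inj_on \<phi> (sphere 0 1)"
  proof (rule inj_onI)
    fix v w assume vw: "v \<in> sphere 0 1" "w \<in> sphere 0 1" "\<phi> v = \<phi> w"
    obtain t u where t: "0 \<le> t" "t < 1" "v = cis (2 * pi * t)" and u: "0 \<le> u" "u < 1" "w = cis (2 * pi * u)"
      using ex[OF vw(1)] ex[OF vw(2)] by blast
    have "\<gamma> t = \<gamma> u" using U(5) t u vw(3) by simp
    then have "t = u" using sp t u unfolding simple_path_def loop_free_def by fastforce
    then show "v = w" using t u by simp
  qed
  have "path_image \<gamma> = \<phi> ` sphere 0 1"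
  proof
    show "path_image \<gamma> \<subseteq> \<phi> ` sphere 0 1" unfolding path_image_def using U(5) by auto
    show "\<phi> ` sphere 0 1 \<subseteq> path_image \<gamma>"
    proof (clarify)
      fix w :: complex assume "w \<in> sphere 0 1"
      then obtain t where "0 \<le> t" "t < 1" "w = cis (2 * pi * t)" using ex by blast
      then show "\<phi> w \<in> path_image \<gamma>" unfolding path_image_def using U(5) by (intro image_eqI[of _ _ t]) auto
    qed
  qed
  then show ?thesis using U inj by blast
qed

section \<open>The side of each curve on which the domain lies\<close>

lemma connected_subset_or_disjoint:
  assumes "connected S" "S \<inter> frontier T = {}"
  shows "S \<subseteq> T \<or> S \<inter> T = {}"
  using connected_Int_frontier[OF assms(1), of T] assms(2) by blast

lemma inversion_annulus:
  assumes "0 < r" "w \<in> annulus r (1 / r)"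
  shows "1 / w \<in> annulus r (1 / r)"
  using assms inverse_between[of r "norm w"] by (simp add: norm_divide)

text \<open>If \<open>\<Omega>\<close> lay on both sides of the curve, it would join the inside to the outside in the
  Jordan curve theorem.\<close>

lemma collar_sides:
  assumes \<Omega>: "open \<Omega>" "connected \<Omega>"
    and g: "simple_path \<gamma>" "pathfinish \<gamma> = pathstart \<gamma>" "path_image \<gamma> = \<phi> ` sphere 0 1"
    and front: "path_image \<gamma> \<subseteq> frontier \<Omega>" "\<phi> ` annulus r (1 / r) \<inter> frontier \<Omega> \<subseteq> path_image \<gamma>"
    and r: "0 < r" "r < 1" and hol: "\<phi> holomorphic_on annulus r (1 / r)" and inj: "inj_on \<phi> (annulus r (1 / r))"
  shows "(\<phi> ` annulus r 1 \<subseteq> \<Omega> \<and> \<phi> ` annulus 1 (1 / r) \<inter> \<Omega> = {}) \<or>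
    (\<phi> ` annulus 1 (1 / r) \<subseteq> \<Omega> \<and> \<phi> ` annulus r 1 \<inter> \<Omega> = {})"
proof -
  let ?A = "annulus r (1 / r)" and ?I = "annulus r 1" and ?O = "annulus 1 (1 / r)"
  have r1: "1 < 1 / r" using r by simp
  have lt: "x < 1 / r" if "x < 1" for x :: real using that r1 by (rule less_trans)
  have sub: "?I \<subseteq> ?A" "?O \<subseteq> ?A" "sphere 0 1 \<subseteq> ?A" using r by (auto simp: lt)
  have Asplit: "?A = ?I \<union> ?O \<union> sphere 0 1" using r by (auto simp: lt)
  have disj: "\<phi> ` B \<inter> frontier \<Omega> = {}" if "B \<subseteq> ?A" "B \<inter> sphere 0 1 = {}" for B
  proof -
    have "\<phi> ` B \<inter> \<phi> ` sphere 0 1 = {}" using inj_on_image_Int[OF inj, of B "sphere 0 1"] that sub by auto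
    then show ?thesis using front(2) g(3) that(1) by blast
  qed
  have conn: "connected (\<phi> ` B)" if "B \<subseteq> ?A" "connected B" for B
    by (rule connected_continuous_image[OF continuous_on_subset[OF holomorphic_on_imp_continuous_on[OF hol] that(1)] that(2)])
  \<comment> \<open>Each half of the collar is connected and misses the boundary of the domain, so
    it lies entirely inside or entirely outside the domain.\<close>
  have I: "\<phi> ` ?I \<subseteq> \<Omega> \<or> \<phi> ` ?I \<inter> \<Omega> = {}"
    using sub by (intro connected_subset_or_disjoint conn disj connected_annulus_complex) auto
  have O: "\<phi> ` ?O \<subseteq> \<Omega> \<or> \<phi> ` ?O \<inter> \<Omega> = {}"
    using sub by (intro connected_subset_or_disjoint conn disj connected_annulus_complex) auto
  have op: "open (\<phi> ` ?A)" by (rule open_mapping_thm3[OF hol open_annulus inj])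
  have "(1::complex) \<in> sphere 0 1" by simp
  then have pA: "\<phi> 1 \<in> \<phi> ` ?A" and pS: "\<phi> 1 \<in> path_image \<gamma>" using sub(3) g(3) by blast+
  have meets: "\<phi> ` ?A \<inter> T \<noteq> {}" if "path_image \<gamma> \<subseteq> frontier T" for T
  proof -
    have "\<phi> 1 \<in> closure T" using that pS by (auto simp: frontier_def)
    then show ?thesis using open_Int_closure_eq_empty[OF op, of T] pA by blast
  qed
  have SO: "path_image \<gamma> \<inter> \<Omega> = {}"
    using front(1) \<Omega>(1) frontier_disjoint_eq by blast
  have "\<phi> ` ?A \<inter> \<Omega> \<noteq> {}" by (rule meets[OF front(1)])
  then have one: "\<phi> ` ?I \<inter> \<Omega> \<noteq> {} \<or> \<phi> ` ?O \<inter> \<Omega> \<noteq> {}" unfolding Asplit using SO g(3) by blast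
  have "\<not> (\<phi> ` ?I \<subseteq> \<Omega> \<and> \<phi> ` ?O \<subseteq> \<Omega>)"
  proof
    assume both: "\<phi> ` ?I \<subseteq> \<Omega> \<and> \<phi> ` ?O \<subseteq> \<Omega>"
    let ?i = "inside (path_image \<gamma>)" and ?o = "outside (path_image \<gamma>)"
    have J: "open ?i" "open ?o" "?i \<inter> ?o = {}" "?i \<union> ?o = - path_image \<gamma>"
      "frontier ?i = path_image \<gamma>" "frontier ?o = path_image \<gamma>"
      using Jordan_inside_outside[OF g(1,2)] by auto
    have cover: "\<phi> ` ?A \<subseteq> \<Omega> \<union> path_image \<gamma>" unfolding Asplit using both g(3) by blast
    have "\<phi> ` ?A \<inter> ?i \<noteq> {}" "\<phi> ` ?A \<inter> ?o \<noteq> {}" using meets J(5,6) by auto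
    moreover have "?i \<inter> path_image \<gamma> = {}" "?o \<inter> path_image \<gamma> = {}" using J(4) by auto
    ultimately have "\<Omega> \<inter> ?i \<noteq> {}" "\<Omega> \<inter> ?o \<noteq> {}" using cover by blast+
    moreover have "\<Omega> \<subseteq> ?i \<union> ?o" using SO J(4) by blast
    ultimately show False using \<Omega>(2) J(1,2,3) unfolding connected_def by blast
  qed
  then show ?thesis using I O one by blast
qed

text \<open>All requirements on the collar width hold for r close to 1 and are combined there. If
  the domain lies on the side |w| > 1 of a curve, precomposing with w -> 1/w exchanges the sides; on
  the circle this is conjugation, so the curve is traversed backwards, recorded by \<sigma> =
  -1.\<close>

lemma collared_domain_exists:
  assumes dom: "analytic_multi_connected_domain \<Omega> m \<gamma>"
  shows "\<exists>\<psi> R \<sigma>. collared_domain \<Omega> m \<psi> R \<and>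
    (\<forall>k\<le>m. (\<sigma> k = 1 \<or> \<sigma> k = (- 1 :: real)) \<and> (\<forall>t\<in>{0..1}. \<gamma> k t = \<psi> k (cis (2 * pi * (\<sigma> k * t)))))"
proof -
  from dom have \<Omega>: "open \<Omega>" "connected \<Omega>" "bounded \<Omega>"
    and curves: "\<And>k. k \<le> m \<Longrightarrow> simple_analytic_closed_curve (\<gamma> k)"
    and dj: "disjoint_family_on (\<lambda>k. path_image (\<gamma> k)) {..m}"
    and fr: "frontier \<Omega> = (\<Union>k\<le>m. path_image (\<gamma> k))"
    unfolding analytic_multi_connected_domain_def by auto
  have "\<exists>U \<phi>. open U \<and> sphere 0 1 \<subseteq> U \<and> \<phi> holomorphic_on U \<and> (\<forall>w\<in>sphere 0 1. deriv \<phi> w \<noteq> 0) \<and>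
    inj_on \<phi> (sphere 0 1) \<and> path_image (\<gamma> k) = \<phi> ` sphere 0 1 \<and> (\<forall>t\<in>{0..1}. \<gamma> k t = \<phi> (cis (2 * pi * t)))"
    if "k \<le> m" for k
    by (rule analytic_curve_parametrization[OF curves[OF that]])
  then obtain U \<phi> where U: "\<And>k. k \<le> m \<Longrightarrow> open (U k) \<and> sphere 0 1 \<subseteq> U k \<and> \<phi> k holomorphic_on U k \<and>
    (\<forall>w\<in>sphere 0 1. deriv (\<phi> k) w \<noteq> 0) \<and> inj_on (\<phi> k) (sphere 0 1) \<and> path_image (\<gamma> k) = \<phi> k ` sphere 0 1 \<and>
    (\<forall>t\<in>{0..1}. \<gamma> k t = \<phi> k (cis (2 * pi * t)))" by metis
  let ?A = "\<lambda>r. annulus r (1 / r) :: complex set"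
  have "\<forall>\<^sub>F r in at_left 1. \<forall>k\<in>{..m}. ?A r \<subseteq> U k"
    by (intro eventually_ball_finite ballI eventually_thin_annulus) (use U in blast)+
  moreover have "\<forall>\<^sub>F r in at_left 1. \<forall>k\<in>{..m}. inj_on (\<phi> k) (?A r)"
  proof (intro eventually_ball_finite ballI finite_atMost)
    fix k assume "k \<in> {..m}"
    then have "\<phi> k holomorphic_on U k" "open (U k)" "sphere 0 1 \<subseteq> U k" "inj_on (\<phi> k) (sphere 0 1)"
      "\<And>w. w \<in> sphere 0 1 \<Longrightarrow> deriv (\<phi> k) w \<noteq> 0"
      using U by blast+
    then show "\<forall>\<^sub>F r in at_left 1. inj_on (\<phi> k) (?A r)" by (rule eventually_inj_on_annulus)
  qed
  moreover have "\<forall>\<^sub>F r in at_left 1. \<forall>k\<in>{..m}. \<forall>l\<in>{..m}. k \<noteq> l \<longrightarrow> \<phi> k ` ?A r \<inter> \<phi> l ` ?A r = {}"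
  proof (intro eventually_ball_finite ballI finite_atMost)
    fix k l assume kl: "k \<in> {..m}" "l \<in> {..m}"
    show "\<forall>\<^sub>F r in at_left 1. k \<noteq> l \<longrightarrow> \<phi> k ` ?A r \<inter> \<phi> l ` ?A r = {}"
    proof (cases "k = l")
      case False
      \<comment> \<open>Disjoint closed curves have disjoint open neighbourhoods, and thin collars
        fit into these.\<close>
      have "closed (path_image (\<gamma> j))" if "j \<le> m" for j
        using curves[OF that] by (auto simp: simple_analytic_closed_curve_def closed_simple_path_image)
      moreover have "path_image (\<gamma> k) \<inter> path_image (\<gamma> l) = {}"
        using dj kl False by (auto simp: disjoint_family_on_def)
      ultimately obtain V W where VW: "open V" "open W" "path_image (\<gamma> k) \<subseteq> V" "path_image (\<gamma> l) \<subseteq> W" "V \<inter> W = {}"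
        using separation_normal kl by (metis atMost_iff)
      have ev: "\<forall>\<^sub>F r in at_left 1. ?A r \<subseteq> U j \<inter> \<phi> j -` T" if "j \<le> m" "open T" "path_image (\<gamma> j) \<subseteq> T" for j T
        using U[OF that(1)] that
        by (intro eventually_thin_annulus continuous_open_preimage holomorphic_on_imp_continuous_on) auto
      have "\<forall>\<^sub>F r in at_left 1. ?A r \<subseteq> U k \<inter> \<phi> k -` V" "\<forall>\<^sub>F r in at_left 1. ?A r \<subseteq> U l \<inter> \<phi> l -` W"
        using ev[OF _ VW(1,3)] ev[OF _ VW(2,4)] kl by simp_all
      then show ?thesis
      proof eventually_elim
        case (elim r)
        then have "\<phi> k ` ?A r \<subseteq> V" "\<phi> l ` ?A r \<subseteq> W" by blast+
        then show ?case using VW(5) by blast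
      qed
    qed simp
  qed
  moreover have "\<forall>\<^sub>F r in at_left (1::real). 0 < r \<and> r < 1"
    unfolding eventually_at_left_field by (intro exI[of _ 0]) auto
  ultimately have "\<forall>\<^sub>F r in at_left 1. (\<forall>k\<in>{..m}. ?A r \<subseteq> U k) \<and> (\<forall>k\<in>{..m}. inj_on (\<phi> k) (?A r)) \<and>
    (\<forall>k\<in>{..m}. \<forall>l\<in>{..m}. k \<noteq> l \<longrightarrow> \<phi> k ` ?A r \<inter> \<phi> l ` ?A r = {}) \<and> 0 < r \<and> r < 1"
    by eventually_elim blast
  from eventually_happens'[OF trivial_limit_at_left_real this]
  obtain r where R: "\<forall>k\<in>{..m}. ?A r \<subseteq> U k" "\<forall>k\<in>{..m}. inj_on (\<phi> k) (?A r)"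
    "\<forall>k\<in>{..m}. \<forall>l\<in>{..m}. k \<noteq> l \<longrightarrow> \<phi> k ` ?A r \<inter> \<phi> l ` ?A r = {}" and r: "0 < r" "r < 1"
    by (elim exE conjE)
  have AU: "\<And>k. k \<le> m \<Longrightarrow> ?A r \<subseteq> U k" and inj: "\<And>k. k \<le> m \<Longrightarrow> inj_on (\<phi> k) (?A r)"
    and disj: "\<And>k l. k \<le> m \<Longrightarrow> l \<le> m \<Longrightarrow> k \<noteq> l \<Longrightarrow> \<phi> k ` ?A r \<inter> \<phi> l ` ?A r = {}"
    using R by simp_all
  have r1: "1 < 1 / r" using r by simp
  have hol: "\<phi> k holomorphic_on ?A r" if "k \<le> m" for k
    using U[OF that] AU[OF that] holomorphic_on_subset by blast
  have pim: "path_image (\<gamma> k) = \<phi> k ` sphere 0 1" if "k \<le> m" for k using U[OF that] by blast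
  have sphA: "sphere 0 1 \<subseteq> ?A r" using r by auto
  have sides: "(\<phi> k ` annulus r 1 \<subseteq> \<Omega> \<and> \<phi> k ` annulus 1 (1 / r) \<inter> \<Omega> = {}) \<or>
    (\<phi> k ` annulus 1 (1 / r) \<subseteq> \<Omega> \<and> \<phi> k ` annulus r 1 \<inter> \<Omega> = {})" if k: "k \<le> m" for k
  proof (rule collar_sides[OF \<Omega>(1,2) _ _ pim[OF k] _ _ r hol[OF k] inj[OF k]])
    show "simple_path (\<gamma> k)" "pathfinish (\<gamma> k) = pathstart (\<gamma> k)"
      using curves[OF k] by (auto simp: simple_analytic_closed_curve_def)
    show "path_image (\<gamma> k) \<subseteq> frontier \<Omega>" using fr k by blast
    show "\<phi> k ` ?A r \<inter> frontier \<Omega> \<subseteq> path_image (\<gamma> k)"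
    proof
      fix p assume p: "p \<in> \<phi> k ` ?A r \<inter> frontier \<Omega>"
      then obtain l where l: "l \<le> m" "p \<in> path_image (\<gamma> l)" using fr by auto
      then have "p \<in> \<phi> l ` ?A r" using pim[OF l(1)] sphA by blast
      then have "k = l" using disj[OF k l(1)] p by blast
      then show "p \<in> path_image (\<gamma> k)" using l by simp
    qed
  qed
  define \<sigma> where "\<sigma> k = (if \<phi> k ` annulus r 1 \<subseteq> \<Omega> then 1 else - 1 :: real)" for k
  define \<psi> where "\<psi> k w = (if \<phi> k ` annulus r 1 \<subseteq> \<Omega> then \<phi> k w else \<phi> k (1 / w))" for k w
  have invA: "(\<lambda>w. 1 / w) ` ?A r \<subseteq> ?A r" using inversion_annulus[OF r(1)] by blast
  have inv_inj: "inj_on (\<lambda>w. 1 / w) (?A r)" by (auto simp: inj_on_def)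
  have \<psi>_img: "\<psi> k ` S \<subseteq> \<phi> k ` ?A r" if "S \<subseteq> ?A r" for k S
    using that invA unfolding \<psi>_def by auto
  have \<psi>_sph: "\<psi> k ` sphere 0 1 = \<phi> k ` sphere 0 1" for k
  proof -
    have "(\<lambda>w. 1 / w) ` sphere 0 1 = (sphere 0 1 :: complex set)"
    proof
      show "(\<lambda>w. 1 / w) ` sphere 0 1 \<subseteq> (sphere 0 1 :: complex set)" by (auto simp: norm_divide)
      show "(sphere 0 1 :: complex set) \<subseteq> (\<lambda>w. 1 / w) ` sphere 0 1"
      proof
        fix w :: complex assume "w \<in> sphere 0 1"
        then show "w \<in> (\<lambda>w. 1 / w) ` sphere 0 1"
          by (intro image_eqI[of _ _ "1 / w"]) (auto simp: norm_divide)
      qed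
    qed
    then show ?thesis unfolding \<psi>_def[abs_def] by (cases "\<phi> k ` annulus r 1 \<subseteq> \<Omega>") (simp_all add: image_image[symmetric])
  qed
  have nsph: "\<phi> k w \<notin> \<Omega>" if "k \<le> m" "norm w = 1" for k w
  proof -
    have "w \<in> sphere 0 1" using that by simp
    then have "\<phi> k w \<in> frontier \<Omega>" unfolding fr using pim[OF that(1)] that(1) by blast
    then show ?thesis using \<Omega>(1) frontier_disjoint_eq by blast
  qed
  have "collared_domain \<Omega> m \<psi> (1 / r)"
  proof
    show "1 < 1 / r" by (rule r1)
    show "open \<Omega>" "bounded \<Omega>" by (fact \<Omega>)+
    have rr: "1 / (1 / r) = r" by simp
    show "frontier \<Omega> = (\<Union>k\<le>m. \<psi> k ` sphere 0 1)" unfolding fr \<psi>_sph using pim by simp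
    fix k assume k: "k \<le> m"
    show "\<psi> k holomorphic_on annulus (1 / (1 / r)) (1 / r)"
    proof (cases "\<phi> k ` annulus r 1 \<subseteq> \<Omega>")
      case True
      then show ?thesis using hol[OF k] unfolding rr \<psi>_def[abs_def] by simp
    next
      case False
      have "\<phi> k \<circ> (\<lambda>w. 1 / w) holomorphic_on ?A r"
        using r by (intro holomorphic_on_compose_gen[OF _ hol[OF k] invA] holomorphic_intros) auto
      then show ?thesis using False unfolding rr \<psi>_def[abs_def] by (simp add: o_def)
    qed
    show "inj_on (\<psi> k) (annulus (1 / (1 / r)) (1 / r))"
    proof (cases "\<phi> k ` annulus r 1 \<subseteq> \<Omega>")
      case True
      then show ?thesis using inj[OF k] unfolding rr \<psi>_def[abs_def] by simp
    next
      case False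
      have "inj_on (\<phi> k \<circ> (\<lambda>w. 1 / w)) (?A r)"
        by (rule comp_inj_on[OF inv_inj inj_on_subset[OF inj[OF k] invA]])
      then show ?thesis using False unfolding rr \<psi>_def[abs_def] by (simp add: o_def)
    qed
    show "\<psi> k ` annulus (1 / (1 / r)) (1 / r) \<inter> \<psi> l ` annulus (1 / (1 / r)) (1 / r) = {}"
      if "l \<le> m" "k \<noteq> l" for l
      unfolding rr using \<psi>_img[OF order_refl, of k] \<psi>_img[OF order_refl, of l] disj[OF k that] by blast
    have flip: "1 / w \<in> annulus 1 (1 / r)" if "w \<in> annulus r 1" for w
    proof -
      have w: "r < norm w" "norm w < 1" using that by auto
      then have "0 < norm w" using r(1) by linarith
      then show ?thesis using w r frac_less2[of 1 1 r "norm w"] by (simp add: norm_divide)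
    qed
    have flip': "1 / w \<in> annulus r 1" if "w \<in> annulus 1 (1 / r)" for w
    proof -
      have w: "1 < norm w" "norm w < 1 / r" using that by auto
      then have "r < norm w" using r(2) by linarith
      then have "r < 1 / norm w" by (rule inverse_between(1)[OF r(1) _ w(2)])
      moreover have "1 / norm w < 1" using w(1) by (subst divide_less_eq_1) simp
      ultimately show ?thesis by (simp add: norm_divide)
    qed
    show "\<psi> k w \<in> \<Omega>" if "w \<in> annulus (1 / (1 / r)) 1" for w
    proof (cases "\<phi> k ` annulus r 1 \<subseteq> \<Omega>")
      case True
      then show ?thesis using that unfolding rr \<psi>_def if_P[OF True] by blast
    next
      case False
      then have "\<phi> k ` annulus 1 (1 / r) \<subseteq> \<Omega>" using sides[OF k] by blast
      moreover have "1 / w \<in> annulus 1 (1 / r)" using flip that unfolding rr by blast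
      ultimately show ?thesis unfolding \<psi>_def if_not_P[OF False] by blast
    qed
    show "\<psi> k w \<notin> \<Omega>" if w: "w \<in> annulus (1 / (1 / r)) (1 / r)" "1 \<le> norm w" for w
    proof (cases "norm w = 1")
      case True
      then show ?thesis using nsph[OF k, of w] nsph[OF k, of "1 / w"] by (simp add: \<psi>_def norm_divide)
    next
      case False
      then have wO: "w \<in> annulus 1 (1 / r)" using w by simp
      \<comment> \<open>A nonempty half collar cannot be both contained in the domain and disjoint
        from it, so exactly one alternative of \<open>sides\<close> applies.\<close>
      have ne: "\<phi> k ` annulus r 1 \<noteq> {}"
      proof -
        obtain x where "r < x" "x < 1" using dense[OF r(2)] by blast
        then have "of_real x \<in> annulus r 1" using r by simp
        then show ?thesis by blast
      qed
      show ?thesis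
      proof (cases "\<phi> k ` annulus r 1 \<subseteq> \<Omega>")
        case True
        then have "\<phi> k ` annulus 1 (1 / r) \<inter> \<Omega> = {}" using sides[OF k] ne by blast
        then show ?thesis using wO unfolding \<psi>_def if_P[OF True] by blast
      next
        case False
        then have "\<phi> k ` annulus r 1 \<inter> \<Omega> = {}" using sides[OF k] by blast
        then show ?thesis using flip'[OF wO] unfolding \<psi>_def if_not_P[OF False] by blast
      qed
    qed
  qed
  moreover have "\<gamma> k t = \<psi> k (cis (2 * pi * (\<sigma> k * t)))" if "k \<le> m" "t \<in> {0..1}" for k t
  proof -
    have "1 / cis (2 * pi * (- 1 * t)) = cis (2 * pi * t)"
      by (simp add: divide_inverse cis_inverse)
    then show ?thesis using U[OF that(1)] that(2) unfolding \<psi>_def \<sigma>_def by simp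
  qed
  moreover have "\<sigma> k = 1 \<or> \<sigma> k = - 1" for k by (simp add: \<sigma>_def)
  ultimately show ?thesis by blast
qed

section \<open>Approximation by inner functions\<close>

text \<open>\<open>F\<close> is (1 + B)(1 - B)^-1. For y = (1 - B) x one has F y = (1 + B) x, so the
  real part of the form is |x|^2 - |B x|^2 \<ge> (1 - q^2) |x|^2; the 4 comes from |y| \<le> 2 |x|.
  A strict bound q < 1 is what makes the accretivity constant positive.\<close>

lemma inverse_cayley:
  fixes B :: "complex^'n^'n"
  assumes q: "0 \<le> q" "q < 1" and B: "\<And>x. norm (B *v x) \<le> q * norm x"
  defines "F \<equiv> 2 *\<^sub>R matrix_inv (mat 1 - B) - mat 1"
  shows "invertible (mat 1 - B)" "cayley F = B" "accretive ((1 - q\<^sup>2) / 4) F"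
proof -
  have lower: "(1 - q) * norm x \<le> norm ((mat 1 - B) *v x)" for x
    using norm_triangle_ineq2[of x "B *v x"] B[of x]
    by (simp add: matrix_vector_mult_diff_rdistrib algebra_simps)
  show inv: "invertible (mat 1 - B)"
    using q by (intro invertible_if_norm_ge[of "1 - q"] lower) auto
  let ?V = "matrix_inv (mat 1 - B)"
  have "(F + mat 1) ** ((1/2) *\<^sub>R (mat 1 - B)) = mat 1"
  proof -
    have "(2 *\<^sub>R ?V) ** ((1/2) *\<^sub>R (mat 1 - B)) = ?V ** (mat 1 - B)"
      by (simp add: matrix_matrix_mult_def vec_eq_iff)
    then show ?thesis by (simp add: F_def matrix_inv(2)[OF inv])
  qed
  then have "matrix_inv (F + mat 1) = (1/2) *\<^sub>R (mat 1 - B)" by (rule matrix_inv_unique)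
  then show "cayley F = B" by (simp add: cayley_def)
  show "accretive ((1 - q\<^sup>2) / 4) F"
    unfolding accretive_def
  proof
    fix y
    define x where "x = ?V *v y"
    have y: "y = x - B *v x"
    proof -
      have "(mat 1 - B) *v x = y" by (simp add: x_def matrix_vector_mul_assoc matrix_inv(1)[OF inv])
      then show ?thesis by (simp add: matrix_vector_mult_diff_rdistrib)
    qed
    have "F *v y = 2 *\<^sub>R x - y"
      by (simp add: F_def x_def matrix_vector_mult_diff_rdistrib matrix_vector_mult_scaleR_left)
    then have Fy: "F *v y = x + B *v x" unfolding y by (simp add: scaleR_2)
    have "Re (hform F y) = (norm x)\<^sup>2 - (norm (B *v x))\<^sup>2"
      unfolding Re_hform Fy unfolding y power2_norm_eq_inner by (simp add: inner_simps inner_commute)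
    moreover have "(norm (B *v x))\<^sup>2 \<le> q\<^sup>2 * (norm x)\<^sup>2"
      using power_mono[OF B[of x], of 2] by (simp add: power_mult_distrib)
    ultimately have "(1 - q\<^sup>2) * (norm x)\<^sup>2 \<le> Re (hform F y)" by (simp add: left_diff_distrib)
    moreover have "(norm y)\<^sup>2 \<le> 4 * (norm x)\<^sup>2"
    proof -
      have "norm y \<le> norm x + norm (B *v x)" unfolding y by (rule norm_triangle_ineq4)
      also have "norm (B *v x) \<le> 1 * norm x" using B[of x] mult_right_mono[of q 1 "norm x"] q by simp
      finally have "norm y \<le> 2 * norm x" by simp
      then show ?thesis using power_mono[of "norm y" "2 * norm x" 2] by (simp add: power_mult_distrib)
    qed
    moreover have "0 \<le> 1 - q\<^sup>2" using q by (simp add: power_le_one)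
    ultimately show "(1 - q\<^sup>2) / 4 * (norm y)\<^sup>2 \<le> Re (hform F y)"
      using mult_left_mono[of "(norm y)\<^sup>2" "4 * (norm x)\<^sup>2" "1 - q\<^sup>2"] by simp
  qed
qed

lemma inner_function_approximation:
  fixes \<theta> :: "complex \<Rightarrow> complex^'n^'n"
  assumes dom: "analytic_multi_connected_domain \<Omega> m \<gamma>"
    and theta_hol: "\<theta> matrix_holomorphic_on \<Omega>" and bound: "\<And>z. z \<in> \<Omega> \<Longrightarrow> opnorm (\<theta> z) \<le> 1"
    and K: "compact K" "K \<subseteq> \<Omega>" and e: "0 < e"
  shows "\<exists>\<Phi>. matrix_inner_function \<Omega> m \<gamma> \<Phi> \<and> (\<forall>z\<in>K. opnorm (\<Phi> z - \<theta> z) \<le> e)"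
proof -
  obtain \<psi> R \<sigma> where cd: "collared_domain \<Omega> m \<psi> R"
    and sig: "\<And>k. k \<le> m \<Longrightarrow> \<sigma> k = 1 \<or> \<sigma> k = (- 1 :: real)"
    and gam: "\<And>k t. k \<le> m \<Longrightarrow> t \<in> {0..1} \<Longrightarrow> \<gamma> k t = \<psi> k (cis (2 * pi * (\<sigma> k * t)))"
    using collared_domain_exists[OF dom] by blast
  interpret collared_domain \<Omega> m \<psi> R by (rule cd)
  obtain r where r: "r < 1" "K \<subseteq> core r" using compact_subset_core[OF K] by blast
  \<comment> \<open>Shrinking \<theta> to q \<theta> makes it a uniformly strict contraction, at a
    cost of at most e / 2 in operator norm. The maximum with 0 is for large
    \<open>e\<close>.\<close>
  define q where "q = max 0 (1 - e / 2)"
  have q: "0 \<le> q" "q < 1" "1 - q \<le> e / 2" using e by (auto simp: q_def max_def)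
  define B where "B z = q *\<^sub>R \<theta> z" for z
  have Bb: "norm (B z *v x) \<le> q * norm x" if "z \<in> \<Omega>" for z x
  proof -
    have "norm (\<theta> z *v x) \<le> 1 * norm x"
      using norm_mult_le_opnorm[of "\<theta> z" x] mult_right_mono[OF bound[OF that], of "norm x"] by simp
    then have "q * norm (\<theta> z *v x) \<le> q * norm x" using q(1) by (simp add: mult_left_mono)
    then show ?thesis using q(1) by (simp add: B_def matrix_vector_mult_scaleR_left)
  qed
  define F where "F z = 2 *\<^sub>R matrix_inv (mat 1 - B z) - mat 1" for z
  have FB: "invertible (mat 1 - B z)" "cayley (F z) = B z" "accretive ((1 - q\<^sup>2) / 4) (F z)" if "z \<in> \<Omega>" for z
    unfolding F_def by (rule inverse_cayley[OF q(1,2) Bb[OF that]])+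
  have "(\<lambda>z. mat 1 - B z) matrix_holomorphic_on \<Omega>"
    using theta_hol unfolding matrix_holomorphic_on_def B_def by (auto intro!: holomorphic_intros simp: scaleR_conv_of_real)
  then have "(\<lambda>z. matrix_inv (mat 1 - B z)) matrix_holomorphic_on \<Omega>"
    by (rule matrix_holomorphic_on_inv) (rule FB(1))
  then have Fhol: "F matrix_holomorphic_on \<Omega>"
    unfolding matrix_holomorphic_on_def F_def by (auto intro!: holomorphic_intros simp: scaleR_conv_of_real)
  have "q\<^sup>2 < 1" using q by (simp add: power_less_one_iff abs_square_less_1)
  then have c: "0 < (1 - q\<^sup>2) / 4" by simp
  \<comment> \<open>The Cayley transform doubles distances at most, so e / 4 here becomes the other
    e / 2.\<close>
  obtain G P E s N a where rs: "refined_sequence \<Omega> m \<psi> R G P E s N a"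
    and close: "\<And>z. z \<in> core r \<Longrightarrow> norm (refined_sequence.limit G z - F z) \<le> e / 4"
    using refined_sequence_exists[OF Fhol c FB(3) r(1), of "e / 4"] e by auto
  interpret S: refined_sequence \<Omega> m \<psi> R G P E s N a by (rule rs)
  define \<Phi> where "\<Phi> z = cayley (S.limit z)" for z
  have inner: "matrix_inner_function \<Omega> m \<gamma> \<Phi>"
    unfolding matrix_inner_function_def
  proof (intro conjI allI impI)
    show "\<Phi> matrix_holomorphic_on \<Omega>"
      unfolding \<Phi>_def[abs_def] by (rule matrix_holomorphic_cayley[OF S.limit_holomorphic S.limit_accretive])
    show "\<exists>B. \<forall>z\<in>\<Omega>. opnorm (\<Phi> z) \<le> B"
      unfolding \<Phi>_def using opnorm_cayley_le S.limit_accretive by blast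
    fix k assume k: "k \<le> m"
    have sph: "sphere 0 1 \<subseteq> annulus (1 / R) R" using R by auto
    have "AE p in arc_length_measure (\<gamma> k). \<exists>w. norm w = 1 \<and> p = \<psi> k w \<and> resonance_free N w"
      by (rule AE_arc_length_resonance_free[OF S.N_pos sig[OF k] hol[OF k] open_annulus sph inj[OF k] gam[OF k]])
    then show "AE p in arc_length_measure (\<gamma> k). \<exists>L. has_nontangential_limit \<Omega> \<Phi> p L \<and> unitary_matrix L"
    proof eventually_elim
      case (elim p)
      then obtain w where "norm w = 1" "p = \<psi> k w" "resonance_free N w" by blast
      then show ?case
        using S.cayley_limit_nontangential[OF k, of w] by (simp add: \<Phi>_def[abs_def] resonance_free_def)
    qed
  qed
  have "opnorm (\<Phi> z - \<theta> z) \<le> e" if z: "z \<in> K" for z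
  proof -
    have zO: "z \<in> \<Omega>" and zc: "z \<in> core r" using z K r by auto
    have "accretive 0 (F z)" using FB(3)[OF zO] c by (intro accretive_mono[of _ "F z" 0]) auto
    then have "opnorm (\<Phi> z - B z) \<le> 2 * norm (S.limit z - F z)"
      using opnorm_cayley_diff_le[OF S.limit_accretive[OF zO], of "F z"] FB(2)[OF zO] by (simp add: \<Phi>_def)
    also have "\<dots> \<le> e / 2" using close[OF zc] by simp
    finally have 1: "opnorm (\<Phi> z - B z) \<le> e / 2" .
    have "B z - \<theta> z = (q - 1) *\<^sub>R \<theta> z" by (simp add: B_def algebra_simps)
    then have "opnorm (B z - \<theta> z) = \<bar>q - 1\<bar> * opnorm (\<theta> z)" by (simp only: opnorm_scaleR)
    also have "\<dots> \<le> (e / 2) * 1" using q bound[OF zO] opnorm_nonneg e by (intro mult_mono) auto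
    finally show ?thesis using 1 opnorm_triangle[of "\<Phi> z - B z" "B z - \<theta> z"] by simp
  qed
  then show ?thesis using inner by blast
qed

theorem theorem3p5:
  fixes \<Omega> :: "complex set" and m :: nat and \<gamma> :: "nat \<Rightarrow> real \<Rightarrow> complex"
    and \<theta> :: "complex \<Rightarrow> complex^'n^'n"
  assumes "analytic_multi_connected_domain \<Omega> m \<gamma>"
    and "\<theta> matrix_holomorphic_on \<Omega>"
    and "\<And>z. z \<in> \<Omega> \<Longrightarrow> opnorm (\<theta> z) \<le> 1"
  shows "\<exists>F :: nat \<Rightarrow> complex \<Rightarrow> complex^'n^'n.
           (\<forall>n. matrix_inner_function \<Omega> m \<gamma> (F n)) \<and>
           (\<forall>K. compact K \<and> K \<subseteq> \<Omega> \<longrightarrow>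
              uniform_limit K (\<lambda>n z. opnorm (F n z - \<theta> z)) (\<lambda>_. 0) sequentially)"
proof -
  have opn: "open \<Omega>" using assms(1) by (simp add: analytic_multi_connected_domain_def)
  \<comment> \<open>An exhaustion by compact sets turns approximation on one compact set into a
    single sequence: the n-th function is within 1/(n + 1) of \<theta> on the n-th set, and every
    compact subset is eventually contained in these sets.\<close>
  have "\<exists>C :: nat \<Rightarrow> complex set. \<forall>n. compact (C n) \<and> C n \<subseteq> \<Omega> \<and>
      (\<forall>K. compact K \<longrightarrow> K \<subseteq> \<Omega> \<longrightarrow> (\<exists>N. \<forall>n\<ge>N. K \<subseteq> C n))"
    by (rule open_Union_compact_subsets[OF opn]) metis
  then obtain C :: "nat \<Rightarrow> complex set" where C: "\<forall>n. compact (C n) \<and> C n \<subseteq> \<Omega> \<and>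
      (\<forall>K. compact K \<longrightarrow> K \<subseteq> \<Omega> \<longrightarrow> (\<exists>N. \<forall>n\<ge>N. K \<subseteq> C n))" ..
  have "\<exists>\<Phi>. matrix_inner_function \<Omega> m \<gamma> \<Phi> \<and> (\<forall>z\<in>C n. opnorm (\<Phi> z - \<theta> z) \<le> inverse (real (Suc n)))" for n
    by (rule inner_function_approximation[OF assms]) (use C in simp_all)
  then obtain F where F: "\<And>n. matrix_inner_function \<Omega> m \<gamma> (F n)"
    "\<And>n z. z \<in> C n \<Longrightarrow> opnorm (F n z - \<theta> z) \<le> inverse (real (Suc n))" by metis
  have "uniform_limit K (\<lambda>n z. opnorm (F n z - \<theta> z)) (\<lambda>_. 0) sequentially" if K: "compact K" "K \<subseteq> \<Omega>" for K
  proof (rule uniform_limitI)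
    fix e :: real assume "0 < e"
    obtain N where N: "\<And>n. N \<le> n \<Longrightarrow> K \<subseteq> C n" using C K by blast
    have "\<forall>\<^sub>F n in sequentially. inverse (real (Suc n)) < e"
      using LIMSEQ_inverse_real_of_nat \<open>0 < e\<close> by (rule order_tendstoD)
    then show "\<forall>\<^sub>F n in sequentially. \<forall>z\<in>K. dist (opnorm (F n z - \<theta> z)) 0 < e"
      using eventually_ge_at_top[of N]
    proof eventually_elim
      case (elim n)
      have "opnorm (F n z - \<theta> z) < e" if "z \<in> K" for z
        using F(2)[of z n] N[OF elim(2)] elim(1) that by (meson le_less_trans subsetD)
      then show ?case by (simp add: abs_of_nonneg[OF opnorm_nonneg])
    qed
  qed
  then show ?thesis using F(1) by blast
qed

end
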